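(* For every $G\in\mathcal F$, $\dim_{\mathbf C} S^G = V(G)$; that is, the dimension of the Specht module of the forest $G$ equals the normalized volume of the matching polytope of $G$.
   Context: $\mathcal F$ is the set of (color-preserving isomorphism classes of) finite bipartitioned forests without isolated vertices: each vertex is colored black or white so that adjacent vertices have different colors. Matching polytope: for a graph $G=(V,E)$ with $n=|E|$ edges, $M_G$ is the set of all $w\colon E\to\mathbf R_{\ge 0}$ such that $\sum_{e\ni v}w(e)\le 1$ for all $v\in V$, viewed as a polytope in $\mathbf R^n$; $V(G)=n!\cdot\operatorname{vol}(M_G)$. Specht module: a diagram $D$ is a finite set of boxes $(i,j)$ with $i,j$ positive integers (row $i$, column $j$). Let $D$ have $n$ boxes, order them arbitrarily, and let the symmetric group $\Sigma_n$ act on them accordingly. Let $R_D\subset\Sigma_n$ (resp. $C_D\subset\Sigma_n$) be the subgroup of permutations that stabilize each row (resp. each column) of $D$, and put $R(D)=\sum_{\sigma\in R_D}\sigma$ and $C(D)=\sum_{\sigma\in C_D}\operatorname{sgn}(\sigma)\sigma$ in $\mathbf C[\Sigma_n]$. The Specht module of $D$ is the left ideal $S^D=\mathbf C[\Sigma_n]C(D)R(D)$, a representation of $\Sigma_n$ by left multiplication. For a bipartitioned bipartite graph $G$, number the white vertices with distinct positive integers and likewise the black vertices, and let $D(G)$ be the diagram containing box $(i,j)$ if and only if $G$ has an edge joining white vertex $i$ and black vertex $j$; then $S^G=S^{D(G)}$, which up to isomorphism does not depend on the numbering. *)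

theory Defs
  imports
    "HOL-Analysis.Analysis"
    "HOL-Algebra.Sym_Groups"
    "HOL-Library.Function_Algebras"
begin

section \<open>Bipartitioned forests\<close>

datatype colour = Black | White

text \<open>Simple undirected graphs: vertex set \<open>V\<close>, edges as two-element subsets of \<open>V\<close>.\<close>

definition finite_simple_graph :: "'v set \<Rightarrow> 'v set set \<Rightarrow> bool" where
  "finite_simple_graph V E \<longleftrightarrow> finite V \<and> (\<forall>e\<in>E. e \<subseteq> V \<and> card e = 2)"

definition proper_bicolouring :: "'v set \<Rightarrow> 'v set set \<Rightarrow> ('v \<Rightarrow> colour) \<Rightarrow> bool" where
  "proper_bicolouring V E col \<longleftrightarrow> (\<forall>u\<in>V. \<forall>v\<in>V. {u, v} \<in> E \<longrightarrow> col u \<noteq> col v)"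

text \<open>A cycle is given by its distinct vertices in cyclic order; there are at least three.\<close>

definition is_cycle :: "'v set set \<Rightarrow> 'v list \<Rightarrow> bool" where
  "is_cycle E vs \<longleftrightarrow> 3 \<le> length vs \<and> distinct vs \<and>
     (\<forall>i<length vs. {vs ! i, vs ! (Suc i mod length vs)} \<in> E)"

definition is_forest :: "'v set \<Rightarrow> 'v set set \<Rightarrow> bool" where
  "is_forest V E \<longleftrightarrow> finite_simple_graph V E \<and> (\<nexists>vs. is_cycle E vs)"

definition no_isolated_vertices :: "'v set \<Rightarrow> 'v set set \<Rightarrow> bool" where
  "no_isolated_vertices V E \<longleftrightarrow> (\<forall>v\<in>V. \<exists>e\<in>E. v \<in> e)"

text \<open>Membership in \<open>\<F>\<close>, for a representative of the isomorphism class.\<close>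

definition bipartitioned_forest :: "'v set \<Rightarrow> 'v set set \<Rightarrow> ('v \<Rightarrow> colour) \<Rightarrow> bool" where
  "bipartitioned_forest V E col \<longleftrightarrow>
     is_forest V E \<and> proper_bicolouring V E col \<and> no_isolated_vertices V E"


section \<open>Matching polytope\<close>

text \<open>Weightings \<open>w : E \<rightarrow> \<real>\<close> are functions that are extensional on \<open>E\<close>, i.e. points of
  \<open>space (\<Pi>\<^sub>M e\<in>E. lborel)\<close>, on which that product measure is \<open>card E\<close>-dimensional Lebesgue
  measure.\<close>

definition matching_polytope :: "'v set \<Rightarrow> 'v set set \<Rightarrow> ('v set \<Rightarrow> real) set" where
  "matching_polytope V E =
     {w \<in> E \<rightarrow>\<^sub>E UNIV. (\<forall>e\<in>E. 0 \<le> w e) \<and> (\<forall>v\<in>V. (\<Sum>e | e \<in> E \<and> v \<in> e. w e) \<le> 1)}"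

definition normalized_volume :: "'v set \<Rightarrow> 'v set set \<Rightarrow> real" where
  "normalized_volume V E =
     fact (card E) * measure (\<Pi>\<^sub>M e\<in>E. lborel) (matching_polytope V E)"


section \<open>Complex group algebras\<close>

text \<open>An element of \<open>\<complex>[G]\<close>, for \<open>G\<close> finite, is its coefficient function, which is \<open>0\<close> outside
  \<open>carrier G\<close>. Addition is pointwise, from Function_Algebras; the pointwise product
  which that theory also provides is not the product of \<open>\<complex>[G]\<close>.\<close>

definition group_algebra :: "('g, 'm) monoid_scheme \<Rightarrow> ('g \<Rightarrow> complex) set" where
  "group_algebra G = {f. \<forall>x. x \<notin> carrier G \<longrightarrow> f x = 0}"

definition ga_mult ::
  "('g, 'm) monoid_scheme \<Rightarrow> ('g \<Rightarrow> complex) \<Rightarrow> ('g \<Rightarrow> complex) \<Rightarrow> 'g \<Rightarrow> complex" where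
  "ga_mult G f g =
     (\<lambda>x. \<Sum>(y, z) | y \<in> carrier G \<and> z \<in> carrier G \<and> y \<otimes>\<^bsub>G\<^esub> z = x. f y * g z)"

definition fun_scale :: "complex \<Rightarrow> ('g \<Rightarrow> complex) \<Rightarrow> 'g \<Rightarrow> complex" where
  "fun_scale c f = (\<lambda>x. c * f x)"

global_interpretation complex_fun: vector_space fun_scale
  defines complex_dim = complex_fun.dim
  by unfold_locales (auto simp: fun_scale_def fun_eq_iff algebra_simps)


section \<open>Specht modules of diagrams\<close>

text \<open>A diagram is a finite set \<open>D\<close> of boxes \<open>(i, j)\<close> (row, column) with \<open>i, j\<close> positive. The
  order on its \<open>n\<close> boxes is a bijection \<open>b\<close> from \<open>{1..n}\<close> to \<open>D\<close>.\<close>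

definition box_ordering :: "(nat \<times> nat) set \<Rightarrow> (nat \<Rightarrow> nat \<times> nat) \<Rightarrow> bool" where
  "box_ordering D b \<longleftrightarrow> bij_betw b {1..card D} D"

definition row_stabilizer :: "nat \<Rightarrow> (nat \<Rightarrow> nat \<times> nat) \<Rightarrow> (nat \<Rightarrow> nat) set" where
  "row_stabilizer n b = {p \<in> carrier (sym_group n).
     \<forall>i. p ` {k \<in> {1..n}. fst (b k) = i} = {k \<in> {1..n}. fst (b k) = i}}"

definition column_stabilizer :: "nat \<Rightarrow> (nat \<Rightarrow> nat \<times> nat) \<Rightarrow> (nat \<Rightarrow> nat) set" where
  "column_stabilizer n b = {p \<in> carrier (sym_group n).
     \<forall>j. p ` {k \<in> {1..n}. snd (b k) = j} = {k \<in> {1..n}. snd (b k) = j}}"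

definition row_symmetrizer :: "nat \<Rightarrow> (nat \<Rightarrow> nat \<times> nat) \<Rightarrow> (nat \<Rightarrow> nat) \<Rightarrow> complex" where
  "row_symmetrizer n b = (\<lambda>p. if p \<in> row_stabilizer n b then 1 else 0)"

definition column_antisymmetrizer :: "nat \<Rightarrow> (nat \<Rightarrow> nat \<times> nat) \<Rightarrow> (nat \<Rightarrow> nat) \<Rightarrow> complex" where
  "column_antisymmetrizer n b =
     (\<lambda>p. if p \<in> column_stabilizer n b then of_int (sign p) else 0)"

definition specht_module ::
  "(nat \<times> nat) set \<Rightarrow> (nat \<Rightarrow> nat \<times> nat) \<Rightarrow> ((nat \<Rightarrow> nat) \<Rightarrow> complex) set" where
  "specht_module D b =
     (let n = card D; G = sym_group n in
      {ga_mult G a (ga_mult G (column_antisymmetrizer n b) (row_symmetrizer n b)) | a.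
         a \<in> group_algebra G})"


section \<open>Diagram of a bipartitioned graph\<close>

definition vertex_numbering ::
  "'v set \<Rightarrow> ('v \<Rightarrow> colour) \<Rightarrow> colour \<Rightarrow> ('v \<Rightarrow> nat) \<Rightarrow> bool" where
  "vertex_numbering V col c num \<longleftrightarrow>
     inj_on num {v \<in> V. col v = c} \<and> (\<forall>v\<in>V. col v = c \<longrightarrow> 0 < num v)"

text \<open>Rows are indexed by white vertices, columns by black ones.\<close>

definition graph_diagram ::
  "'v set \<Rightarrow> 'v set set \<Rightarrow> ('v \<Rightarrow> colour) \<Rightarrow> ('v \<Rightarrow> nat) \<Rightarrow> ('v \<Rightarrow> nat) \<Rightarrow> (nat \<times> nat) set" where
  "graph_diagram V E col r c =
     {(r u, c v) | u v. u \<in> V \<and> v \<in> V \<and> col u = White \<and> col v = Black \<and> {u, v} \<in> E}"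

end

theory Submission
  imports Defs "HOL-Probability.Infinite_Product_Measure"
begin

text \<open>A graph whose edges are numbered \<open>1, \<dots>, n\<close> is recorded by two functions \<open>r\<close> and \<open>c\<close>: the
white endpoint (row) and the black endpoint (column) of every edge. Both sides of the theorem depend
only on these functions, and two arguments, one for each inequality, prove that they agree.

Upper bound. Let \<open>e1\<close> and \<open>e2\<close> be edges of \<open>G\<close> in a common row, where \<open>e2\<close> is alone in its column.
Let \<open>G''\<close> arise from \<open>G\<close> by moving \<open>e1\<close> to a new row, and \<open>G'\<close> from \<open>G''\<close> by moving \<open>e2\<close> to the column of
\<open>e1\<close>. The hyperplane \<open>w e1 = w e2\<close> cuts the matching polytope of \<open>G''\<close> into two pieces, and subtracting
the smaller of the two coordinates from the larger one carries the pieces onto the polytopes of \<open>G\<close>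
and \<open>G'\<close>; so \<open>V(G'') = V(G) + V(G')\<close> (\<open>matching_volume_recurrence\<close>). On the side of the
representations, as in the work of James and Peel, \<open>S(G')\<close> is contained in \<open>S(G'')\<close>, and right
multiplication by a multiple of \<open>R(G)\<close> maps \<open>S(G'')\<close> onto \<open>S(G)\<close>. It kills \<open>S(G')\<close>, because the
transposition of \<open>e1\<close> and \<open>e2\<close> preserves the columns of \<open>G'\<close> and the rows of \<open>G\<close>. Hence
\<open>dim S(G) + dim S(G') \<le> dim S(G'')\<close> (\<open>specht_ideal_exchange\<close>). Both graphs \<open>G'\<close> and \<open>G''\<close> are forests
again, and \<open>G''\<close> has one vertex more than \<open>G\<close>. Induction ends at \<open>n\<close> disjoint edges, where both sides
are \<open>n!\<close>, and (up to exchanging rows and columns) gives \<open>dim S(G) \<le> V(G'') - dim S(G')\<close>; this is at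
most \<open>V(G)\<close> once \<open>V(G') \<le> dim S(G')\<close>.

Lower bound. Draw every tree in the plane and call a numbering of the edges standard if the
numbers that one meets around each vertex are in cyclic order (with the number of one preceding edge
as the starting point). The map sending \<open>y\<close> in the unit cube to
\<open>w e = frac (y e - y (edge preceding e))\<close> preserves volume, and \<open>w\<close> lies in the matching polytope
if and only if the coordinates of \<open>y\<close> are ordered like a standard numbering. Each of the \<open>n!\<close> possible
orders has probability \<open>1 / n!\<close>, so \<open>V(G)\<close> is the number of standard numberings
(\<open>matching_volume_count\<close>). For a standard numbering \<open>\<sigma>\<close> consider the element \<open>\<sigma> C R\<close> of \<open>S(G)\<close>. If its
coefficient at \<open>x\<close> is nonzero, then permuting the entries of \<open>x\<close> within rows and those of \<open>\<sigma>\<close> within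
columns can produce the same numbering. On standard numberings this relation has no cycles except
loops (\<open>periodic_standard_constant\<close>), so the elements \<open>\<sigma> C R\<close> form a triangular system and are
linearly independent.\<close>

section \<open>Plane trees and standard labellings\<close>

definition cyclic_triple :: "'l::linorder \<Rightarrow> 'l \<Rightarrow> 'l \<Rightarrow> bool" where
  "cyclic_triple x y z \<longleftrightarrow> x < y \<and> y < z \<or> y < z \<and> z < x \<or> z < x \<and> x < y"

text \<open>Trees are built from their edges. In \<open>Join s b\<close> the branch \<open>b\<close> is hung at the root vertex of \<open>s\<close>, after
all edges that \<open>s\<close> has there. It is attached by its first edge: one end of that edge is the root of
\<open>s\<close>, the other end is the root of \<open>b\<close>. So the first edge of every tree ends in a vertex that has no
further edge inside that tree.\<close>

datatype 'e plane_tree = Leaf 'e | Join "'e plane_tree" "'e plane_tree"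

fun edges :: "'e plane_tree \<Rightarrow> 'e set" where
  "edges (Leaf f) = {f}"
| "edges (Join s b) = edges s \<union> edges b"

fun first_edge :: "'e plane_tree \<Rightarrow> 'e" where
  "first_edge (Leaf f) = f"
| "first_edge (Join s b) = first_edge s"

fun last_edge :: "'e plane_tree \<Rightarrow> 'e" where
  "last_edge (Leaf f) = f"
| "last_edge (Join s b) = first_edge b"

text \<open>The root vertex is the column of the first edge. A branch is rooted at the row of its first edge, so
that \<open>r\<close> and \<open>c\<close> change places in the recursive call.\<close>

fun drawing :: "('e \<Rightarrow> nat) \<Rightarrow> ('e \<Rightarrow> nat) \<Rightarrow> 'e plane_tree \<Rightarrow> bool" where
  "drawing r c (Leaf f) \<longleftrightarrow> True"
| "drawing r c (Join s b) \<longleftrightarrow> drawing r c s \<and> drawing c r b \<and> c (first_edge b) = c (first_edge s) \<and>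
     (\<forall>e\<in>edges s. \<forall>e'\<in>edges b. r e \<noteq> r e' \<and>
        (c e = c e' \<longrightarrow> e' = first_edge b \<and> c e = c (first_edge s)))"

text \<open>Here \<open>p\<close> is the label that precedes the root. Around the root one must meet \<open>p\<close> and then the labels
of the root edges in cyclic order; it is enough to compare each new edge with \<open>p\<close> and with the
previous one. For a branch, the preceding label is that of the root edge to its left.\<close>

fun standard :: "'l::linorder \<Rightarrow> ('e \<Rightarrow> 'l) \<Rightarrow> 'e plane_tree \<Rightarrow> bool" where
  "standard p T (Leaf f) \<longleftrightarrow> True"
| "standard p T (Join s b) \<longleftrightarrow> standard p T s \<and> standard (T (last_edge s)) T b \<and>
     cyclic_triple p (T (last_edge s)) (T (first_edge b))"

lemma finite_edges [simp]: "finite (edges t)"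
  by (induction t) auto

lemma first_edge_in_edges [simp]: "first_edge t \<in> edges t"
  by (induction t) auto

lemma last_edge_in_edges [simp]: "last_edge t \<in> edges t"
  by (induction t) auto

lemma drawing_disjoint: "drawing r c (Join s b) \<Longrightarrow> edges s \<inter> edges b = {}"
  by fastforce

text \<open>The far end of the first edge is a leaf, because hanging branches only ever adds edges at the root
or strictly inside a branch.\<close>

lemma first_edge_pendant:
  "drawing r c t \<Longrightarrow> e \<in> edges t \<Longrightarrow> r e = r (first_edge t) \<Longrightarrow> e = first_edge t"
  by (induction t) (force+)

lemma standard_cong:
  assumes "\<And>e. e \<in> edges t \<Longrightarrow> T e = T' e"
  shows "standard p T t = standard p T' t"
  using assms
proof (induction t arbitrary: p)
  case (Join s b)
  have "T (last_edge s) = T' (last_edge s)" "T (first_edge b) = T' (first_edge b)"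
    using Join.prems by (auto intro: Join.prems)
  moreover have "standard p T s = standard p T' s" "standard q T b = standard q T' b" for q
    using Join by auto
  ultimately show ?case by simp
qed simp


section \<open>Acyclicity of row and column exchanges\<close>

text \<open>A witness \<open>S\<close> arises from \<open>T\<close> by permuting labels within rows, and from \<open>T'\<close> by permuting labels within
columns.\<close>

definition exchangeable ::
  "('e \<Rightarrow> nat) \<Rightarrow> ('e \<Rightarrow> nat) \<Rightarrow> 'e set \<Rightarrow> ('e \<Rightarrow> nat) \<Rightarrow> ('e \<Rightarrow> nat) \<Rightarrow> bool" where
  "exchangeable r c E T T' \<longleftrightarrow> (\<exists>S. inj_on S E \<and>
     (\<forall>i. S ` {e\<in>E. r e = i} = T ` {e\<in>E. r e = i}) \<and>
     (\<forall>j. S ` {e\<in>E. c e = j} = T' ` {e\<in>E. c e = j}))"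

lemma exchangeable_sym: "exchangeable r c E T T' \<longleftrightarrow> exchangeable c r E T' T"
  unfolding exchangeable_def by blast

lemma exchangeable_cong:
  assumes "\<And>e. e \<in> E \<Longrightarrow> T e = U e" "\<And>e. e \<in> E \<Longrightarrow> T' e = U' e"
  shows "exchangeable r c E T T' \<longleftrightarrow> exchangeable r c E U U'"
proof -
  have "T ` {e\<in>E. r e = i} = U ` {e\<in>E. r e = i}" "T' ` {e\<in>E. c e = i} = U' ` {e\<in>E. c e = i}" for i
    using assms by (auto intro!: image_cong)
  then show ?thesis unfolding exchangeable_def by simp
qed

lemma image_eq_on_union_of_fibres:
  assumes "\<And>i. S ` {e\<in>E. r e = i} = T ` {e\<in>E. r e = i}" and "A \<subseteq> E"
    and "\<And>e e'. e \<in> A \<Longrightarrow> e' \<in> E \<Longrightarrow> r e' = r e \<Longrightarrow> e' \<in> A"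
  shows "S ` A = T ` A"
proof -
  have A: "A = (\<Union>e\<in>A. {e'\<in>E. r e' = r e})" using assms(2,3) by auto
  have "S ` A = (\<Union>e\<in>A. S ` {e'\<in>E. r e' = r e})" by (subst A) (simp add: image_UN)
  also have "\<dots> = (\<Union>e\<in>A. T ` {e'\<in>E. r e' = r e})" by (simp add: assms(1))
  also have "\<dots> = T ` A" by (subst (2) A) (simp add: image_UN)
  finally show ?thesis .
qed

lemma sum_eq_if_same_image:
  assumes "inj_on U E" "inj_on U' E" "A \<subseteq> E" "U ` A = U' ` A"
  shows "(\<Sum>e\<in>A. h (U e)) = (\<Sum>e\<in>A. h (U' e))"
proof -
  have "(\<Sum>e\<in>A. h (U e)) = sum h (U ` A)"
    using inj_on_subset[OF assms(1,3)] by (simp add: sum.reindex)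
  also have "\<dots> = (\<Sum>e\<in>A. h (U' e))"
    using inj_on_subset[OF assms(2,3)] by (simp add: sum.reindex assms(4))
  finally show ?thesis .
qed

text \<open>Ordering labels by this key is the same as listing them cyclically from \<open>p\<close> onwards: labels above \<open>p\<close>
get keys in \<open>[-1, 0)\<close> and labels below \<open>p\<close> get keys in \<open>[0, 1)\<close>. Taking values in a bounded interval
of reals avoids a bound on the labels.\<close>

definition cyclic_key :: "nat \<Rightarrow> nat \<Rightarrow> real" where
  "cyclic_key p l = (if p < l then 0 else 1) - 1 / (real l + 1)"

lemma cyclic_key_less_iff:
  assumes "a \<noteq> p" "b \<noteq> p"
  shows "cyclic_key p a < cyclic_key p b \<longleftrightarrow> cyclic_triple p a b"
proof -
  have mono: "1 / (real b + 1) < 1 / (real a + 1) \<longleftrightarrow> a < b" for a b :: nat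
    by (simp add: field_simps)
  have range: "0 < 1 / (real a + 1)" "1 / (real a + 1) \<le> 1" for a :: nat
    by (auto simp: field_simps)
  have *: "1 / (real b + 1) < 1 + 1 / (real a + 1)" for a b :: nat
    using range(1)[of a] range(2)[of b] by linarith
  show ?thesis
    using assms mono[of b a] *[of a b] *[of b a] 
    unfolding cyclic_key_def cyclic_triple_def by (auto simp: not_less)
qed

lemma cyclic_key_inj: "inj_on (cyclic_key p) {l. l \<noteq> p}"
proof (rule inj_onI)
  fix a b assume "a \<in> {l. l \<noteq> p}" "b \<in> {l. l \<noteq> p}" "cyclic_key p a = cyclic_key p b"
  then have "\<not> cyclic_triple p a b" "\<not> cyclic_triple p b a" "a \<noteq> p" "b \<noteq> p"
    using cyclic_key_less_iff[of a p b] cyclic_key_less_iff[of b p a] by auto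
  then show "a = b" unfolding cyclic_triple_def by auto
qed

text \<open>Consecutive root edges increase in the key, so the last root edge has the largest one.\<close>

lemma standard_last_edge_max:
  assumes "drawing r c t" "standard p T t" "\<And>e. e \<in> edges t \<Longrightarrow> T e \<noteq> p"
    and "e \<in> edges t" "c e = c (first_edge t)"
  shows "cyclic_key p (T e) \<le> cyclic_key p (T (last_edge t))"
  using assms
proof (induction t arbitrary: e)
  case (Join s b)
  have less: "cyclic_key p (T (last_edge s)) < cyclic_key p (T (first_edge b))"
    using Join.prems(2,3) by (subst cyclic_key_less_iff) auto
  consider "e \<in> edges s" | "e \<in> edges b" using Join.prems(4) by auto
  then show ?case
  proof cases
    case 1
    then have "cyclic_key p (T e) \<le> cyclic_key p (T (last_edge s))"
      using Join.IH(1)[of e] Join.prems by auto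
    with less show ?thesis by simp
  next
    case 2
    then have "e = first_edge b" using Join.prems(1,5) first_edge_in_edges[of s] by fastforce
    then show ?thesis by simp
  qed
qed simp

lemma periodic_monotone_constant:
  fixes g :: "nat \<Rightarrow> real"
  assumes "\<And>j. g j \<le> g (Suc j)" "\<And>j. g (j + N) = g j" "0 < N"
  shows "g (Suc j) = g j"
proof -
  have "g (Suc j) \<le> g (j + N)" 
    by (rule lift_Suc_mono_le[of g, OF assms(1)]) (use assms(3) in simp)
  also have "\<dots> = g j" by (rule assms(2))
  finally show ?thesis using assms(1)[of j] by (rule antisym)
qed

text \<open>Reading a periodic chain of exchanges backwards swaps the roles of rows and columns. Stepping
by \<open>N - 1\<close> is stepping by \<open>-1\<close> modulo the period.\<close>

lemma periodic_exchange_reverse: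
  assumes N: "1 < N" and per: "\<And>j e. e \<in> E \<Longrightarrow> T (j + N) e = T j e"
    and ex: "\<And>j. exchangeable r c E (T j) (T (Suc j))"
  defines "R \<equiv> \<lambda>j. T ((N - 1) * j)"
  shows "\<And>j e. e \<in> E \<Longrightarrow> R (j + N) e = R j e"
    and "\<And>j. exchangeable c r E (R j) (R (Suc j))"
    and "\<And>j e. e \<in> E \<Longrightarrow> T j e = R ((N - 1) * j) e"
proof -
  have multiple: "T (j + k * N) e = T j e" if "e \<in> E" for j k e
    by (induction k) (use per[of e] that in \<open>auto simp: add.assoc[symmetric] add.commute[of N]\<close>)
  show "R (j + N) e = R j e" if "e \<in> E" for j e
    unfolding R_def distrib_left by (rule multiple[OF that])
  show "exchangeable c r E (R j) (R (Suc j))" for j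
  proof -
    have "Suc ((N - 1) * Suc j) = (N - 1) * j + N" using N by simp
    then have "exchangeable r c E (R (Suc j)) (T ((N - 1) * j + N))"
      using ex[of "(N - 1) * Suc j"] by (simp only: R_def)
    then have "exchangeable r c E (R (Suc j)) (R j)"
      by (rule exchangeable_cong[THEN iffD1, rotated -1]) (auto simp: R_def per)
    then show ?thesis by (simp add: exchangeable_sym)
  qed
  show "T j e = R ((N - 1) * j) e" if "e \<in> E" for j e
  proof -
    obtain m where m: "N = m + 2" using less_imp_Suc_add[OF N] by auto
    have "T j e = T (j + (m * j) * N) e" using multiple[OF that] by simp
    also have "j + (m * j) * N = (N - 1) * ((N - 1) * j)" by (simp add: m algebra_simps)
    finally show ?thesis by (simp only: R_def)
  qed
qed

text \<open>The exchange relation has no cycles on standard labellings. In \<open>Join s b\<close> let \<open>f\<close> be the first edge of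
\<open>b\<close>, and let \<open>S\<close> be the labelling between \<open>T j\<close> and \<open>T (j + 1)\<close>. Every row that meets \<open>b\<close> lies in \<open>b\<close>, so \<open>S\<close>
and \<open>T j\<close> use the same labels on \<open>b\<close>; every column that meets \<open>b\<close>, other than the root, lies in \<open>b\<close>, so
\<open>S\<close> and \<open>T (j + 1)\<close> use the same labels on \<open>b\<close> without \<open>f\<close>. The label \<open>S f\<close> occurs in the root column of
\<open>T (j + 1)\<close>, where \<open>f\<close> has the largest key. Hence the sum of the keys over \<open>b\<close> never decreases, and since
the chain is periodic it is constant and \<open>S f = T (j + 1) f\<close>. After that \<open>s\<close> and \<open>b\<close> no longer interact.
By induction the labels on \<open>s\<close> are constant, in particular the label that precedes \<open>b\<close>; this makes the
induction hypothesis applicable to \<open>b\<close>, with rows and columns exchanged.\<close>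

lemma periodic_standard_constant:
  assumes "drawing r c t" "1 < N"
    and "\<And>j e. e \<in> edges t \<Longrightarrow> T (j + N) e = T j e"
    and "\<And>j. inj_on (T j) (edges t)"
    and "\<And>j e. e \<in> edges t \<Longrightarrow> T j e \<noteq> p"
    and "\<And>j. standard p (T j) t"
    and "\<And>j. exchangeable r c (edges t) (T j) (T (Suc j))"
    and "e \<in> edges t"
  shows "T j e = T 0 e"
  using assms
proof (induction t arbitrary: r c T p e j)
  case (Leaf f)
  have *: "T (Suc j) f = T j f" for j
  proof -
    obtain S where S: "\<And>i. S ` {e\<in>{f}. r e = i} = T j ` {e\<in>{f}. r e = i}"
        "\<And>i. S ` {e\<in>{f}. c e = i} = T (Suc j) ` {e\<in>{f}. c e = i}"
      using Leaf.prems(7)[of j] unfolding exchangeable_def by auto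
    have "{e\<in>{f}. r e = r f} = {f}" "{e\<in>{f}. c e = c f} = {f}" by auto
    with S(1)[of "r f"] S(2)[of "c f"] show ?thesis by simp
  qed
  have "T j f = T 0 f" by (induction j) (simp_all add: *)
  then show ?case using Leaf.prems(8) by simp
next
  case (Join s b)
  define f where "f = first_edge b"
  define l where "l = last_edge s"
  let ?E = "edges s \<union> edges b"
  note draw = Join.prems(1)
  have ds: "drawing r c s" and db: "drawing c r b" and cf: "c f = c (first_edge s)"
    using draw by (auto simp: f_def)
  have disj: "edges s \<inter> edges b = {}" using draw by (rule drawing_disjoint)
  have rdiff: "r e \<noteq> r e'" if "e \<in> edges s" "e' \<in> edges b" for e e'
    using draw that by auto
  have cdiff: "e' = f \<and> c e = c f" if "e \<in> edges s" "e' \<in> edges b" "c e = c e'" for e e'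
    using draw that by (auto simp: f_def)
  have fb: "f \<in> edges b" by (simp add: f_def)
  have ls: "l \<in> edges s" by (simp add: l_def)
  have funique: "e = f" if "e \<in> edges b" "c e = c f" for e
    using first_edge_pendant[OF db that(1)] that(2) by (simp add: f_def)
  have inj: "inj_on (T j) ?E" for j using Join.prems(4)[of j] by simp
  have np: "T j e \<noteq> p" if "e \<in> ?E" for j e using Join.prems(5)[of e j] that by simp
  have st: "standard p (T j) s" "standard (T j l) (T j) b" "cyclic_triple p (T j l) (T j f)" for j
    using Join.prems(6)[of j] by (auto simp: l_def f_def)
  have per: "T (j + N) e = T j e" if "e \<in> ?E" for j e using Join.prems(3)[of e j] that by simp
  define w where "w j = (\<Sum>e\<in>edges b. cyclic_key p (T j e))" for j
  \<comment> \<open>\<open>S j\<close> has the rows of \<open>T j\<close> and the columns of \<open>T (Suc j)\<close>.\<close>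
  have "\<forall>j. \<exists>S. inj_on S ?E \<and> (\<forall>i. S ` {e\<in>?E. r e = i} = T j ` {e\<in>?E. r e = i}) \<and>
      (\<forall>i. S ` {e\<in>?E. c e = i} = T (Suc j) ` {e\<in>?E. c e = i})"
    using Join.prems(7) unfolding exchangeable_def by simp
  then obtain S where Sinj: "\<And>j. inj_on (S j) ?E"
    and Sr: "\<And>j i. S j ` {e\<in>?E. r e = i} = T j ` {e\<in>?E. r e = i}"
    and Sc: "\<And>j i. S j ` {e\<in>?E. c e = i} = T (Suc j) ` {e\<in>?E. c e = i}"
    by metis
  have Sb: "S j ` edges b = T j ` edges b" for j
    by (rule image_eq_on_union_of_fibres[OF Sr]) (use rdiff in fastforce)+
  have Sb': "S j ` (edges b - {f}) = T (Suc j) ` (edges b - {f})" for j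
  proof (rule image_eq_on_union_of_fibres[OF Sc])
    fix e e' assume e: "e \<in> edges b - {f}" "e' \<in> ?E" "c e' = c e"
    show "e' \<in> edges b - {f}"
    proof
      show "e' \<in> edges b" using e cdiff[of e' e] by auto
      show "e' \<notin> {f}" using e funique[of e] by auto
    qed
  qed auto
  have Sall: "S j ` ?E = T j ` ?E" for j
    by (rule image_eq_on_union_of_fibres[OF Sr]) auto
  have Snp: "S j e \<noteq> p" if "e \<in> ?E" for j e
    using Sall[of j] np[of _ j] that by (metis imageE imageI)
  \<comment> \<open>\<open>S j f\<close> is some label in the root column of \<open>T (Suc j)\<close>, where \<open>f\<close> is the last edge.\<close>
  have Sf: "cyclic_key p (S j f) \<le> cyclic_key p (T (Suc j) f)" for j
  proof -
    have "S j f \<in> S j ` {e\<in>?E. c e = c f}" using fb by auto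
    then obtain e where e: "e \<in> ?E" "c e = c f" "S j f = T (Suc j) e" using Sc by auto
    show ?thesis
    proof (cases "e \<in> edges b")
      case True
      then show ?thesis using funique[of e] e by simp
    next
      case False
      then have "e \<in> edges s" using e by simp
      then have "cyclic_key p (T (Suc j) e) \<le> cyclic_key p (T (Suc j) l)"
        using standard_last_edge_max[OF ds st(1), of "Suc j" e] np[of _ "Suc j"] e(2) cf
        by (simp add: l_def)
      also have "\<dots> < cyclic_key p (T (Suc j) f)"
        using st(3) np ls fb by (subst cyclic_key_less_iff) auto
      finally show ?thesis using e by simp
    qed
  qed
  have wS: "w j = (\<Sum>e\<in>edges b. cyclic_key p (S j e))" for j
    unfolding w_def by (rule sum_eq_if_same_image[OF inj Sinj]) (simp_all only: Un_upper2 Sb)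
  have rest: "(\<Sum>e\<in>edges b - {f}. cyclic_key p (S j e))
      = (\<Sum>e\<in>edges b - {f}. cyclic_key p (T (Suc j) e))" for j
    by (rule sum_eq_if_same_image[OF Sinj inj _ Sb']) blast
  have step: "w (Suc j) - w j = cyclic_key p (T (Suc j) f) - cyclic_key p (S j f)" for j
    unfolding wS[of j] unfolding w_def
    using sum.remove[OF finite_edges fb, of "\<lambda>e. cyclic_key p (S j e)"]
      sum.remove[OF finite_edges fb, of "\<lambda>e. cyclic_key p (T (Suc j) e)"] rest[of j] by simp
  have "w j \<le> w (Suc j)" for j using step[of j] Sf[of j] by simp
  moreover have "w (j + N) = w j" for j unfolding w_def by (rule sum.cong) (auto simp: per)
  ultimately have "w (Suc j) = w j" for j
    using periodic_monotone_constant[of w N j] Join.prems(2) by auto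
  then have key: "cyclic_key p (S j f) = cyclic_key p (T (Suc j) f)" for j using step[of j] by simp
  have Sf: "S j f = T (Suc j) f" for j
  proof (rule inj_onD[OF cyclic_key_inj key])
    show "S j f \<in> {l. l \<noteq> p}" using Snp[of f j] fb by simp
    show "T (Suc j) f \<in> {l. l \<noteq> p}" using np[of f "Suc j"] fb by simp
  qed
  have Ss: "S j ` edges s = T j ` edges s" for j
    by (rule image_eq_on_union_of_fibres[OF Sr]) (use rdiff in fastforce)+
  have ex_s: "exchangeable r c (edges s) (T j) (T (Suc j))" for j
    unfolding exchangeable_def
  proof (intro exI[of _ "S j"] conjI allI)
    show "inj_on (S j) (edges s)" using Sinj by (rule inj_on_subset) auto
    show "S j ` {e \<in> edges s. r e = i} = T j ` {e \<in> edges s. r e = i}" for i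
      by (rule image_eq_on_union_of_fibres[OF Sr]) (use rdiff in fastforce)+
    show "S j ` {e \<in> edges s. c e = i} = T (Suc j) ` {e \<in> edges s. c e = i}" for i
    proof (cases "i = c f")
      case False
      show ?thesis
        by (rule image_eq_on_union_of_fibres[OF Sc]) (use False cdiff in fastforce)+
    next
      case True
      have *: "U ` {e \<in> edges s. c e = i} = U ` {e \<in> ?E. c e = i} - {U f}" if "inj_on U ?E" for U :: "_ \<Rightarrow> nat"
      proof -
        have "{e \<in> edges s. c e = i} = {e \<in> ?E. c e = i} - {f}"
          using True funique disj fb by auto
        then show ?thesis
          using inj_on_image_set_diff[OF that, of "{e \<in> ?E. c e = i}" "{f}"] fb by auto
      qed
      show ?thesis using *[OF Sinj] *[OF inj] Sc Sf by simp
    qed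
  qed
  have const_s: "T j e = T 0 e" if "e \<in> edges s" for j e
  proof (rule Join.IH(1)[where T = T and p = p, OF ds Join.prems(2)])
    show "T (j + N) e = T j e" if "e \<in> edges s" for j e using per that by simp
    show "inj_on (T j) (edges s)" for j by (rule inj_on_subset[OF inj]) auto
    show "T j e \<noteq> p" if "e \<in> edges s" for j e using np that by simp
  qed (fact st(1) ex_s that)+
  have ex_b: "exchangeable r c (edges b) (T j) (T (Suc j))" for j
    unfolding exchangeable_def
  proof (intro exI[of _ "S j"] conjI allI)
    show "inj_on (S j) (edges b)" using Sinj by (rule inj_on_subset) auto
    show "S j ` {e \<in> edges b. r e = i} = T j ` {e \<in> edges b. r e = i}" for i
      by (rule image_eq_on_union_of_fibres[OF Sr]) (use rdiff in fastforce)+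
    show "S j ` {e \<in> edges b. c e = i} = T (Suc j) ` {e \<in> edges b. c e = i}" for i
    proof (cases "i = c f")
      case False
      show ?thesis
        by (rule image_eq_on_union_of_fibres[OF Sc]) (use False cdiff in fastforce)+
    next
      case True
      then have "{e \<in> edges b. c e = i} = {f}" using funique fb by auto
      then show ?thesis using Sf by simp
    qed
  qed
  define q where "q = T 0 l"
  have q: "T j l = q" for j using const_s[OF ls] by (simp add: q_def)
  define R where "R j = T ((N - 1) * j)" for j
  have per_b: "T (j + N) e = T j e" if "e \<in> edges b" for j e using per that by simp
  note reverse = periodic_exchange_reverse[where E = "edges b" and T = T, OF Join.prems(2) per_b ex_b]
  have R_per: "R (j + N) e = R j e" if "e \<in> edges b" for j e
    unfolding R_def using reverse(1) that by blast
  have R_ex: "exchangeable c r (edges b) (R j) (R (Suc j))" for j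
    unfolding R_def using reverse(2) by blast
  have T_R: "T j e = R ((N - 1) * j) e" if "e \<in> edges b" for j e
    unfolding R_def using reverse(3) that by blast
  have const_R: "R j e = R 0 e" if "e \<in> edges b" for j e
  proof (rule Join.IH(2)[where T = R and p = q, OF db Join.prems(2)])
    show "R (j + N) e = R j e" if "e \<in> edges b" for j e using that by (rule R_per)
    show "inj_on (R j) (edges b)" for j unfolding R_def by (rule inj_on_subset[OF inj]) auto
    show "R j e \<noteq> q" if "e \<in> edges b" for j e
      using inj_onD[OF inj, of "(N - 1) * j" e l] that ls disj q by (auto simp: R_def)
    show "standard q (R j) b" for j using st(2)[of "(N - 1) * j"] q by (simp add: R_def)
  qed (fact R_ex that)+
  have const_b: "T j e = T 0 e" if "e \<in> edges b" for j e
    using T_R[OF that, of j] T_R[OF that, of 0] const_R[OF that] by simp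
  show ?case using const_s const_b Join.prems(8) by auto
qed

section \<open>Forests and their drawings\<close>

text \<open>A graph is a forest if and only if every nonempty set of edges contains one that has an end of degree
one in that set. This form passes to subgraphs at once and supports induction by removing a leaf.\<close>

definition forest :: "'e set \<Rightarrow> ('e \<Rightarrow> nat) \<Rightarrow> ('e \<Rightarrow> nat) \<Rightarrow> bool" where
  "forest E r c \<longleftrightarrow> finite E \<and> (\<forall>F\<subseteq>E. F \<noteq> {} \<longrightarrow>
     (\<exists>e\<in>F. (\<forall>e'\<in>F. r e' = r e \<longrightarrow> e' = e) \<or> (\<forall>e'\<in>F. c e' = c e \<longrightarrow> e' = e)))"

lemma forest_swap: "forest E r c \<longleftrightarrow> forest E c r"
proof -
  have "forest E c r" if "forest E r c" for r c :: "'a \<Rightarrow> nat"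
    unfolding forest_def
  proof (intro conjI allI impI)
    show "finite E" using that by (simp add: forest_def)
    fix F assume "F \<subseteq> E" "F \<noteq> {}"
    with that obtain e where "e \<in> F"
      "(\<forall>e'\<in>F. r e' = r e \<longrightarrow> e' = e) \<or> (\<forall>e'\<in>F. c e' = c e \<longrightarrow> e' = e)"
      unfolding forest_def by metis
    then show "\<exists>e\<in>F. (\<forall>e'\<in>F. c e' = c e \<longrightarrow> e' = e) \<or> (\<forall>e'\<in>F. r e' = r e \<longrightarrow> e' = e)"
      by (intro bexI[of _ e]) (simp_all only: disj_commute)
  qed
  then show ?thesis by blast
qed

lemma forest_subset: "forest E r c \<Longrightarrow> F \<subseteq> E \<Longrightarrow> forest F r c"
  unfolding forest_def by (simp add: finite_subset)

lemma forest_leaf: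
  assumes "forest E r c" "F \<subseteq> E" "F \<noteq> {}"
  obtains e where "e \<in> F" "\<And>e'. e' \<in> F \<Longrightarrow> r e' = r e \<Longrightarrow> e' = e"
  | e where "e \<in> F" "\<And>e'. e' \<in> F \<Longrightarrow> c e' = c e \<Longrightarrow> e' = e"
proof -
  have "\<exists>e\<in>F. (\<forall>e'\<in>F. r e' = r e \<longrightarrow> e' = e) \<or> (\<forall>e'\<in>F. c e' = c e \<longrightarrow> e' = e)"
    using assms by (simp add: forest_def)
  then show ?thesis using that by metis
qed

lemma forest_inj:
  assumes "forest E r c"
  shows "inj_on (\<lambda>e. (r e, c e)) E"
proof (rule inj_onI)
  fix e e' assume *: "e \<in> E" "e' \<in> E" "(r e, c e) = (r e', c e')"
  then have "{e, e'} \<subseteq> E" "{e, e'} \<noteq> {}" by auto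
  with assms show "e = e'"
  proof (rule forest_leaf)
    fix d assume "d \<in> {e, e'}" "\<And>d'. d' \<in> {e, e'} \<Longrightarrow> r d' = r d \<Longrightarrow> d' = d"
    from this(1) this(2)[of e] this(2)[of e'] *(3) show ?thesis by auto
  next
    fix d assume "d \<in> {e, e'}" "\<And>d'. d' \<in> {e, e'} \<Longrightarrow> c d' = c d \<Longrightarrow> d' = d"
    from this(1) this(2)[of e] this(2)[of e'] *(3) show ?thesis by auto
  qed
qed

text \<open>A set containing \<open>e1\<close> has the leaf \<open>e1\<close>, which is alone in the new row; other sets see no change.\<close>

lemma forest_split:
  assumes "forest E r c" "x \<notin> r ` E"
  shows "forest E (r(e1 := x)) c"
  unfolding forest_def
proof (intro conjI allI impI)
  show "finite E" using assms(1) by (simp add: forest_def)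
  fix F assume F: "F \<subseteq> E" "F \<noteq> {}"
  let ?leaf = "\<lambda>r. \<exists>e\<in>F. (\<forall>e'\<in>F. r e' = r e \<longrightarrow> e' = e) \<or> (\<forall>e'\<in>F. c e' = c e \<longrightarrow> e' = e)"
  show "?leaf (r(e1 := x))"
  proof (cases "e1 \<in> F")
    case True
    then show ?thesis using F(1) assms(2) by (auto intro!: bexI[of _ e1])
  next
    case False
    have "?leaf r" using assms(1) F unfolding forest_def by blast
    with False show ?thesis by (auto simp: fun_upd_def)
  qed
qed

text \<open>A set containing \<open>e1\<close> has the leaf \<open>e1\<close>. In a set that contains \<open>e2\<close> but not \<open>e1\<close>, the moved edge \<open>e2\<close>
has the ends that \<open>e1\<close> had in the original graph, so renaming it to \<open>e1\<close> gives an isomorphic subgraph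
of the original forest.\<close>

lemma forest_slide:
  assumes "forest E r c" "x \<notin> r ` E" "e1 \<in> E" "e2 \<in> E" "e1 \<noteq> e2" "r e1 = r e2"
  shows "forest E (r(e1 := x)) (c(e2 := c e1))"
  unfolding forest_def
proof (intro conjI allI impI)
  show "finite E" using assms(1) by (simp add: forest_def)
  fix F assume F: "F \<subseteq> E" "F \<noteq> {}"
  let ?r = "r(e1 := x)" and ?c = "c(e2 := c e1)"
  let ?leaf = "\<lambda>F r c. \<exists>e\<in>F. (\<forall>e'\<in>F. r e' = r e \<longrightarrow> e' = e) \<or> (\<forall>e'\<in>F. c e' = c e \<longrightarrow> e' = e)"
  have leaf: "?leaf F r c" if "F \<subseteq> E" "F \<noteq> {}" for F
    using assms(1) that unfolding forest_def by blast
  consider "e1 \<in> F" | "e1 \<notin> F" "e2 \<notin> F" | "e1 \<notin> F" "e2 \<in> F" by blast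
  then show "?leaf F ?r ?c"
  proof cases
    case 1
    then show ?thesis using F(1) assms(2) by (auto intro!: bexI[of _ e1])
  next
    case 2
    then show ?thesis using leaf[OF F] by (auto simp: fun_upd_def)
  next
    case 3
    \<comment> \<open>In the slid graph \<open>e2\<close> joins the vertices that \<open>e1\<close> joined before.\<close>
    let ?\<pi> = "\<lambda>e. if e = e2 then e1 else e"
    have inj: "?\<pi> e' = ?\<pi> e \<longleftrightarrow> e' = e" if "e \<in> F" "e' \<in> F" for e e' using 3 that by auto
    have pi: "r (?\<pi> e) = ?r e" "c (?\<pi> e) = ?c e" if "e \<in> F" for e
    proof -
      have "e \<noteq> e1" using 3(1) that by blast
      then show "r (?\<pi> e) = ?r e" "c (?\<pi> e) = ?c e" using assms(5,6) by simp_all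
    qed
    have "?leaf (?\<pi> ` F) r c" using F assms(3) by (intro leaf) auto
    then obtain e where "e \<in> F" and
      "(\<forall>e'\<in>F. r (?\<pi> e') = r (?\<pi> e) \<longrightarrow> ?\<pi> e' = ?\<pi> e) \<or> (\<forall>e'\<in>F. c (?\<pi> e') = c (?\<pi> e) \<longrightarrow> ?\<pi> e' = ?\<pi> e)"
      by blast
    moreover have "(\<forall>e'\<in>F. r (?\<pi> e') = r (?\<pi> e) \<longrightarrow> ?\<pi> e' = ?\<pi> e) \<longleftrightarrow> (\<forall>e'\<in>F. ?r e' = ?r e \<longrightarrow> e' = e)"
      by (rule ball_cong[OF refl]) (simp only: pi[OF \<open>e \<in> F\<close>] pi inj[OF \<open>e \<in> F\<close>])
    moreover have "(\<forall>e'\<in>F. c (?\<pi> e') = c (?\<pi> e) \<longrightarrow> ?\<pi> e' = ?\<pi> e) \<longleftrightarrow> (\<forall>e'\<in>F. ?c e' = ?c e \<longrightarrow> e' = e)"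
      by (rule ball_cong[OF refl]) (simp only: pi[OF \<open>e \<in> F\<close>] pi inj[OF \<open>e \<in> F\<close>])
    ultimately show ?thesis using \<open>e \<in> F\<close> by (simp only:) (rule bexI)
  qed
qed

lemma drawing_Join_insert_left:
  assumes "drawing r c (Join s b)" "drawing r c s'" "edges s' = insert e (edges s)"
    and "first_edge s' = first_edge s"
    and "\<And>e'. e' \<in> edges b \<Longrightarrow> r e \<noteq> r e' \<and>
      (c e = c e' \<longrightarrow> e' = first_edge b \<and> c e = c (first_edge s))"
  shows "drawing r c (Join s' b)"
  using assms by simp

lemma drawing_Join_insert_right:
  assumes "drawing r c (Join s b)" "drawing c r b'" "edges b' = insert e (edges b)"
    and "first_edge b' = first_edge b"
    and "\<And>e'. e' \<in> edges s \<Longrightarrow> r e \<noteq> r e' \<and> c e \<noteq> c e'"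
  shows "drawing r c (Join s b')"
  using assms by (simp add: eq_sym_conv)

text \<open>A new leaf can be drawn at every vertex except the far end of the first edge: at the root it is hung
as a new branch, elsewhere it is inserted in the part that contains the vertex.\<close>

lemma drawing_insert_pendant:
  assumes "drawing r c t"
  shows "c e \<notin> c ` edges t \<Longrightarrow> r e \<in> r ` edges t \<Longrightarrow> r e \<noteq> r (first_edge t) \<Longrightarrow>
      \<exists>t'. drawing r c t' \<and> edges t' = insert e (edges t) \<and> first_edge t' = first_edge t"
    and "r e \<notin> r ` edges t \<Longrightarrow> c e \<in> c ` edges t \<Longrightarrow>
      \<exists>t'. drawing r c t' \<and> edges t' = insert e (edges t) \<and> first_edge t' = first_edge t"
  using assms
proof (induction t arbitrary: r c)
  case (Leaf f)
  {
    case 1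
    then show ?case by simp
  next
    case 2
    then show ?case by (intro exI[of _ "Join (Leaf f) (Leaf e)"]) auto
  }
next
  case (Join s b)
  {
    case 1
    note draw = \<open>drawing r c (Join s b)\<close>
    consider "r e \<in> r ` edges s" | "r e \<in> r ` edges b" "r e \<notin> r ` edges s" using 1(2) by auto
    then show ?case
    proof cases
      case A: 1
      obtain s' where s': "drawing r c s'" "edges s' = insert e (edges s)" "first_edge s' = first_edge s"
        using Join.IH(1)[where r = r and c = c] 1 A draw by auto
      have "drawing r c (Join s' b)"
      proof (rule drawing_Join_insert_left[OF draw s'])
        fix e' assume e': "e' \<in> edges b"
        obtain x where x: "x \<in> edges s" "r e = r x" using A by blast
        have "r x \<noteq> r e'" using draw x(1) e' by simp
        moreover have "c e \<noteq> c e'" using 1(1) e' by auto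
        ultimately show "r e \<noteq> r e' \<and> (c e = c e' \<longrightarrow> e' = first_edge b \<and> c e = c (first_edge s))"
          using x(2) by simp
      qed
      then show ?thesis using s' by (intro exI[of _ "Join s' b"]) auto
    next
      case B: 2
      obtain b' where b': "drawing c r b'" "edges b' = insert e (edges b)" "first_edge b' = first_edge b"
        using Join.IH(4)[where r = c and c = r] 1 B draw by auto
      have "drawing r c (Join s b')"
        by (rule drawing_Join_insert_right[OF draw b']) (use B 1(1) in auto)
      then show ?thesis using b' by (intro exI[of _ "Join s b'"]) auto
    qed
  next
    case 2
    note draw = \<open>drawing r c (Join s b)\<close>
    consider "c e \<in> c ` edges s" | "c e \<in> c ` edges b" "c e \<notin> c ` edges s" using 2(2) by auto
    then show ?case
    proof cases
      case A: 1
      obtain s' where s': "drawing r c s'" "edges s' = insert e (edges s)" "first_edge s' = first_edge s"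
        using Join.IH(2)[where r = r and c = c] 2 A draw by auto
      have "drawing r c (Join s' b)"
      proof (rule drawing_Join_insert_left[OF draw s'])
        fix e' assume e': "e' \<in> edges b"
        obtain x where x: "x \<in> edges s" "c e = c x" using A by blast
        have "c x = c e' \<longrightarrow> e' = first_edge b \<and> c x = c (first_edge s)" using draw x(1) e' by simp
        moreover have "r e \<noteq> r e'" using 2(1) e' by auto
        ultimately show "r e \<noteq> r e' \<and> (c e = c e' \<longrightarrow> e' = first_edge b \<and> c e = c (first_edge s))"
          using x(2) by simp
      qed
      then show ?thesis using s' by (intro exI[of _ "Join s' b"]) auto
    next
      case B: 2
      have "c e \<noteq> c (first_edge b)" using B(2) draw first_edge_in_edges[of s] by (metis drawing.simps(2) imageI)
      then obtain b' where b': "drawing c r b'" "edges b' = insert e (edges b)" "first_edge b' = first_edge b"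
        using Join.IH(3)[where r = c and c = r] 2 B draw by auto
      have "drawing r c (Join s b')"
        by (rule drawing_Join_insert_right[OF draw b']) (use B 2(1) in auto)
      then show ?thesis using b' by (intro exI[of _ "Join s b'"]) auto
    qed
  }
qed

text \<open>At the far end of the first edge the drawing is rooted anew: that vertex becomes the root, the
new leaf is drawn first, and the whole old tree becomes a branch.\<close>

lemma drawing_insert_at_first_pendant:
  assumes "drawing r c t" "c e \<notin> c ` edges t" "r e = r (first_edge t)"
  shows "drawing c r (Join (Leaf e) t)"
  using assms first_edge_pendant[OF assms(1)] by auto

text \<open>Drawing a leaf at the far end of a first edge moves the root to a vertex of the other colour, so the
roots of the trees can be rows as well as columns.\<close>

fun forest_drawing :: "('e \<Rightarrow> nat) \<Rightarrow> ('e \<Rightarrow> nat) \<Rightarrow> 'e plane_tree list \<Rightarrow> bool" where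
  "forest_drawing r c [] \<longleftrightarrow> True"
| "forest_drawing r c (t # ts) \<longleftrightarrow> (drawing r c t \<or> drawing c r t) \<and> forest_drawing r c ts \<and>
     (\<forall>e\<in>edges t. \<forall>e'\<in>\<Union>(edges ` set ts). r e \<noteq> r e' \<and> c e \<noteq> c e')"

lemma drawing_insert_leaf:
  assumes t: "drawing r c t \<or> drawing c r t" and e: "c e \<notin> c ` edges t" "r e \<in> r ` edges t"
  shows "\<exists>t'. (drawing r c t' \<or> drawing c r t') \<and> edges t' = insert e (edges t)"
  using t
proof
  assume d: "drawing r c t"
  show ?thesis
  proof (cases "r e = r (first_edge t)")
    case True
    with d e have "drawing c r (Join (Leaf e) t)" by (intro drawing_insert_at_first_pendant)
    then show ?thesis by (intro exI[of _ "Join (Leaf e) t"]) simp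
  next
    case False
    then show ?thesis using drawing_insert_pendant(1)[OF d e] by blast
  qed
next
  assume "drawing c r t"
  from drawing_insert_pendant(2)[OF this e] show ?thesis by blast
qed

lemma forest_drawing_swap: "forest_drawing r c ts \<longleftrightarrow> forest_drawing c r ts"
  by (induction ts) auto

lemma forest_drawing_insert_leaf:
  assumes "forest_drawing r c ts" "c e \<notin> c ` \<Union>(edges ` set ts)"
  shows "\<exists>ts'. forest_drawing r c ts' \<and> \<Union>(edges ` set ts') = insert e (\<Union>(edges ` set ts))"
  using assms
proof (induction ts)
  case Nil
  show ?case by (rule exI[of _ "[Leaf e]"]) simp
next
  case (Cons t ts)
  show ?case
  proof (cases "r e \<in> r ` edges t")
    case True
    then obtain t' where "drawing r c t' \<or> drawing c r t'" "edges t' = insert e (edges t)"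
      using drawing_insert_leaf[of r c t e] Cons.prems by auto
    moreover have "\<forall>e'\<in>\<Union>(edges ` set ts). r e \<noteq> r e' \<and> c e \<noteq> c e'"
    proof
      fix e' assume e': "e' \<in> \<Union>(edges ` set ts)"
      obtain e0 where "e0 \<in> edges t" "r e = r e0" using True by blast
      then have "r e \<noteq> r e'" using Cons.prems(1) e' by (metis forest_drawing.simps(2))
      moreover have "e' \<in> \<Union>(edges ` set (t # ts))" using e' by simp
      then have "c e \<noteq> c e'" using Cons.prems(2) by (metis imageI)
      ultimately show "r e \<noteq> r e' \<and> c e \<noteq> c e'" by simp
    qed
    ultimately show ?thesis using Cons.prems by (intro exI[of _ "t' # ts"]) auto
  next
    case False
    obtain ts' where "forest_drawing r c ts'" "\<Union>(edges ` set ts') = insert e (\<Union>(edges ` set ts))"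
      using Cons by auto
    moreover have "c e' \<noteq> c e" "r e' \<noteq> r e" if "e' \<in> edges t" for e'
    proof -
      have "e' \<in> \<Union>(edges ` set (t # ts))" using that by simp
      then show "c e' \<noteq> c e" using Cons.prems(2) by (metis imageI)
      show "r e' \<noteq> r e" using False that by (metis imageI)
    qed
    ultimately show ?thesis using Cons.prems by (intro exI[of _ "t # ts'"]) auto
  qed
qed

lemma forest_drawing_exists:
  assumes "forest E r c"
  shows "\<exists>ts. forest_drawing r c ts \<and> \<Union>(edges ` set ts) = E"
proof -
  have "finite E" using assms by (simp add: forest_def)
  then show ?thesis using assms
  proof (induction E rule: finite_psubset_induct)
    case (psubset E)
    show ?case
    proof (cases "E = {}")
      case True
      then show ?thesis by (intro exI[of _ "[]"]) simp
    next
      case False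
      have rec: "\<exists>ts. forest_drawing r c ts \<and> \<Union>(edges ` set ts) = E - {e}" if "e \<in> E" for e
        using psubset.IH[of "E - {e}"] forest_subset[OF psubset.prems, of "E - {e}"] that by auto
      have extend: "\<exists>ts. forest_drawing r c ts \<and> \<Union>(edges ` set ts) = E"
        if "forest_drawing r c ts" and ts: "\<Union>(edges ` set ts) = E - {e}" and "e \<in> E"
          and leaf: "\<And>e'. e' \<in> E \<Longrightarrow> c e' = c e \<Longrightarrow> e' = e" for r c ts e
      proof -
        have "c e \<notin> c ` \<Union>(edges ` set ts)"
        proof
          assume "c e \<in> c ` \<Union>(edges ` set ts)"
          then obtain e' where "e' \<in> E - {e}" "c e' = c e" using ts by (metis imageE)
          then show False using leaf[of e'] by simp
        qed
        from forest_drawing_insert_leaf[OF that(1) this] ts that(3) show ?thesis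
          by (simp add: insert_absorb)
      qed
      from psubset.prems subset_refl False show ?thesis
      proof (rule forest_leaf)
        fix e assume "e \<in> E" "\<And>e'. e' \<in> E \<Longrightarrow> c e' = c e \<Longrightarrow> e' = e"
        with rec[of e] extend[of r c _ e] show ?thesis by blast
      next
        fix e assume "e \<in> E" "\<And>e'. e' \<in> E \<Longrightarrow> r e' = r e \<Longrightarrow> e' = e"
        with rec[of e] extend[of c r _ e] show ?thesis unfolding forest_drawing_swap[of r c] by blast
      qed
    qed
  qed
qed

lemma forest_drawing_closed:
  assumes "forest_drawing r c ts" "t \<in> set ts" "e \<in> edges t" "e' \<in> \<Union>(edges ` set ts)"
    and "r e' = r e \<or> c e' = c e"
  shows "e' \<in> edges t"
  using assms
proof (induction ts)
  case (Cons t0 ts)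
  consider "t = t0" | "t \<in> set ts" using Cons.prems by auto
  then show ?case
  proof cases
    case 1
    show ?thesis
    proof (rule ccontr)
      assume "e' \<notin> edges t"
      with 1 Cons.prems(4) have "e' \<in> \<Union>(edges ` set ts)" by auto
      then show False using 1 Cons.prems(1,3,5) by (metis forest_drawing.simps(2))
    qed
  next
    case 2
    then have "e \<in> \<Union>(edges ` set ts)" using Cons.prems by auto
    then have "e' \<notin> edges t0" using Cons.prems(1,5) by (metis forest_drawing.simps(2))
    then show ?thesis using Cons 2 by auto
  qed
qed simp

lemma forest_drawing_drawing:
  "forest_drawing r c ts \<Longrightarrow> t \<in> set ts \<Longrightarrow> drawing r c t \<or> drawing c r t"
  by (induction ts) auto

section \<open>The uniform measure on the unit cube\<close>

abbreviation unif :: "real measure" where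
  "unif \<equiv> uniform_measure lborel {0..1}"

abbreviation unit_cube :: "'e set \<Rightarrow> ('e \<Rightarrow> real) measure" where
  "unit_cube E \<equiv> (\<Pi>\<^sub>M e\<in>E. unif)"

lemma prob_space_unif: "prob_space unif"
  by (rule prob_space_uniform_measure) auto

lemma prob_space_unit_cube: "prob_space (unit_cube E)"
  by (rule prob_space_PiM) (rule prob_space_unif)

text \<open>The half-open interval is the one on which \<open>frac\<close> acts as a rotation.\<close>

lemma emeasure_unif:
  assumes "A \<in> sets borel"
  shows "emeasure unif A = emeasure lborel ({0..<1} \<inter> A)"
proof -
  have "emeasure unif A = emeasure lborel ({0..1} \<inter> A)"
    using assms by (simp add: divide_ennreal_def)
  also have "\<dots> = emeasure lborel ({0..<1} \<inter> A)"
  proof (rule emeasure_eq_AE)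
    show "AE x in lborel. x \<in> {0..1} \<inter> A \<longleftrightarrow> x \<in> {0..<1} \<inter> A"
      using AE_lborel_singleton[of "1::real"] by eventually_elim auto
  qed (use assms in auto)
  finally show ?thesis .
qed

lemma emeasure_lborel_translate:
  assumes "A \<in> sets borel"
  shows "emeasure lborel {y::real. y + t \<in> A} = emeasure lborel A"
proof -
  have "emeasure lborel A = emeasure (distr lborel borel ((+) t)) A" by (simp add: lborel_distr_plus)
  also have "\<dots> = emeasure lborel ((+) t -` A)" using assms by (subst emeasure_distr) auto
  also have "(+) t -` A = {y. y + t \<in> A}" by (auto simp: add.commute)
  finally show ?thesis by simp
qed

lemma measurable_frac [measurable]: "frac \<in> borel_measurable (borel :: real measure)"
  unfolding frac_def by measurable

lemma frac_eq_on_unit_interval: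
  fixes x :: real
  assumes "-1 \<le> x" "x < 1"
  shows "frac x = (if 0 \<le> x then x else x + 1)"
proof -
  have "\<lfloor>x\<rfloor> = (if 0 \<le> x then 0 else -1)" using assms by (simp add: floor_eq_iff)
  then show ?thesis by (simp add: frac_def)
qed

text \<open>The uniform distribution on a circle of length one is invariant under rotation.\<close>

lemma distr_unif_frac: "distr unif unif (\<lambda>y. frac (y - a)) = unif"
proof (rule measure_eqI)
  fix A assume "A \<in> sets (distr unif unif (\<lambda>y. frac (y - a)))"
  then have A: "A \<in> sets borel" by simp
  define b where "b = frac a"
  have b: "0 \<le> b" "b < 1" by (auto simp: b_def frac_ge_0 frac_lt_1)
  have fr: "frac (y - a) = frac (y - b)" for y
  proof -
    have y: "y - b = (y - a) + of_int \<lfloor>a\<rfloor>" by (simp add: b_def frac_def)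
    then have "\<lfloor>y - b\<rfloor> = \<lfloor>y - a\<rfloor> + \<lfloor>a\<rfloor>" by (simp only: floor_add_int)
    then have "real_of_int \<lfloor>y - b\<rfloor> = real_of_int \<lfloor>y - a\<rfloor> + real_of_int \<lfloor>a\<rfloor>" by simp
    with y show ?thesis unfolding frac_def by linarith
  qed
  have [measurable]: "A \<in> sets borel" by fact
  have "emeasure (distr unif unif (\<lambda>y. frac (y - a))) A = emeasure unif {y. frac (y - b) \<in> A}"
    using A by (subst emeasure_distr) (auto simp: fr vimage_def)
  also have "\<dots> = emeasure lborel ({0..<1} \<inter> {y. frac (y - b) \<in> A})"
    by (rule emeasure_unif) measurable
  also have "{0..<1} \<inter> {y. frac (y - b) \<in> A}
      = {y. y + (1 - b) \<in> {1-b..<1} \<inter> A} \<union> {y. y + (- b) \<in> {0..<1-b} \<inter> A}"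
  proof (rule Set.set_eqI)
    fix y
    have "frac (y - b) = (if b \<le> y then y + (- b) else y + (1 - b))" if "0 \<le> y" "y < 1"
      using that b frac_eq_on_unit_interval[of "y - b"] by simp
    then show "y \<in> {0..<1} \<inter> {y. frac (y - b) \<in> A} \<longleftrightarrow>
        y \<in> {y. y + (1 - b) \<in> {1-b..<1} \<inter> A} \<union> {y. y + (- b) \<in> {0..<1-b} \<inter> A}"
      using b by (cases "0 \<le> y \<and> y < 1"; cases "b \<le> y") auto
  qed
  also have "emeasure lborel \<dots> = emeasure lborel {y. y + (1 - b) \<in> {1-b..<1} \<inter> A}
      + emeasure lborel {y. y + (- b) \<in> {0..<1-b} \<inter> A}"
    by (rule plus_emeasure[symmetric]) (measurable, measurable, auto)
  also have "\<dots> = emeasure lborel ({1-b..<1} \<inter> A) + emeasure lborel ({0..<1-b} \<inter> A)"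
    by (intro arg_cong2[where f = "(+)"] emeasure_lborel_translate) auto
  also have "\<dots> = emeasure lborel (({1-b..<1} \<inter> A) \<union> ({0..<1-b} \<inter> A))"
    by (rule plus_emeasure) auto
  also have "({1-b..<1} \<inter> A) \<union> ({0..<1-b} \<inter> A) = {0..<1} \<inter> A" using b by auto
  also have "emeasure lborel \<dots> = emeasure unif A" by (rule emeasure_unif[symmetric, OF A])
  finally show "emeasure (distr unif unif (\<lambda>y. frac (y - a))) A = emeasure unif A" .
qed simp

fun value_at :: "'e option \<Rightarrow> ('e \<Rightarrow> real) \<Rightarrow> real" where
  "value_at None w = 0"
| "value_at (Some d) w = w d"

text \<open>Coordinate \<open>e\<close> is measured on the circle from the position of \<open>q\<close>, or from \<open>0\<close> if there is no \<open>q\<close>.\<close>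

definition rotate_coord :: "'e option \<Rightarrow> 'e \<Rightarrow> ('e \<Rightarrow> real) \<Rightarrow> 'e \<Rightarrow> real" where
  "rotate_coord q e w = w(e := frac (w e - value_at q w))"

lemma measurable_coord:
  assumes "e \<in> E"
  shows "(\<lambda>w. w e) \<in> borel_measurable (unit_cube E)"
  using measurable_component_singleton[OF assms, of "\<lambda>_. unif"]
  by (simp add: measurable_cong_sets[OF refl, of unif borel])

lemma measurable_value_at:
  assumes "set_option q \<subseteq> E"
  shows "value_at q \<in> borel_measurable (unit_cube E)"
proof (cases q)
  case None
  then have "value_at q = (\<lambda>w. 0)" by (intro ext) simp
  then show ?thesis by simp
next
  case (Some d)
  then have "value_at q = (\<lambda>w. w d)" by (intro ext) simp
  then show ?thesis using measurable_coord[of d E] assms Some by simp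
qed

lemma measurable_rotate_coord:
  assumes "e \<in> E" "set_option q \<subseteq> E"
  shows "rotate_coord q e \<in> measurable (unit_cube E) (unit_cube E)"
proof -
  note [measurable] = measurable_coord[OF assms(1)] measurable_value_at[OF assms(2)]
  have "(\<lambda>w i. rotate_coord q e w i) \<in> measurable (unit_cube E) (unit_cube E)"
  proof (rule measurable_PiM_single')
    fix i assume i: "i \<in> E"
    have "(\<lambda>w. frac (w e - value_at q w)) \<in> borel_measurable (unit_cube E)" by measurable
    then show "(\<lambda>w. rotate_coord q e w i) \<in> measurable (unit_cube E) unif"
      using measurable_coord[OF i] by (cases "i = e") (simp_all add: rotate_coord_def measurable_cong_sets[OF refl, of unif borel])
  qed (use assms(1) in \<open>auto simp: rotate_coord_def space_PiM PiE_def extensional_def\<close>)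
  then show ?thesis by simp
qed

text \<open>With the other coordinates fixed this is a rotation of the circle; integrate over the others.\<close>

lemma distr_rotate_coord:
  assumes "finite E" "e \<in> E" "set_option q \<subseteq> E - {e}"
  shows "distr (unit_cube E) (unit_cube E) (rotate_coord q e) = unit_cube E"
proof (rule measure_eqI)
  interpret product_sigma_finite "\<lambda>_. unif"
    by (intro product_sigma_finite.intro prob_space_imp_sigma_finite prob_space_unif)
  have [measurable]: "rotate_coord q e \<in> measurable (unit_cube E) (unit_cube E)"
    using assms by (intro measurable_rotate_coord) auto
  fix A assume "A \<in> sets (distr (unit_cube E) (unit_cube E) (rotate_coord q e))"
  then have A [measurable]: "A \<in> sets (unit_cube E)" by simp
  define I where "I = E - {e}"
  have E: "E = insert e I" and I: "finite I" "e \<notin> I" using assms by (auto simp: I_def)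
  have ins: "integral\<^sup>N (unit_cube E) f = (\<integral>\<^sup>+ x. (\<integral>\<^sup>+ y. f (x(e := y)) \<partial>unif) \<partial>unit_cube I)"
    if "f \<in> borel_measurable (unit_cube E)" for f
    unfolding E using product_nn_integral_insert[OF I] that E by simp
  have upd: "(\<lambda>y. x(e := y)) \<in> measurable unif (unit_cube E)" if "x \<in> space (unit_cube I)" for x
  proof -
    have "(\<lambda>y i. (x(e := y)) i) \<in> measurable unif (unit_cube E)"
    proof (rule measurable_PiM_single')
      fix i show "(\<lambda>y. (x(e := y)) i) \<in> measurable unif unif" by (cases "i = e") auto
    qed (use that E in \<open>auto simp: space_PiM PiE_def extensional_def\<close>)
    then show ?thesis by (simp add: fun_upd_def)
  qed
  have "emeasure (distr (unit_cube E) (unit_cube E) (rotate_coord q e)) A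
      = (\<integral>\<^sup>+ w. indicator A w \<partial>distr (unit_cube E) (unit_cube E) (rotate_coord q e))" by simp
  also have "\<dots> = (\<integral>\<^sup>+ w. indicator A (rotate_coord q e w) \<partial>unit_cube E)"
    by (rule nn_integral_distr) measurable
  also have "\<dots> = (\<integral>\<^sup>+ x. (\<integral>\<^sup>+ y. indicator A (rotate_coord q e (x(e := y))) \<partial>unif) \<partial>unit_cube I)"
    by (rule ins) measurable
  also have "\<dots> = (\<integral>\<^sup>+ x. (\<integral>\<^sup>+ y. indicator A (x(e := y)) \<partial>unif) \<partial>unit_cube I)"
  proof (rule nn_integral_cong)
    fix x assume x: "x \<in> space (unit_cube I)"
    note [measurable] = upd[OF x]
    have rot: "rotate_coord q e (x(e := y)) = x(e := frac (y - value_at q x))" for y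
      using assms(3) by (cases q) (auto simp: rotate_coord_def)
    have "(\<integral>\<^sup>+ y. indicator A (rotate_coord q e (x(e := y))) \<partial>unif)
        = (\<integral>\<^sup>+ y. indicator A (x(e := y)) \<partial>distr unif unif (\<lambda>y. frac (y - value_at q x)))"
      unfolding rot by (rule nn_integral_distr[symmetric]) measurable
    then show "(\<integral>\<^sup>+ y. indicator A (rotate_coord q e (x(e := y))) \<partial>unif) = (\<integral>\<^sup>+ y. indicator A (x(e := y)) \<partial>unif)"
      by (simp only: distr_unif_frac)
  qed
  also have "\<dots> = (\<integral>\<^sup>+ w. indicator A w \<partial>unit_cube E)" by (rule ins[symmetric]) measurable
  finally show "emeasure (distr (unit_cube E) (unit_cube E) (rotate_coord q e)) A = emeasure (unit_cube E) A"
    by simp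
qed simp

lemma AE_unit_cube_open:
  assumes "finite E"
  shows "AE w in unit_cube E. \<forall>e\<in>E. 0 < w e \<and> w e < 1"
proof (rule AE_finite_allI[OF assms])
  fix e assume "e \<in> E"
  have "AE x in lborel. x \<in> {0..1::real} \<longrightarrow> 0 < x \<and> x < 1"
    using AE_lborel_singleton[of "1::real"] AE_lborel_singleton[of "0::real"] by eventually_elim auto
  then have "AE x in unif. 0 < x \<and> x < 1" by (subst AE_uniform_measure) auto
  from AE_PiM_component[OF prob_space_unif \<open>e \<in> E\<close> this]
  show "AE w in unit_cube E. 0 < w e \<and> w e < 1" .
qed

text \<open>If \<open>w e = w d\<close> then rotating coordinate \<open>e\<close> by \<open>w d\<close> gives \<open>0\<close>, and rotation preserves the measure.\<close>

lemma AE_unit_cube_inj: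
  assumes "finite E"
  shows "AE w in unit_cube E. inj_on w E"
proof -
  have "AE w in unit_cube E. \<forall>e\<in>E. \<forall>d\<in>E. d \<noteq> e \<longrightarrow> w e \<noteq> w d"
  proof (intro AE_finite_allI[OF assms])
    fix e d assume ed: "e \<in> E" "d \<in> E"
    show "AE w in unit_cube E. d \<noteq> e \<longrightarrow> w e \<noteq> w d"
    proof (cases "d = e")
      case False
      have "AE w in unit_cube E. w e \<noteq> 0"
        using AE_unit_cube_open[OF assms] by eventually_elim (use ed in force)
      then have "AE w in distr (unit_cube E) (unit_cube E) (rotate_coord (Some d) e). w e \<noteq> 0"
        using ed False assms by (subst distr_rotate_coord) auto
      then have "AE w in unit_cube E. rotate_coord (Some d) e w e \<noteq> 0"
        by (rule AE_distrD[rotated]) (use ed in \<open>auto intro!: measurable_rotate_coord\<close>)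
      then show ?thesis by eventually_elim (auto simp: rotate_coord_def)
    qed simp
  qed
  then show ?thesis by eventually_elim (auto simp: inj_on_def)
qed



section \<open>Fractional matchings of a drawn forest\<close>

definition fractional_matching ::
  "'e set \<Rightarrow> ('e \<Rightarrow> nat) \<Rightarrow> ('e \<Rightarrow> nat) \<Rightarrow> ('e \<Rightarrow> real) \<Rightarrow> bool" where
  "fractional_matching E r c w \<longleftrightarrow> (\<forall>e\<in>E. 0 \<le> w e) \<and>
     (\<forall>i. (\<Sum>e | e \<in> E \<and> r e = i. w e) \<le> 1) \<and> (\<forall>j. (\<Sum>e | e \<in> E \<and> c e = j. w e) \<le> 1)"

lemma fractional_matching_swap: "fractional_matching E r c w \<longleftrightarrow> fractional_matching E c r w"
  unfolding fractional_matching_def by blast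

lemma fractional_matching_cong:
  assumes "\<And>e. e \<in> E \<Longrightarrow> w e = w' e"
  shows "fractional_matching E r c w \<longleftrightarrow> fractional_matching E r c w'"
proof -
  have "(\<Sum>e | e \<in> E \<and> f e = i. w e) = (\<Sum>e | e \<in> E \<and> f e = i. w' e)" for f :: "_ \<Rightarrow> nat" and i
    by (rule sum.cong) (auto simp: assms)
  then show ?thesis unfolding fractional_matching_def by (simp add: assms)
qed

lemma fractional_matching_subset:
  assumes "fractional_matching E r c w" "F \<subseteq> E" "finite E"
  shows "fractional_matching F r c w"
proof -
  have "(\<Sum>e | e \<in> F \<and> f e = i. w e) \<le> (\<Sum>e | e \<in> E \<and> f e = i. w e)" for f :: "_ \<Rightarrow> nat" and i
    by (rule sum_mono2) (use assms in \<open>auto simp: fractional_matching_def\<close>)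
  then show ?thesis using assms(1,2) unfolding fractional_matching_def by (meson order_trans subsetD)
qed

lemma fractional_matching_union:
  assumes "fractional_matching E r c w" "fractional_matching F r c w"
    and "\<And>e e'. e \<in> E \<Longrightarrow> e' \<in> F \<Longrightarrow> r e \<noteq> r e'"
    and "\<And>j. j \<in> c ` E \<Longrightarrow> j \<in> c ` F \<Longrightarrow> (\<Sum>e | e \<in> E \<union> F \<and> c e = j. w e) \<le> 1"
  shows "fractional_matching (E \<union> F) r c w"
  unfolding fractional_matching_def
proof (intro conjI ballI allI)
  have split: "(\<Sum>e | e \<in> E \<union> F \<and> f e = i. w e) \<le> 1" if "i \<notin> f ` E \<or> i \<notin> f ` F"
    "\<And>i. (\<Sum>e | e \<in> E \<and> f e = i. w e) \<le> 1" "\<And>i. (\<Sum>e | e \<in> F \<and> f e = i. w e) \<le> 1" for f :: "_ \<Rightarrow> nat" and i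
  proof -
    from that(1) show ?thesis
    proof
      assume "i \<notin> f ` E"
      then have "f e \<noteq> i" if "e \<in> E" for e using that by (metis imageI)
      then have "{e. e \<in> E \<union> F \<and> f e = i} = {e. e \<in> F \<and> f e = i}" by auto
      then show ?thesis by (simp only: that)
    next
      assume "i \<notin> f ` F"
      then have "f e \<noteq> i" if "e \<in> F" for e using that by (metis imageI)
      then have "{e. e \<in> E \<union> F \<and> f e = i} = {e. e \<in> E \<and> f e = i}" by auto
      then show ?thesis by (simp only: that)
    qed
  qed
  show "0 \<le> w e" if "e \<in> E \<union> F" for e using assms(1,2) that by (auto simp: fractional_matching_def)
  show "(\<Sum>e | e \<in> E \<union> F \<and> r e = i. w e) \<le> 1" for i
  proof (rule split)
    show "i \<notin> r ` E \<or> i \<notin> r ` F" using assms(3) by blast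
  qed (use assms(1,2) in \<open>auto simp: fractional_matching_def\<close>)
  show "(\<Sum>e | e \<in> E \<union> F \<and> c e = j. w e) \<le> 1" for j
  proof (cases "j \<in> c ` E \<and> j \<in> c ` F")
    case False
    show ?thesis by (rule split) (use False assms(1,2) in \<open>auto simp: fractional_matching_def\<close>)
  qed (use assms(4) in blast)
qed

text \<open>Every coordinate is replaced by its circular distance from the preceding edge of the drawing. The
branch has to be treated before \<open>s\<close>, because it refers to the unchanged coordinate of the last
edge of \<open>s\<close>.\<close>

fun unroll :: "'e option \<Rightarrow> 'e plane_tree \<Rightarrow> ('e \<Rightarrow> real) \<Rightarrow> 'e \<Rightarrow> real" where
  "unroll q (Leaf f) = rotate_coord q f"
| "unroll q (Join s b) = unroll q s \<circ> unroll (Some (last_edge s)) b"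

text \<open>Travelling around the circle from \<open>a\<close> to \<open>b\<close> and on to \<open>c\<close> takes at most one turn exactly if the three
points are in cyclic order.\<close>

lemma frac_cyclic:
  fixes a b c :: real
  assumes "0 \<le> a" "a < 1" "0 \<le> b" "b < 1" "0 \<le> c" "c < 1" "a \<noteq> b" "b \<noteq> c" "a \<noteq> c"
  shows "frac (b - a) + frac (c - b) \<le> 1 \<longleftrightarrow> cyclic_triple a b c"
    and "cyclic_triple a b c \<Longrightarrow> frac (b - a) + frac (c - b) = frac (c - a)"
proof -
  have "frac (b - a) = (if 0 \<le> b - a then b - a else b - a + 1)"
    "frac (c - b) = (if 0 \<le> c - b then c - b else c - b + 1)"
    "frac (c - a) = (if 0 \<le> c - a then c - a else c - a + 1)"
    using assms by (simp_all add: frac_eq_on_unit_interval)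
  note fr = this
  show "frac (b - a) + frac (c - b) \<le> 1 \<longleftrightarrow> cyclic_triple a b c"
    unfolding fr cyclic_triple_def using assms by (auto split: if_splits)
  show "cyclic_triple a b c \<Longrightarrow> frac (b - a) + frac (c - b) = frac (c - a)"
    unfolding fr cyclic_triple_def using assms by (auto split: if_splits)
qed

lemma unroll_outside: "e \<notin> edges t \<Longrightarrow> unroll q t y e = y e"
  by (induction t arbitrary: q y) (auto simp: rotate_coord_def)

lemma value_at_cong: "(\<And>d. q = Some d \<Longrightarrow> y d = y' d) \<Longrightarrow> value_at q y = value_at q y'"
  by (cases q) auto

text \<open>The weights at the root are the circular distances between consecutive points \<open>y e\<close>, so their sum is
at most \<open>1\<close> if and only if these points are met in cyclic order, and then the sum is the
distance from the starting point to the last edge. The induction needs this value: in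
\<open>Join s b\<close> one more weight, the distance from the last edge of \<open>s\<close> to the first edge of \<open>b\<close>, is added at
the root, and all other vertices belong to only one of the two parts.\<close>

lemma unroll_fractional_matching:
  assumes "drawing r c t" "inj_on y (edges t)" "\<And>e. e \<in> edges t \<Longrightarrow> 0 < y e \<and> y e < 1"
    and "set_option q \<inter> edges t = {}" "0 \<le> value_at q y" "value_at q y < 1"
    and "\<And>e. e \<in> edges t \<Longrightarrow> y e \<noteq> value_at q y"
  shows "fractional_matching (edges t) r c (unroll q t y) \<longleftrightarrow> standard (value_at q y) y t"
    and "unroll q t y (first_edge t) = frac (y (first_edge t) - value_at q y)"
    and "standard (value_at q y) y t \<Longrightarrow>
      (\<Sum>e | e \<in> edges t \<and> c e = c (first_edge t). unroll q t y e) = frac (y (last_edge t) - value_at q y)"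
  using assms
proof (induction t arbitrary: r c q y)
  case (Leaf f)
  {
    case 1
    have "(\<Sum>e | e = f \<and> g e = i. rotate_coord q f y e) \<le> 1" for g :: "_ \<Rightarrow> nat" and i
    proof -
      have "{e. e = f \<and> g e = i} = (if g f = i then {f} else {})" by auto
      then show ?thesis using frac_lt_1[of "y f - value_at q y"] by (simp add: rotate_coord_def)
    qed
    then show ?case by (simp add: fractional_matching_def rotate_coord_def frac_ge_0)
  next
    case 2
    then show ?case by (simp add: rotate_coord_def)
  next
    case 3
    have "{e. e = f \<and> c e = c f} = {f}" by auto
    then show ?case by (simp add: rotate_coord_def)
  }
next
  case (Join s b)
  let ?l = "last_edge s" and ?f = "first_edge b"
  {
    fix r c q y
    assume draw: "drawing r c (Join s b)" and inj: "inj_on y (edges (Join s b))"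
      and unit: "\<And>e. e \<in> edges (Join s b) \<Longrightarrow> 0 < y e \<and> y e < 1"
      and q: "set_option q \<inter> edges (Join s b) = {}" "0 \<le> value_at q y" "value_at q y < 1"
        "\<And>e. e \<in> edges (Join s b) \<Longrightarrow> y e \<noteq> value_at q y"
    define z where "z = unroll (Some ?l) b y"
    define w where "w = unroll q (Join s b) y"
    define a where "a = value_at q y"
    have w: "w = unroll q s z" by (simp add: w_def z_def)
    have disj: "edges s \<inter> edges b = {}" using draw by (rule drawing_disjoint)
    have ds: "drawing r c s" and db: "drawing c r b" and cf: "c ?f = c (first_edge s)"
      using draw by simp_all
    have zs: "z e = y e" if "e \<notin> edges b" for e using that by (simp add: z_def unroll_outside)
    have zs': "z e = y e" if "e \<in> edges s" for e using that disj by (intro zs) auto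
    have wb: "w e = z e" if "e \<in> edges b" for e
    proof -
      have "e \<notin> edges s" using that disj by blast
      then show ?thesis by (simp add: w unroll_outside)
    qed
    have zq: "value_at q z = a" unfolding a_def
      by (rule value_at_cong) (use q(1) in \<open>auto intro!: zs\<close>)
    have lb: "?l \<notin> edges b" "?l \<in> edges s" using disj last_edge_in_edges[of s] by blast+
    have "inj_on y (edges s)" "inj_on y (edges b)" using inj by (auto intro: inj_on_subset)
    moreover have "inj_on z (edges s) \<longleftrightarrow> inj_on y (edges s)" by (rule inj_on_cong) (rule zs')
    ultimately have IHs_prems: "inj_on z (edges s)" "\<And>e. e \<in> edges s \<Longrightarrow> 0 < z e \<and> z e < 1"
      "set_option q \<inter> edges s = {}" "0 \<le> value_at q z" "value_at q z < 1"
      "\<And>e. e \<in> edges s \<Longrightarrow> z e \<noteq> value_at q z"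
      and IHb_prem1: "inj_on y (edges b)"
      using unit q zs' zq by (auto simp: a_def)
    have IHb_prems: "inj_on y (edges b)" "\<And>e. e \<in> edges b \<Longrightarrow> 0 < y e \<and> y e < 1"
      "set_option (Some ?l) \<inter> edges b = {}" "0 \<le> value_at (Some ?l) y" "value_at (Some ?l) y < 1"
      using IHb_prem1 unit lb by (auto simp: less_imp_le)
    have IHb_prem6: "y e \<noteq> value_at (Some ?l) y" if "e \<in> edges b" for e
      using inj_onD[OF inj, of e ?l] that lb by auto
    have std_s: "standard a z s \<longleftrightarrow> standard a y s" by (rule standard_cong) (rule zs')
    have fm_s: "fractional_matching (edges s) r c w \<longleftrightarrow> standard a y s"
      using Join.IH(1)[OF ds IHs_prems] by (simp add: w zq std_s)
    have first_s: "w (first_edge s) = frac (y (first_edge s) - a)"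
      using Join.IH(2)[OF ds IHs_prems] by (simp add: w zq zs')
    have sum_s: "(\<Sum>e | e \<in> edges s \<and> c e = c (first_edge s). w e) = frac (y ?l - a)" if "standard a y s"
      using Join.IH(3)[OF _ ds IHs_prems] that lb by (simp add: w zq zs' std_s)
    have fm_b: "fractional_matching (edges b) r c w \<longleftrightarrow> standard (y ?l) y b"
      using Join.IH(4)[OF db IHb_prems IHb_prem6] fractional_matching_cong[of "edges b" w z, OF wb]
      by (simp add: z_def fractional_matching_swap[of _ r c])
    have first_b: "w ?f = frac (y ?f - y ?l)"
      using Join.IH(5)[OF db IHb_prems IHb_prem6] by (simp add: wb z_def)
    have root: "{e. e \<in> edges s \<union> edges b \<and> c e = c (first_edge s)}
        = insert ?f {e. e \<in> edges s \<and> c e = c (first_edge s)}"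
      using draw first_edge_pendant[OF db] cf by auto
    have root_sum: "(\<Sum>e | e \<in> edges s \<union> edges b \<and> c e = c (first_edge s). w e)
        = (\<Sum>e | e \<in> edges s \<and> c e = c (first_edge s). w e) + frac (y ?f - y ?l)"
      unfolding root using disj first_edge_in_edges[of b] by (subst sum.insert) (auto simp: first_b)
    have "0 \<le> a" "a < 1" using q by (simp_all add: a_def)
    moreover have "0 \<le> y ?l" "y ?l < 1" "0 \<le> y ?f" "y ?f < 1"
      using unit[of ?l] unit[of ?f] by (simp_all add: less_imp_le)
    moreover have "a \<noteq> y ?l" "y ?l \<noteq> y ?f" "a \<noteq> y ?f"
      using q(4)[of ?l] q(4)[of ?f] IHb_prem6[of ?f] by (simp_all add: a_def eq_commute)
    ultimately have cyc: "frac (y ?l - a) + frac (y ?f - y ?l) \<le> 1 \<longleftrightarrow> cyclic_triple a (y ?l) (y ?f)"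
      "cyclic_triple a (y ?l) (y ?f) \<Longrightarrow> frac (y ?l - a) + frac (y ?f - y ?l) = frac (y ?f - a)"
      by (rule frac_cyclic)+
    have "fractional_matching (edges (Join s b)) r c w \<longleftrightarrow> standard a y (Join s b)"
    proof
      assume fm: "fractional_matching (edges (Join s b)) r c w"
      then have "standard a y s" "standard (y ?l) y b"
        using fm_s fm_b fractional_matching_subset[OF fm] by auto
      moreover have "(\<Sum>e | e \<in> edges s \<union> edges b \<and> c e = c (first_edge s). w e) \<le> 1"
        using fm by (simp add: fractional_matching_def)
      ultimately show "standard a y (Join s b)" using root_sum sum_s cyc(1) by simp
    next
      assume std: "standard a y (Join s b)"
      have "fractional_matching (edges s \<union> edges b) r c w"
      proof (rule fractional_matching_union)
        fix j assume "j \<in> c ` edges s" "j \<in> c ` edges b"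
        then have "j = c (first_edge s)" using draw by fastforce
        then show "(\<Sum>e | e \<in> edges s \<union> edges b \<and> c e = j. w e) \<le> 1"
          using root_sum sum_s cyc(1) std by simp
      qed (use std fm_s fm_b draw in auto)
      then show "fractional_matching (edges (Join s b)) r c w" by simp
    qed
    moreover have "w (first_edge (Join s b)) = frac (y (first_edge (Join s b)) - a)" by (simp add: first_s)
    moreover have "(\<Sum>e | e \<in> edges (Join s b) \<and> c e = c (first_edge (Join s b)). w e)
        = frac (y (last_edge (Join s b)) - a)" if "standard a y (Join s b)"
      using that root_sum sum_s cyc(2) by simp
    ultimately have "fractional_matching (edges (Join s b)) r c (unroll q (Join s b) y)
          \<longleftrightarrow> standard (value_at q y) y (Join s b)"
      "unroll q (Join s b) y (first_edge (Join s b)) = frac (y (first_edge (Join s b)) - value_at q y)"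
      "standard (value_at q y) y (Join s b) \<Longrightarrow>
        (\<Sum>e | e \<in> edges (Join s b) \<and> c e = c (first_edge (Join s b)). unroll q (Join s b) y e)
          = frac (y (last_edge (Join s b)) - value_at q y)"
      unfolding w_def a_def by blast+
  }
  note main = this
  {
    case 1 show ?case by (rule main(1)[OF 1])
  next
    case 2 show ?case by (rule main(2)[OF 2])
  next
    case 3 show ?case by (rule main(3)[OF 3(2-8) 3(1)])
  }
qed

lemma unroll_measure_preserving:
  assumes "finite E" "edges t \<subseteq> E" "drawing r c t" "set_option q \<subseteq> E - edges t"
  shows "unroll q t \<in> measurable (unit_cube E) (unit_cube E)"
    and "distr (unit_cube E) (unit_cube E) (unroll q t) = unit_cube E"
  using assms(2-)
proof (induction t arbitrary: q r c)
  case (Leaf f)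
  {
    case 1
    then show ?case by (auto intro!: measurable_rotate_coord)
  next
    case 2
    then show ?case by (auto intro!: distr_rotate_coord assms(1))
  }
next
  case (Join s b)
  have b: "set_option (Some (last_edge s)) \<subseteq> E - edges b"
    if "edges (Join s b) \<subseteq> E" "drawing r c (Join s b)" for r c
  proof -
    have "last_edge s \<in> E - edges b"
      using drawing_disjoint[OF that(2)] last_edge_in_edges[of s] that(1) by (metis DiffI Un_iff disjoint_iff edges.simps(2) subsetD)
    then show ?thesis by simp
  qed
  {
    case 1
    then have "set_option q \<subseteq> E - edges s" "edges s \<subseteq> E" "edges b \<subseteq> E" "drawing r c s" "drawing c r b"
      by auto
    then have "unroll q s \<in> measurable (unit_cube E) (unit_cube E)"
      "unroll (Some (last_edge s)) b \<in> measurable (unit_cube E) (unit_cube E)"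
      using Join.IH(1)[of r c q] Join.IH(3)[OF _ _ b[OF 1(1,2)], of c r] by blast+
    then show ?case by (simp only: unroll.simps) (rule measurable_comp)
  next
    case 2
    have s: "unroll q s \<in> measurable (unit_cube E) (unit_cube E)"
        "distr (unit_cube E) (unit_cube E) (unroll q s) = unit_cube E"
      using Join.IH(1,2)[of r c q] 2 by auto
    have "unroll (Some (last_edge s)) b \<in> measurable (unit_cube E) (unit_cube E)"
        "distr (unit_cube E) (unit_cube E) (unroll (Some (last_edge s)) b) = unit_cube E"
      using Join.IH(3,4)[OF _ _ b[OF 2(1,2)], of c r] 2 by auto
    then show ?case using distr_distr[OF s(1), of "unroll (Some (last_edge s)) b" "unit_cube E"] s(2)
      by (simp add: comp_def)
  }
qed

fun unroll_forest :: "'e plane_tree list \<Rightarrow> ('e \<Rightarrow> real) \<Rightarrow> 'e \<Rightarrow> real" where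
  "unroll_forest [] = id"
| "unroll_forest (t # ts) = unroll None t \<circ> unroll_forest ts"

lemma unroll_forest_measure_preserving:
  assumes "finite E" "\<Union>(edges ` set ts) \<subseteq> E" "forest_drawing r c ts"
  shows "unroll_forest ts \<in> measurable (unit_cube E) (unit_cube E) \<and>
    distr (unit_cube E) (unit_cube E) (unroll_forest ts) = unit_cube E"
  using assms(2,3)
proof (induction ts)
  case Nil
  then show ?case by (simp add: id_def)
next
  case (Cons t ts)
  then have IH: "unroll_forest ts \<in> measurable (unit_cube E) (unit_cube E)"
    "distr (unit_cube E) (unit_cube E) (unroll_forest ts) = unit_cube E" by auto
  have t: "unroll None t \<in> measurable (unit_cube E) (unit_cube E)"
    "distr (unit_cube E) (unit_cube E) (unroll None t) = unit_cube E"
    using unroll_measure_preserving[OF assms(1), of t r c None]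
      unroll_measure_preserving[OF assms(1), of t c r None] Cons.prems by auto
  show ?case using IH t distr_distr[OF t(1) IH(1)] by (auto simp: comp_def)
qed

lemma unroll_forest_outside: "e \<notin> \<Union>(edges ` set ts) \<Longrightarrow> unroll_forest ts y e = y e"
  by (induction ts) (auto simp: unroll_outside)

lemma unroll_forest_fractional_matching:
  assumes "forest_drawing r c ts" "inj_on y (\<Union>(edges ` set ts))"
    and "\<And>e. e \<in> \<Union>(edges ` set ts) \<Longrightarrow> 0 < y e \<and> y e < 1"
  shows "fractional_matching (\<Union>(edges ` set ts)) r c (unroll_forest ts y) \<longleftrightarrow> (\<forall>t\<in>set ts. standard 0 y t)"
  using assms
proof (induction ts)
  case Nil
  show ?case by (simp add: fractional_matching_def)
next
  case (Cons t ts)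
  let ?U = "\<Union>(edges ` set ts)"
  define z where "z = unroll_forest ts y"
  define w where "w = unroll None t z"
  have sep: "r e \<noteq> r e'" "c e \<noteq> c e'" if "e \<in> edges t" "e' \<in> ?U" for e e'
    using Cons.prems(1) that by (metis forest_drawing.simps(2))+
  have zt: "z e = y e" if "e \<in> edges t" for e
    unfolding z_def by (rule unroll_forest_outside) (use sep(1)[OF that] in blast)
  have wU: "w e = z e" if "e \<in> ?U" for e
    unfolding w_def by (rule unroll_outside) (use sep(1)[OF _ that] in blast)
  have "inj_on z (edges t) \<longleftrightarrow> inj_on y (edges t)" by (rule inj_on_cong) (rule zt)
  moreover have "inj_on y (edges t)" using Cons.prems(2) by (rule inj_on_subset) auto
  ultimately have pre: "inj_on z (edges t)" "\<And>e. e \<in> edges t \<Longrightarrow> 0 < z e \<and> z e < 1"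
      "set_option None \<inter> edges t = {}" "0 \<le> value_at None z" "value_at None z < 1"
      "\<And>e. e \<in> edges t \<Longrightarrow> z e \<noteq> value_at None z"
    using Cons.prems(3) zt by (auto simp: less_le)
  have "drawing r c t \<or> drawing c r t" using Cons.prems(1) by simp
  then have "fractional_matching (edges t) r c w \<longleftrightarrow> standard 0 z t"
    unfolding w_def using unroll_fractional_matching(1)[OF _ pre] fractional_matching_swap
    by (metis value_at.simps(1))
  also have "\<dots> \<longleftrightarrow> standard 0 y t" by (rule standard_cong) (rule zt)
  finally have fm_t: "fractional_matching (edges t) r c w \<longleftrightarrow> standard 0 y t" .
  have "fractional_matching ?U r c w \<longleftrightarrow> fractional_matching ?U r c z"
    by (rule fractional_matching_cong) (rule wU)
  also have "\<dots> \<longleftrightarrow> (\<forall>t\<in>set ts. standard 0 y t)"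
    unfolding z_def
  proof (rule Cons.IH)
    show "inj_on y ?U" using Cons.prems(2) by (rule inj_on_subset) auto
  qed (use Cons.prems in auto)
  finally have fm_U: "fractional_matching ?U r c w \<longleftrightarrow> (\<forall>t\<in>set ts. standard 0 y t)" .
  have "fractional_matching (edges t \<union> ?U) r c w \<longleftrightarrow>
      fractional_matching (edges t) r c w \<and> fractional_matching ?U r c w"
  proof
    assume "fractional_matching (edges t \<union> ?U) r c w"
    from fractional_matching_subset[OF this]
    show "fractional_matching (edges t) r c w \<and> fractional_matching ?U r c w" by auto
  next
    assume fm: "fractional_matching (edges t) r c w \<and> fractional_matching ?U r c w"
    show "fractional_matching (edges t \<union> ?U) r c w"
    proof (rule fractional_matching_union)
      fix j assume "j \<in> c ` edges t" "j \<in> c ` ?U"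
      then have False using sep(2) by (metis imageE)
      then show "(\<Sum>e | e \<in> edges t \<union> ?U \<and> c e = j. w e) \<le> 1" ..
    qed (use fm sep(1) in blast)+
  qed
  then show ?case using fm_t fm_U by (simp add: w_def z_def)
qed


section \<open>The volume counts standard labellings\<close>

definition matching_volume :: "'e set \<Rightarrow> ('e \<Rightarrow> nat) \<Rightarrow> ('e \<Rightarrow> nat) \<Rightarrow> real" where
  "matching_volume E r c = measure (unit_cube E) {w \<in> space (unit_cube E). fractional_matching E r c w}"

lemma pred_fractional_matching:
  assumes "finite E"
  shows "Measurable.pred (unit_cube E) (fractional_matching E r c)"
  unfolding fractional_matching_def
  by (intro pred_intros_logic pred_intros_finite pred_intros_countable assms
      borel_measurable_pred_less borel_measurable_sum measurable_coord
      borel_measurable_const | simp)+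

lemma matching_volume_swap: "matching_volume E r c = matching_volume E c r"
  unfolding matching_volume_def by (simp add: fractional_matching_swap[of E r c])

lemma measure_eq_AE_pred:
  assumes "Measurable.pred M P" "Measurable.pred M Q" "AE x in M. P x \<longleftrightarrow> Q x"
  shows "measure M {x\<in>space M. P x} = measure M {x\<in>space M. Q x}"
  by (rule measure_eq_AE) (use assms in \<open>auto elim: eventually_mono\<close>)

lemma measure_preserving_pred:
  assumes "f \<in> measurable M M" "distr M M f = M" "Measurable.pred M P"
  shows "measure M {x\<in>space M. P (f x)} = measure M {x\<in>space M. P x}"
proof -
  have "measure M {x\<in>space M. P x} = measure (distr M M f) {x\<in>space M. P x}" by (simp add: assms(2))
  also have "\<dots> = measure M (f -` {x\<in>space M. P x} \<inter> space M)"
    by (rule measure_distr) (use assms in auto)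
  also have "f -` {x\<in>space M. P x} \<inter> space M = {x\<in>space M. P (f x)}"
    using measurable_space[OF assms(1)] by auto
  finally show ?thesis by simp
qed

text \<open>Being standard depends only on the relative order of the labels and of \<open>p\<close>.\<close>

lemma standard_order_iso:
  assumes "\<And>e e'. e \<in> D \<Longrightarrow> e' \<in> D \<Longrightarrow> T e < T e' \<longleftrightarrow> T' e < T' e'" "edges t \<subseteq> D"
    and "\<And>e. e \<in> edges t \<Longrightarrow> (T e < p \<longleftrightarrow> T' e < p') \<and> (p < T e \<longleftrightarrow> p' < T' e)"
  shows "standard p T t \<longleftrightarrow> standard p' T' t"
  using assms(2,3)
proof (induction t arbitrary: p p')
  case (Join s b)
  have "standard p T s \<longleftrightarrow> standard p' T' s" by (rule Join.IH(1)) (use Join.prems in auto)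
  moreover have "standard (T (last_edge s)) T b \<longleftrightarrow> standard (T' (last_edge s)) T' b"
  proof (rule Join.IH(2))
    fix e assume "e \<in> edges b"
    then have "e \<in> D" "last_edge s \<in> D" using Join.prems(1) last_edge_in_edges[of s] by auto
    then show "(T e < T (last_edge s) \<longleftrightarrow> T' e < T' (last_edge s)) \<and>
        (T (last_edge s) < T e \<longleftrightarrow> T' (last_edge s) < T' e)" using assms(1) by simp
  qed (use Join.prems in auto)
  moreover have "cyclic_triple p (T (last_edge s)) (T (first_edge b)) \<longleftrightarrow>
      cyclic_triple p' (T' (last_edge s)) (T' (first_edge b))"
  proof -
    have "last_edge s \<in> D" "first_edge b \<in> D"
      using Join.prems(1) last_edge_in_edges[of s] first_edge_in_edges[of b] by auto
    then show ?thesis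
      using Join.prems(2)[of "last_edge s"] Join.prems(2)[of "first_edge b"] assms(1)
      by (simp add: cyclic_triple_def)
  qed
  ultimately show ?case by simp
qed simp

definition order_chamber :: "nat \<Rightarrow> (nat \<Rightarrow> nat) \<Rightarrow> (nat \<Rightarrow> real) set" where
  "order_chamber n \<sigma> = {y \<in> space (unit_cube {1..n}).
     \<forall>i\<in>{1..n}. \<forall>j\<in>{1..n}. \<sigma> i < \<sigma> j \<longrightarrow> y i < y j}"

lemma pred_less_coords:
  assumes "i \<in> E" "j \<in> E"
  shows "Measurable.pred (unit_cube E) (\<lambda>y. y i < y j)"
  using measurable_coord[OF assms(1)] measurable_coord[OF assms(2)] by measurable

lemma order_chamber_sets: "order_chamber n \<sigma> \<in> sets (unit_cube {1..n})"
  unfolding order_chamber_def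
  by (rule predE) (intro pred_intros_finite pred_intros_imp' pred_less_coords finite_atLeastAtMost)

text \<open>Permuting the coordinates preserves the product measure and permutes the chambers.\<close>

lemma measure_order_chamber:
  assumes "\<sigma> permutes {1..n}"
  shows "measure (unit_cube {1..n}) (order_chamber n \<sigma>) = measure (unit_cube {1..n}) (order_chamber n id)"
proof -
  let ?E = "{1..n}" and ?\<tau> = "inv' \<sigma>"
  let ?f = "\<lambda>y. \<lambda>i\<in>?E. y (?\<tau> i) :: real"
  have \<tau>: "?\<tau> permutes ?E" using assms by (rule permutes_inv)
  have \<tau>E: "?\<tau> i \<in> ?E \<longleftrightarrow> i \<in> ?E" for i using \<tau> by (rule permutes_in_image)
  have distr: "distr (unit_cube ?E) (unit_cube ?E) ?f = unit_cube ?E"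
    by (rule distr_PiM_reindex[OF prob_space_unif])
      (use \<tau> \<tau>E in \<open>auto intro: permutes_inj_on\<close>)
  have meas: "?f \<in> measurable (unit_cube ?E) (unit_cube ?E)"
    by (rule measurable_restrict) (use \<tau>E in \<open>auto intro!: measurable_component_singleton\<close>)
  have "?f -` order_chamber n id \<inter> space (unit_cube ?E) = order_chamber n \<sigma>"
  proof (rule Set.set_eqI)
    fix y :: "nat \<Rightarrow> real"
    have "(\<forall>i\<in>?E. \<forall>j\<in>?E. i < j \<longrightarrow> y (?\<tau> i) < y (?\<tau> j)) \<longleftrightarrow>
        (\<forall>i\<in>\<sigma> ` ?E. \<forall>j\<in>\<sigma> ` ?E. i < j \<longrightarrow> y (?\<tau> i) < y (?\<tau> j))"
      by (simp only: permutes_image[OF assms])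
    also have "\<dots> \<longleftrightarrow> (\<forall>i\<in>?E. \<forall>j\<in>?E. \<sigma> i < \<sigma> j \<longrightarrow> y i < y j)"
      by (simp add: permutes_inverses(2)[OF assms])
    finally show "y \<in> ?f -` order_chamber n id \<inter> space (unit_cube ?E) \<longleftrightarrow> y \<in> order_chamber n \<sigma>"
      using measurable_space[OF meas, of y] by (auto simp: order_chamber_def)
  qed
  then show ?thesis
    using measure_distr[OF meas order_chamber_sets, of id] distr by simp
qed

definition coord_rank :: "nat \<Rightarrow> (nat \<Rightarrow> real) \<Rightarrow> nat \<Rightarrow> nat" where
  "coord_rank n y i = (if i \<in> {1..n} then card {j\<in>{1..n}. y j \<le> y i} else i)"

lemma coord_rank_less:
  assumes "i \<in> {1..n}" "j \<in> {1..n}" "y i < y j"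
  shows "coord_rank n y i < coord_rank n y j"
proof -
  have "{k\<in>{1..n}. y k \<le> y i} \<subseteq> {k\<in>{1..n}. y k \<le> y j}" using assms(3) by auto
  moreover have "j \<in> {k\<in>{1..n}. y k \<le> y j}" "j \<notin> {k\<in>{1..n}. y k \<le> y i}" using assms(2,3) by auto
  ultimately have "{k\<in>{1..n}. y k \<le> y i} \<subset> {k\<in>{1..n}. y k \<le> y j}" by blast
  then have "card {k\<in>{1..n}. y k \<le> y i} < card {k\<in>{1..n}. y k \<le> y j}" by (intro psubset_card_mono) auto
  then show ?thesis using assms by (simp add: coord_rank_def)
qed

lemma coord_rank_permutes:
  assumes "inj_on y {1..n}"
  shows "coord_rank n y permutes {1..n}"
proof -
  have inj: "inj_on (coord_rank n y) {1..n}"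
  proof (rule inj_onI)
    fix i j assume ij: "i \<in> {1..n}" "j \<in> {1..n}" "coord_rank n y i = coord_rank n y j"
    then have "\<not> y i < y j" "\<not> y j < y i" using coord_rank_less by (metis less_irrefl)+
    then show "i = j" using inj_onD[OF assms] ij by (metis linorder_neqE)
  qed
  have "coord_rank n y i \<in> {1..n}" if "i \<in> {1..n}" for i
  proof -
    have "card {j\<in>{1..n}. y j \<le> y i} \<le> card {1..n}" by (rule card_mono) auto
    moreover have "card {j\<in>{1..n}. y j \<le> y i} > 0" using that by (subst card_gt_0_iff) auto
    ultimately show ?thesis using that by (simp add: coord_rank_def)
  qed
  then have "coord_rank n y ` {1..n} = {1..n}" using inj by (intro endo_inj_surj) auto
  with inj show ?thesis
    by (intro bij_imp_permutes) (auto simp: bij_betw_def coord_rank_def)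
qed

text \<open>A permutation that orders the indices as \<open>y\<close> does must send every index to the rank of its coordinate.\<close>

lemma order_chamber_iff_rank:
  assumes "\<sigma> permutes {1..n}" "inj_on y {1..n}" "y \<in> space (unit_cube {1..n})"
  shows "y \<in> order_chamber n \<sigma> \<longleftrightarrow> \<sigma> = coord_rank n y"
proof
  assume y: "y \<in> order_chamber n \<sigma>"
  show "\<sigma> = coord_rank n y"
  proof
    fix i show "\<sigma> i = coord_rank n y i"
    proof (cases "i \<in> {1..n}")
      case True
      have "y j \<le> y i \<longleftrightarrow> \<sigma> j \<le> \<sigma> i" if "j \<in> {1..n}" for j
      proof -
        have "\<sigma> i < \<sigma> j \<Longrightarrow> y i < y j" "\<sigma> j < \<sigma> i \<Longrightarrow> y j < y i"
          using y True that by (auto simp: order_chamber_def)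
        moreover have "\<sigma> i = \<sigma> j \<Longrightarrow> i = j" using permutes_inj[OF assms(1)] by (simp add: inj_eq)
        ultimately show ?thesis by (metis linorder_not_less nat_neq_iff order_le_less order_less_imp_le)
      qed
      then have "card {j\<in>{1..n}. y j \<le> y i} = card {j\<in>{1..n}. \<sigma> j \<le> \<sigma> i}"
        by (intro arg_cong[of _ _ card]) auto
      also have "\<dots> = card (\<sigma> ` {j\<in>{1..n}. \<sigma> j \<le> \<sigma> i})"
        using permutes_inj[OF assms(1)] by (intro card_image[symmetric]) (meson inj_on_subset subset_UNIV)
      also have "\<sigma> ` {j\<in>{1..n}. \<sigma> j \<le> \<sigma> i} = {k \<in> \<sigma> ` {1..n}. k \<le> \<sigma> i}" by auto
      also have "\<dots> = {1..\<sigma> i}"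
        unfolding permutes_image[OF assms(1)] using permutes_in_image[OF assms(1), of i] True by auto
      finally show ?thesis using True by (simp add: coord_rank_def)
    next
      case False
      then show ?thesis using permutes_not_in[OF assms(1) False] by (auto simp: coord_rank_def)
    qed
  qed
next
  assume \<sigma>: "\<sigma> = coord_rank n y"
  have "y i < y j" if ij: "i \<in> {1..n}" "j \<in> {1..n}" "\<sigma> i < \<sigma> j" for i j
  proof (rule ccontr)
    assume "\<not> y i < y j"
    then consider "y j < y i" | "y i = y j" by linarith
    then show False
    proof cases
      case 1
      then show False using coord_rank_less[OF ij(2,1), of y] ij(3) by (simp add: \<sigma>)
    next
      case 2
      then have "i = j" using inj_onD[OF assms(2)] ij by blast
      then show False using ij(3) by simp
    qed
  qed
  then show "y \<in> order_chamber n \<sigma>" using assms(3) by (auto simp: order_chamber_def)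
qed

lemma measure_union_order_chambers:
  assumes "X \<subseteq> {\<sigma>. \<sigma> permutes {1..n}}"
  shows "fact n * measure (unit_cube {1..n}) (\<Union>\<sigma>\<in>X. order_chamber n \<sigma>) = card X"
proof -
  let ?P = "unit_cube {1..n}"
  interpret prob_space ?P by (rule prob_space_unit_cube)
  have fin: "finite {\<sigma>. \<sigma> permutes {1..n}}" by (rule finite_permutations) simp
  define q where "q = measure ?P (order_chamber n id)"
  have disj: "order_chamber n \<sigma> \<inter> order_chamber n \<rho> = {}"
    if "\<sigma> permutes {1..n}" "\<rho> permutes {1..n}" "\<sigma> \<noteq> \<rho>" for \<sigma> \<rho>
  proof (rule ccontr)
    assume "order_chamber n \<sigma> \<inter> order_chamber n \<rho> \<noteq> {}"
    then obtain y where y: "y \<in> order_chamber n \<sigma>" "y \<in> order_chamber n \<rho>" by blast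
    have "inj_on y {1..n}"
    proof (rule inj_onI)
      fix i j assume ij: "i \<in> {1..n}" "j \<in> {1..n}" "y i = y j"
      have less: "y k < y l" if "k \<in> {1..n}" "l \<in> {1..n}" "\<sigma> k < \<sigma> l" for k l
        using y(1) that unfolding order_chamber_def by blast
      have "\<not> \<sigma> i < \<sigma> j" "\<not> \<sigma> j < \<sigma> i" using less[OF ij(1,2)] less[OF ij(2,1)] ij(3) by linarith+
      then show "i = j" using permutes_inj[OF that(1)] by (metis injD nat_neq_iff)
    qed
    moreover have "y \<in> space ?P" using y by (simp add: order_chamber_def)
    ultimately show False using order_chamber_iff_rank y that by metis
  qed
  have sum: "measure ?P (\<Union>\<sigma>\<in>Y. order_chamber n \<sigma>) = card Y * q" if "Y \<subseteq> {\<sigma>. \<sigma> permutes {1..n}}" for Y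
  proof -
    have "measure ?P (\<Union>\<sigma>\<in>Y. order_chamber n \<sigma>) = (\<Sum>\<sigma>\<in>Y. measure ?P (order_chamber n \<sigma>))"
    proof (rule finite_measure_finite_Union)
      show "finite Y" using fin that by (rule finite_subset[rotated])
      show "(\<lambda>\<sigma>. order_chamber n \<sigma>) ` Y \<subseteq> sets ?P" using order_chamber_sets by auto
      show "disjoint_family_on (\<lambda>\<sigma>. order_chamber n \<sigma>) Y"
        unfolding disjoint_family_on_def using disj that by blast
    qed
    also have "\<dots> = (\<Sum>\<sigma>\<in>Y. q)"
    proof (rule sum.cong[OF refl])
      fix \<sigma> assume "\<sigma> \<in> Y"
      with that have "\<sigma> permutes {1..n}" by blast
      then show "measure ?P (order_chamber n \<sigma>) = q" unfolding q_def by (rule measure_order_chamber)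
    qed
    finally show ?thesis by simp
  qed
  have "measure ?P (\<Union>\<sigma>\<in>{\<sigma>. \<sigma> permutes {1..n}}. order_chamber n \<sigma>) = 1"
  proof (subst prob_eq_1)
    show "(\<Union>\<sigma>\<in>{\<sigma>. \<sigma> permutes {1..n}}. order_chamber n \<sigma>) \<in> sets ?P"
      using fin order_chamber_sets by (intro sets.finite_UN) auto
    have "AE y in ?P. inj_on y {1..n}" by (rule AE_unit_cube_inj) simp
    then show "AE y in ?P. y \<in> (\<Union>\<sigma>\<in>{\<sigma>. \<sigma> permutes {1..n}}. order_chamber n \<sigma>)"
      using AE_space by eventually_elim (use coord_rank_permutes order_chamber_iff_rank in blast)
  qed
  then have "fact n * q = 1" using sum[OF subset_refl] by (simp add: card_permutations[OF refl])
  then show ?thesis using sum[OF assms] by (simp add: mult.left_commute)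
qed

text \<open>Unrolling preserves the measure and, outside a null set, pulls the matching polytope back to the
union of the order chambers of the standard permutations.\<close>

lemma matching_volume_count:
  assumes "forest_drawing r c ts" "\<Union>(edges ` set ts) = {1..n}"
  shows "fact n * matching_volume {1..n} r c = card {\<sigma>. \<sigma> permutes {1..n} \<and> (\<forall>t\<in>set ts. standard 0 \<sigma> t)}"
    (is "_ = real (card ?X)")
proof -
  let ?P = "unit_cube {1..n}"
  have unroll: "unroll_forest ts \<in> measurable ?P ?P" "distr ?P ?P (unroll_forest ts) = ?P"
    using unroll_forest_measure_preserving[OF _ _ assms(1), of "{1..n}"] assms(2) by auto
  have perms: "?X \<subseteq> {\<sigma>. \<sigma> permutes {1..n}}" by blast
  then have fin: "finite ?X" by (rule finite_subset) (simp add: finite_permutations)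
  have pred: "Measurable.pred ?P (fractional_matching {1..n} r c)" by (rule pred_fractional_matching) simp
  have "matching_volume {1..n} r c = measure ?P {y \<in> space ?P. fractional_matching {1..n} r c (unroll_forest ts y)}"
    unfolding matching_volume_def by (rule measure_preserving_pred[OF unroll pred, symmetric])
  also have "\<dots> = measure ?P {y \<in> space ?P. y \<in> (\<Union>\<sigma>\<in>?X. order_chamber n \<sigma>)}"
  proof (rule measure_eq_AE_pred)
    show "Measurable.pred ?P (\<lambda>y. fractional_matching {1..n} r c (unroll_forest ts y))"
      by (rule measurable_compose[OF unroll(1) pred])
    show "Measurable.pred ?P (\<lambda>y. y \<in> (\<Union>\<sigma>\<in>?X. order_chamber n \<sigma>))"
    proof (rule pred_sets2)
      show "(\<Union>\<sigma>\<in>?X. order_chamber n \<sigma>) \<in> sets ?P"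
        using fin order_chamber_sets by (intro sets.finite_UN) blast+
    qed (rule measurable_ident_sets[OF refl])
    have "AE y in ?P. inj_on y {1..n}" "AE y in ?P. \<forall>i\<in>{1..n}. 0 < y i \<and> y i < 1"
      by (rule AE_unit_cube_inj AE_unit_cube_open, simp)+
    then show "AE y in ?P. fractional_matching {1..n} r c (unroll_forest ts y) \<longleftrightarrow> y \<in> (\<Union>\<sigma>\<in>?X. order_chamber n \<sigma>)"
      using AE_space
    proof eventually_elim
      fix y assume inj: "inj_on y {1..n}" and unit: "\<forall>i\<in>{1..n}. 0 < y i \<and> y i < 1" and sp: "y \<in> space ?P"
      let ?\<rho> = "coord_rank n y"
      have perm: "?\<rho> permutes {1..n}" using inj by (rule coord_rank_permutes)
      have ord: "y i < y j \<longleftrightarrow> ?\<rho> i < ?\<rho> j" if "i \<in> {1..n}" "j \<in> {1..n}" for i j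
        using coord_rank_less[OF that, of y] coord_rank_less[OF that(2,1), of y] inj_onD[OF inj _ that]
        by (metis less_asym less_irrefl linorder_neqE)
      have pos: "0 < ?\<rho> i" if "i \<in> {1..n}" for i using permutes_in_image[OF perm, of i] that by simp
      have "standard 0 y t \<longleftrightarrow> standard 0 ?\<rho> t" if "t \<in> set ts" for t
      proof (rule standard_order_iso[OF ord])
        show t: "edges t \<subseteq> {1..n}" using that assms(2) by auto
        fix e assume "e \<in> edges t"
        with t have "e \<in> {1..n}" by blast
        then show "(y e < 0 \<longleftrightarrow> ?\<rho> e < 0) \<and> (0 < y e \<longleftrightarrow> 0 < ?\<rho> e)" using unit pos by (auto simp: not_less less_imp_le)
      qed
      then have "fractional_matching {1..n} r c (unroll_forest ts y) \<longleftrightarrow> ?\<rho> \<in> ?X"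
        using unroll_forest_fractional_matching[OF assms(1), of y] inj unit perm by (simp add: assms(2))
      also have "\<dots> \<longleftrightarrow> (\<exists>\<sigma>\<in>?X. y \<in> order_chamber n \<sigma>)"
        using order_chamber_iff_rank[OF _ inj sp] by auto
      finally show "fractional_matching {1..n} r c (unroll_forest ts y) \<longleftrightarrow> y \<in> (\<Union>\<sigma>\<in>?X. order_chamber n \<sigma>)"
        by simp
    qed
  qed
  also have "{y \<in> space ?P. y \<in> (\<Union>\<sigma>\<in>?X. order_chamber n \<sigma>)} = (\<Union>\<sigma>\<in>?X. order_chamber n \<sigma>)"
    by (auto simp: order_chamber_def)
  finally show ?thesis using measure_union_order_chambers[OF perms] by simp
qed

section \<open>Splitting the matching polytope\<close>

text \<open>Subtract coordinate \<open>e1\<close> from coordinate \<open>e2\<close>, modulo \<open>1\<close>. If \<open>w e1 < w e2\<close>, then the constraint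
\<open>w e1 + w e2 + S \<le> 1\<close> of the common row pulls back to \<open>w e2 + S \<le> 1\<close>, the constraint of that row after
\<open>e1\<close> has left it. If \<open>w e1 > w e2\<close>, then the pulled back left-hand side is \<open>w e2 + 1 + S\<close>, which is too
large. The column of \<open>e2\<close> and the new row contain one edge each and impose nothing on the cube, and
no other constraint involves \<open>e2\<close>.\<close>

lemma matching_volume_slide:
  assumes "finite E" "e1 \<in> E" "e2 \<in> E" "e1 \<noteq> e2" "r e1 = r e2"
    and leaf: "\<And>e. e \<in> E \<Longrightarrow> c e = c e2 \<Longrightarrow> e = e2" and x: "x \<notin> r ` E"
  shows "matching_volume E r c =
    measure (unit_cube E) {w \<in> space (unit_cube E). fractional_matching E (r(e1 := x)) c w \<and> w e1 < w e2}"
proof -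
  let ?P = "unit_cube E" and ?rot = "rotate_coord (Some e1) e2" and ?r = "r(e1 := x)"
  have rot: "?rot \<in> measurable ?P ?P" "distr ?P ?P ?rot = ?P"
    using assms(1-4) by (auto intro!: measurable_rotate_coord distr_rotate_coord)
  have xr: "r e \<noteq> x" if "e \<in> E" for e using x that by blast
  have pred: "Measurable.pred ?P (fractional_matching E r c)" for r c
    using assms(1) by (rule pred_fractional_matching)
  have key: "fractional_matching E r c (?rot w) \<longleftrightarrow> fractional_matching E ?r c w \<and> w e1 < w e2"
    if unit: "\<forall>e\<in>E. 0 < w e \<and> w e < 1" and inj: "inj_on w E" for w
  proof -
    define w' where "w' = ?rot w"
    have ne: "w e1 \<noteq> w e2" using inj_onD[OF inj _ assms(2,3)] assms(4) by blast
    have w'2: "w' e2 = (if w e1 < w e2 then w e2 - w e1 else w e2 - w e1 + 1)"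
    proof -
      have "0 < w e1" "w e1 < 1" "0 < w e2" "w e2 < 1" using unit assms(2,3) by auto
      then have "frac (w e2 - w e1) = (if 0 \<le> w e2 - w e1 then w e2 - w e1 else w e2 - w e1 + 1)"
        by (intro frac_eq_on_unit_interval) linarith+
      then show ?thesis using ne by (auto simp: w'_def rotate_coord_def)
    qed
    have w'other: "w' e = w e" if "e \<noteq> e2" for e using that by (simp add: w'_def rotate_coord_def)
    have unit1: "0 < w e" "w e < 1" if "e \<in> E" for e using unit that by auto
    define S where "S = (\<Sum>e | e \<in> E - {e1, e2} \<and> r e = r e1. w e)"
    have S: "0 \<le> S" unfolding S_def by (rule sum_nonneg) (use unit1 in \<open>auto intro: less_imp_le\<close>)
    have S': "S = (\<Sum>e | e \<in> E - {e1, e2} \<and> r e = r e1. w' e)"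
      unfolding S_def by (rule sum.cong) (auto simp: w'other)
    have row_v': "(\<Sum>e | e \<in> E \<and> r e = r e1. w' e) = w e1 + w' e2 + S"
    proof -
      have "{e. e \<in> E \<and> r e = r e1} = insert e1 (insert e2 {e. e \<in> E - {e1, e2} \<and> r e = r e1})"
        using assms(2,3,5) by auto
      then show ?thesis using assms(1,4) w'other[OF assms(4)] by (simp add: S')
    qed
    have row_v: "(\<Sum>e | e \<in> E \<and> ?r e = r e1. w e) = w e2 + S"
    proof -
      have "{e. e \<in> E \<and> ?r e = r e1} = insert e2 {e. e \<in> E - {e1, e2} \<and> r e = r e1}"
        using assms(2,3,4,5) xr by auto
      then show ?thesis using assms(1) by (simp add: S_def)
    qed
    have row_x: "(\<Sum>e | e \<in> E \<and> ?r e = x. w e) = w e1"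
    proof -
      have "{e. e \<in> E \<and> ?r e = x} = {e1}" using assms(2) xr by auto
      then show ?thesis by simp
    qed
    have row_x': "(\<Sum>e | e \<in> E \<and> r e = x. w' e) = 0"
      by (rule sum.neutral) (use xr in blast)
    have row_other: "(\<Sum>e | e \<in> E \<and> ?r e = i. w e) = (\<Sum>e | e \<in> E \<and> r e = i. w' e)"
      if "i \<noteq> r e1" "i \<noteq> x" for i
    proof (rule sum.cong)
      show "{e. e \<in> E \<and> ?r e = i} = {e. e \<in> E \<and> r e = i}" using that by auto
      show "w e = w' e" if "e \<in> {e. e \<in> E \<and> r e = i}" for e
      proof -
        have "e \<noteq> e2" using that \<open>i \<noteq> r e1\<close> assms(5) by auto
        then show ?thesis by (simp add: w'other)
      qed
    qed
    have w'2_unit: "0 < w' e2" "w' e2 < 1"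
      using ne w'2 unit1[OF assms(2)] unit1[OF assms(3)] by (auto split: if_splits)
    have col: "(\<Sum>e | e \<in> E \<and> c e = j. w e) \<le> 1 \<longleftrightarrow> (\<Sum>e | e \<in> E \<and> c e = j. w' e) \<le> 1" for j
    proof (cases "j = c e2")
      case True
      then have "{e. e \<in> E \<and> c e = j} = {e2}" using leaf assms(3) by auto
      then show ?thesis using w'2_unit unit1[OF assms(3)] by simp
    next
      case False
      have "(\<Sum>e | e \<in> E \<and> c e = j. w e) = (\<Sum>e | e \<in> E \<and> c e = j. w' e)"
      proof (rule sum.cong[OF refl])
        fix e assume "e \<in> {e. e \<in> E \<and> c e = j}"
        then have "e \<noteq> e2" using False by auto
        then show "w e = w' e" by (simp add: w'other)
      qed
      then show ?thesis by simp
    qed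
    have nonneg: "0 \<le> w e" "0 \<le> w' e" if "e \<in> E" for e
      using unit1[OF that] w'2_unit w'other[of e] by (cases "e = e2"; simp)+
    show ?thesis
    proof (cases "w e1 < w e2")
      case True
      have "(\<Sum>e | e \<in> E \<and> ?r e = i. w e) \<le> 1 \<longleftrightarrow> (\<Sum>e | e \<in> E \<and> r e = i. w' e) \<le> 1" for i
      proof -
        consider "i = r e1" | "i = x" | "i \<noteq> r e1" "i \<noteq> x" by blast
        then show ?thesis
        proof cases
          case 1
          then show ?thesis using row_v row_v' w'2 True by simp
        next
          case 2
          then show ?thesis using row_x row_x' unit1[OF assms(2)] by simp
        next
          case 3
          show ?thesis unfolding row_other[OF 3] ..
        qed
      qed
      then show ?thesis using True nonneg col unfolding fractional_matching_def w'_def[symmetric] by simp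
    next
      case False
      have "\<not> (\<Sum>e | e \<in> E \<and> r e = r e1. w' e) \<le> 1"
        unfolding row_v' using False w'2 S unit1[OF assms(3)] by simp
      then show ?thesis using False unfolding fractional_matching_def w'_def[symmetric] by blast
    qed
  qed
  have "matching_volume E r c = measure ?P {w \<in> space ?P. fractional_matching E r c (?rot w)}"
    unfolding matching_volume_def by (rule measure_preserving_pred[OF rot pred, symmetric])
  also have "\<dots> = measure ?P {w \<in> space ?P. fractional_matching E ?r c w \<and> w e1 < w e2}"
  proof (rule measure_eq_AE_pred)
    show "Measurable.pred ?P (\<lambda>w. fractional_matching E r c (?rot w))"
      by (rule measurable_compose[OF rot(1) pred])
    show "Measurable.pred ?P (\<lambda>w. fractional_matching E ?r c w \<and> w e1 < w e2)"
      by (intro pred_intros_logic pred pred_less_coords assms(2,3))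
    show "AE w in ?P. fractional_matching E r c (?rot w) \<longleftrightarrow> fractional_matching E ?r c w \<and> w e1 < w e2"
      using AE_unit_cube_open[OF assms(1)] AE_unit_cube_inj[OF assms(1)]
      by eventually_elim (rule key)
  qed
  finally show ?thesis .
qed

text \<open>The two summands are the parts of the polytope on the right where \<open>w e1 < w e2\<close> and where
\<open>w e2 < w e1\<close>. For the second summand apply the previous lemma with rows and columns, and with \<open>e1\<close> and
\<open>e2\<close>, interchanged.\<close>

lemma matching_volume_recurrence:
  assumes "finite E" "e1 \<in> E" "e2 \<in> E" "e1 \<noteq> e2" "r e1 = r e2"
    and leaf: "\<And>e. e \<in> E \<Longrightarrow> c e = c e2 \<Longrightarrow> e = e2" and x: "x \<notin> r ` E"
  shows "matching_volume E r c + matching_volume E (r(e1 := x)) (c(e2 := c e1))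
    = matching_volume E (r(e1 := x)) c"
proof -
  let ?P = "unit_cube E" and ?r = "r(e1 := x)" and ?c = "c(e2 := c e1)"
  let ?below = "{w \<in> space ?P. fractional_matching E ?r c w \<and> w e1 < w e2}"
  let ?above = "{w \<in> space ?P. fractional_matching E ?r c w \<and> w e2 < w e1}"
  interpret prob_space ?P by (rule prob_space_unit_cube)
  have pred: "Measurable.pred ?P (fractional_matching E ?r c)"
    using assms(1) by (rule pred_fractional_matching)
  have less: "Measurable.pred ?P (\<lambda>w. w e1 < w e2)" "Measurable.pred ?P (\<lambda>w. w e2 < w e1)"
    by (intro pred_less_coords assms(2,3))+
  have "matching_volume E ?r ?c = matching_volume E ?c ?r" by (rule matching_volume_swap)
  also have "\<dots> = measure ?P {w \<in> space ?P. fractional_matching E (?c(e2 := c e2)) ?r w \<and> w e2 < w e1}"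
  proof (rule matching_volume_slide[OF assms(1,3,2)])
    show "e = e1" if "e \<in> E" "?r e = ?r e1" for e using that x by (auto split: if_splits)
    show "c e2 \<notin> ?c ` E" using leaf assms(2,4) by (auto simp: image_iff)
  qed (use assms(4) in auto)
  also have "?c(e2 := c e2) = c" by simp
  also have "fractional_matching E c ?r = fractional_matching E ?r c"
    by (intro ext) (rule fractional_matching_swap)
  finally have above: "matching_volume E ?r ?c = measure ?P ?above" .
  have below: "matching_volume E r c = measure ?P ?below"
    by (rule matching_volume_slide[OF assms])
  have "measure ?P ?below
      + measure ?P ?above
      = measure ?P (?below
          \<union> ?above)"
    by (rule finite_measure_Union[symmetric]) (use pred less in auto)
  also have "\<dots> = measure ?P {w \<in> space ?P. fractional_matching E ?r c w \<and> (w e1 < w e2 \<or> w e2 < w e1)}"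
    by (rule arg_cong[of _ _ "measure ?P"]) auto
  also have "\<dots> = measure ?P {w \<in> space ?P. fractional_matching E ?r c w}"
  proof (rule measure_eq_AE_pred)
    show "AE w in ?P. fractional_matching E ?r c w \<and> (w e1 < w e2 \<or> w e2 < w e1) \<longleftrightarrow> fractional_matching E ?r c w"
      using AE_unit_cube_inj[OF assms(1)]
    proof eventually_elim
      fix w :: "'a \<Rightarrow> real" assume "inj_on w E"
      then have "w e1 \<noteq> w e2" using inj_onD[OF _ _ assms(2,3)] assms(4) by blast
      then show "fractional_matching E ?r c w \<and> (w e1 < w e2 \<or> w e2 < w e1) \<longleftrightarrow> fractional_matching E ?r c w"
        by (auto simp: neq_iff)
    qed
  qed (intro pred_intros_logic pred less)+
  finally show ?thesis unfolding above below by (simp only: matching_volume_def)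
qed

lemma matching_volume_matching:
  assumes "finite E" "inj_on r E" "inj_on c E"
  shows "matching_volume E r c = 1"
proof -
  interpret prob_space "unit_cube E" by (rule prob_space_unit_cube)
  have "AE w in unit_cube E. fractional_matching E r c w"
    using AE_unit_cube_open[OF assms(1)]
  proof eventually_elim
    fix w :: "'a \<Rightarrow> real" assume unit: "\<forall>e\<in>E. 0 < w e \<and> w e < 1"
    have "(\<Sum>e | e \<in> E \<and> f e = i. w e) \<le> 1" if f: "inj_on f E" for f :: "'a \<Rightarrow> nat" and i
    proof (cases "i \<in> f ` E")
      case True
      then obtain d where "d \<in> E" "i = f d" by blast
      then have "{e. e \<in> E \<and> f e = i} = {d}" using inj_onD[OF f] by auto
      then show ?thesis using unit \<open>d \<in> E\<close> by (simp add: less_imp_le)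
    next
      case False
      then have "{e. e \<in> E \<and> f e = i} = {}" by blast
      then show ?thesis by (simp only: sum.empty)
    qed
    then show "fractional_matching E r c w"
      using unit assms(2,3) by (auto simp: fractional_matching_def less_imp_le)
  qed
  then show ?thesis unfolding matching_volume_def
    by (intro prob_Collect_eq_1[THEN iffD2] predE pred_fractional_matching assms(1))
qed


section \<open>Change of index set and Lebesgue measure\<close>

lemma matching_volume_reindex:
  assumes "bij_betw \<eta> I E" "finite I"
  shows "matching_volume E r c = matching_volume I (r \<circ> \<eta>) (c \<circ> \<eta>)"
proof -
  let ?f = "\<lambda>\<omega>. \<lambda>i\<in>I. \<omega> (\<eta> i) :: real"
  let ?M = "{w \<in> space (unit_cube I). fractional_matching I (r \<circ> \<eta>) (c \<circ> \<eta>) w}"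
  have \<eta>: "\<eta> i \<in> E" if "i \<in> I" for i using bij_betwE[OF assms(1)] that by blast
  have distr: "distr (unit_cube E) (unit_cube I) ?f = unit_cube I"
    by (rule distr_PiM_reindex[OF prob_space_unif]) (use assms(1) \<eta> in \<open>auto simp: bij_betw_def\<close>)
  have meas: "?f \<in> measurable (unit_cube E) (unit_cube I)"
    by (rule measurable_restrict) (rule measurable_component_singleton[OF \<eta>])
  have fm: "fractional_matching I (r \<circ> \<eta>) (c \<circ> \<eta>) (?f w) \<longleftrightarrow> fractional_matching E r c w" for w
  proof -
    have "(\<Sum>i | i \<in> I \<and> (g \<circ> \<eta>) i = k. ?f w i) = (\<Sum>e | e \<in> E \<and> g e = k. w e)" for g :: "_ \<Rightarrow> nat" and k
    proof -
      have "bij_betw \<eta> {i. i \<in> I \<and> (g \<circ> \<eta>) i = k} {e. e \<in> E \<and> g e = k}"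
        by (rule bij_betw_subset[OF assms(1)]) (use bij_betw_imp_surj_on[OF assms(1)] in auto)
      from sum.reindex_bij_betw[OF this, of w]
      have "(\<Sum>i | i \<in> I \<and> (g \<circ> \<eta>) i = k. w (\<eta> i)) = (\<Sum>e | e \<in> E \<and> g e = k. w e)" .
      moreover have "(\<Sum>i | i \<in> I \<and> (g \<circ> \<eta>) i = k. ?f w i) = (\<Sum>i | i \<in> I \<and> (g \<circ> \<eta>) i = k. w (\<eta> i))"
        by (rule sum.cong) auto
      ultimately show ?thesis by (simp only:)
    qed
    moreover have "(\<forall>i\<in>I. 0 \<le> ?f w i) \<longleftrightarrow> (\<forall>e\<in>E. 0 \<le> w e)"
      using bij_betw_imp_surj_on[OF assms(1)] by auto
    ultimately show ?thesis unfolding fractional_matching_def by simp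
  qed
  have "matching_volume I (r \<circ> \<eta>) (c \<circ> \<eta>) = measure (distr (unit_cube E) (unit_cube I) ?f)
      ?M"
    by (simp only: distr matching_volume_def)
  also have "\<dots> = measure (unit_cube E)
      (?f -` ?M \<inter> space (unit_cube E))"
    by (rule measure_distr[OF meas]) (rule predE[OF pred_fractional_matching[OF assms(2)]])
  also have "?f -` ?M \<inter> space (unit_cube E)
      = {w \<in> space (unit_cube E). fractional_matching E r c w}"
    using measurable_space[OF meas] fm by blast
  finally show ?thesis by (simp only: matching_volume_def)
qed

lemma unit_cube_density:
  assumes "finite E"
  shows "unit_cube E = density (\<Pi>\<^sub>M e\<in>E. lborel) (indicator (E \<rightarrow>\<^sub>E {0..1}))"
proof -
  interpret U: product_sigma_finite "\<lambda>_. unif"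
    by (intro product_sigma_finite.intro prob_space_imp_sigma_finite prob_space_unif)
  interpret L: product_sigma_finite "\<lambda>_. lborel :: real measure"
    by (intro product_sigma_finite.intro sigma_finite_lborel)
  let ?L = "\<Pi>\<^sub>M e\<in>E. lborel :: real measure"
  have cube: "E \<rightarrow>\<^sub>E {0..1} \<in> sets ?L" using assms by (intro sets_PiM_I_finite) auto
  have "density ?L (indicator (E \<rightarrow>\<^sub>E {0..1})) = unit_cube E"
  proof (rule U.PiM_eqI[OF assms])
    show "sets (density ?L (indicator (E \<rightarrow>\<^sub>E {0..1}))) = sets (unit_cube E)"
      by (simp cong: sets_PiM_cong)
    fix A :: "'a \<Rightarrow> real set" assume "\<And>e. e \<in> E \<Longrightarrow> A e \<in> sets unif"
    then have A: "A e \<in> sets borel" if "e \<in> E" for e using that by simp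
    have "emeasure (density ?L (indicator (E \<rightarrow>\<^sub>E {0..1}))) (Pi\<^sub>E E A)
        = (\<integral>\<^sup>+w. indicator (E \<rightarrow>\<^sub>E {0..1}) w * indicator (Pi\<^sub>E E A) w \<partial>?L)"
      using cube A assms by (intro emeasure_density sets_PiM_I_finite) auto
    also have "\<dots> = (\<integral>\<^sup>+w. indicator (\<Pi>\<^sub>E e\<in>E. {0..1} \<inter> A e) w \<partial>?L)"
      by (rule nn_integral_cong) (auto simp: indicator_def PiE_iff)
    also have "\<dots> = emeasure ?L (\<Pi>\<^sub>E e\<in>E. {0..1} \<inter> A e)"
      using A assms by (intro nn_integral_indicator sets_PiM_I_finite) auto
    also have "\<dots> = (\<Prod>e\<in>E. emeasure lborel ({0..1} \<inter> A e))"
      using A assms by (intro L.emeasure_PiM) auto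
    also have "\<dots> = (\<Prod>e\<in>E. emeasure unif (A e))"
      using A by (intro prod.cong) (auto simp: divide_ennreal_def)
    finally show "emeasure (density ?L (indicator (E \<rightarrow>\<^sub>E {0..1}))) (Pi\<^sub>E E A) = (\<Prod>e\<in>E. emeasure unif (A e))" .
  qed
  then show ?thesis by simp
qed

text \<open>Fractional matchings have all weights in \<open>[0, 1]\<close>, so they lie in the cube, where both measures agree.\<close>

lemma lebesgue_measure_fractional_matchings:
  assumes "finite E"
  shows "measure (\<Pi>\<^sub>M e\<in>E. lborel) {w \<in> E \<rightarrow>\<^sub>E UNIV. fractional_matching E r c w} = matching_volume E r c"
proof -
  let ?L = "\<Pi>\<^sub>M e\<in>E. lborel :: real measure"
  let ?M = "{w \<in> E \<rightarrow>\<^sub>E UNIV. fractional_matching E r c w}"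
  have space: "space (unit_cube E) = E \<rightarrow>\<^sub>E UNIV" by (simp add: space_PiM)
  have M: "?M \<in> sets (unit_cube E)"
    using predE[OF pred_fractional_matching[OF assms]] space by metis
  then have Mb: "?M \<in> sets ?L" by (simp cong: sets_PiM_cong)
  have le: "w e \<le> 1" if "fractional_matching E r c w" "e \<in> E" for w e
  proof -
    have "w e = (\<Sum>d\<in>{e}. w d)" by simp
    also have "\<dots> \<le> (\<Sum>d | d \<in> E \<and> r d = r e. w d)"
      using that assms by (intro sum_mono2) (auto simp: fractional_matching_def)
    also have "\<dots> \<le> 1" using that(1) by (simp add: fractional_matching_def)
    finally show ?thesis .
  qed
  have cube: "E \<rightarrow>\<^sub>E {0..1} \<in> sets ?L" using assms by (intro sets_PiM_I_finite) auto
  have "emeasure (unit_cube E) ?M = (\<integral>\<^sup>+w. indicator (E \<rightarrow>\<^sub>E {0..1}) w * indicator ?M w \<partial>?L)"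
    unfolding unit_cube_density[OF assms] using cube Mb by (intro emeasure_density) auto
  also have "\<dots> = (\<integral>\<^sup>+w. indicator ?M w \<partial>?L)"
    using le by (intro nn_integral_cong) (auto simp: indicator_def PiE_iff fractional_matching_def)
  also have "\<dots> = emeasure ?L ?M" using Mb by (rule nn_integral_indicator)
  finally show ?thesis by (simp add: matching_volume_def measure_def space)
qed

section \<open>Convolution on the symmetric group\<close>

abbreviation perms :: "nat \<Rightarrow> (nat \<Rightarrow> nat) set" where
  "perms n \<equiv> {p. p permutes {1..n}}"

lemma finite_perms: "finite (perms n)"
  by (rule finite_permutations) simp

lemma sum_perms_compose_left:
  assumes "q \<in> perms n"
  shows "(\<Sum>p\<in>perms n. F p) = (\<Sum>p\<in>perms n. F (q \<circ> p))"
proof (rule sum.reindex_bij_witness[where i = "\<lambda>p. q \<circ> p" and j = "\<lambda>p. inv' q \<circ> p"])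
  have q: "q permutes {1..n}" using assms by simp
  fix p assume "p \<in> perms n"
  then have p: "p permutes {1..n}" by simp
  show eq: "q \<circ> (inv' q \<circ> p) = p" "inv' q \<circ> (q \<circ> p) = p"
    by (auto simp: permutes_inverses[OF q])
  show "inv' q \<circ> p \<in> perms n" "q \<circ> p \<in> perms n"
    using permutes_compose[OF p permutes_inv[OF q]] permutes_compose[OF p q] by auto
  show "F (q \<circ> (inv' q \<circ> p)) = F p" by (simp only: eq)
qed

lemma sum_perms_compose_right:
  assumes "q \<in> perms n"
  shows "(\<Sum>p\<in>perms n. F p) = (\<Sum>p\<in>perms n. F (p \<circ> q))"
proof (rule sum.reindex_bij_witness[where i = "\<lambda>p. p \<circ> q" and j = "\<lambda>p. p \<circ> inv' q"])
  have q: "q permutes {1..n}" using assms by simp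
  fix p assume "p \<in> perms n"
  then have p: "p permutes {1..n}" by simp
  show eq: "(p \<circ> inv' q) \<circ> q = p" "(p \<circ> q) \<circ> inv' q = p"
    by (auto simp: permutes_inverses[OF q])
  show "p \<circ> inv' q \<in> perms n" "p \<circ> q \<in> perms n"
    using permutes_compose[OF permutes_inv[OF q] p] permutes_compose[OF q p] by auto
  show "F ((p \<circ> inv' q) \<circ> q) = F p" by (simp only: eq)
qed

lemma sum_perms_inverse: "(\<Sum>p\<in>perms n. F p) = (\<Sum>p\<in>perms n. F (inv' p))"
  by (rule sum.reindex_bij_witness[where i = inv' and j = inv'])
    (auto simp: permutes_inv permutes_inv_inv)

abbreviation conv :: "nat \<Rightarrow> ((nat \<Rightarrow> nat) \<Rightarrow> complex) \<Rightarrow> ((nat \<Rightarrow> nat) \<Rightarrow> complex) \<Rightarrow> (nat \<Rightarrow> nat) \<Rightarrow> complex" where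
  "conv n \<equiv> ga_mult (sym_group n)"

lemma conv_apply:
  "conv n f g x = (if x \<in> perms n then \<Sum>y\<in>perms n. f y * g (inv' y \<circ> x) else 0)"
proof -
  have expand: "conv n f g x = (\<Sum>(y, z) | y \<in> perms n \<and> z \<in> perms n \<and> y \<circ> z = x. f y * g z)"
    unfolding ga_mult_def by (simp add: sym_group_def)
  show ?thesis
  proof (cases "x \<in> perms n")
    case True
    then have x: "x permutes {1..n}" by simp
    have "(\<Sum>(y, z) | y \<in> perms n \<and> z \<in> perms n \<and> y \<circ> z = x. f y * g z)
        = (\<Sum>y\<in>perms n. f y * g (inv' y \<circ> x))"
    proof (rule sum.reindex_bij_witness[where i = "\<lambda>y. (y, inv' y \<circ> x)" and j = fst])
      fix a assume "a \<in> {(y, z). y \<in> perms n \<and> z \<in> perms n \<and> y \<circ> z = x}"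
      then obtain y z where a: "a = (y, z)" "y permutes {1..n}" "z permutes {1..n}" "y \<circ> z = x" by auto
      have "inv' y \<circ> x = z" using a(4) by (auto simp: permutes_inverses[OF a(2)])
      then show "(fst a, inv' (fst a) \<circ> x) = a" "fst a \<in> perms n"
        "f (fst a) * g (inv' (fst a) \<circ> x) = (case a of (y, z) \<Rightarrow> f y * g z)" using a by auto
    next
      fix y assume "y \<in> perms n"
      then have y: "y permutes {1..n}" by simp
      have "y \<circ> (inv' y \<circ> x) = x" by (auto simp: permutes_inverses[OF y])
      then show "(y, inv' y \<circ> x) \<in> {(y, z). y \<in> perms n \<and> z \<in> perms n \<and> y \<circ> z = x}"
        using y permutes_compose[OF x permutes_inv[OF y]] by simp
    qed simp
    then show ?thesis using True by (simp only: expand if_True)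
  next
    case False
    have "{(y, z). y \<in> perms n \<and> z \<in> perms n \<and> y \<circ> z = x} = {}"
      using False permutes_compose by blast
    then show ?thesis using False by (simp only: expand sum.empty if_False)
  qed
qed

lemma conv_assoc: "conv n (conv n f g) h = conv n f (conv n g h)"
proof
  fix x show "conv n (conv n f g) h x = conv n f (conv n g h) x"
  proof (cases "x \<in> perms n")
    case True
    have "conv n (conv n f g) h x = (\<Sum>y\<in>perms n. \<Sum>z\<in>perms n. f z * g (inv' z \<circ> y) * h (inv' y \<circ> x))"
      using True by (simp add: conv_apply sum_distrib_right)
    also have "\<dots> = (\<Sum>z\<in>perms n. \<Sum>y\<in>perms n. f z * g (inv' z \<circ> y) * h (inv' y \<circ> x))"
      by (rule sum.swap)
    also have "\<dots> = (\<Sum>z\<in>perms n. \<Sum>w\<in>perms n. f z * (g w * h (inv' w \<circ> (inv' z \<circ> x))))"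
    proof (rule sum.cong[OF refl])
      fix z assume z: "z \<in> perms n"
      then have z': "z permutes {1..n}" by simp
      have "(\<Sum>y\<in>perms n. f z * g (inv' z \<circ> y) * h (inv' y \<circ> x))
          = (\<Sum>w\<in>perms n. f z * g (inv' z \<circ> (z \<circ> w)) * h (inv' (z \<circ> w) \<circ> x))"
        by (rule sum_perms_compose_left[OF z])
      also have "\<dots> = (\<Sum>w\<in>perms n. f z * (g w * h (inv' w \<circ> (inv' z \<circ> x))))"
      proof (rule sum.cong[OF refl])
        fix w assume "w \<in> perms n"
        then have w: "w permutes {1..n}" by simp
        have "inv' z \<circ> (z \<circ> w) = w" by (auto simp: permutes_inverses[OF z'])
        moreover have "inv' (z \<circ> w) = inv' w \<circ> inv' z"
          using z' w by (simp add: o_inv_distrib permutes_bij)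
        ultimately show "f z * g (inv' z \<circ> (z \<circ> w)) * h (inv' (z \<circ> w) \<circ> x)
            = f z * (g w * h (inv' w \<circ> (inv' z \<circ> x)))" by (simp add: comp_assoc mult.assoc)
      qed
      finally show "(\<Sum>y\<in>perms n. f z * g (inv' z \<circ> y) * h (inv' y \<circ> x))
          = (\<Sum>w\<in>perms n. f z * (g w * h (inv' w \<circ> (inv' z \<circ> x))))" .
    qed
    also have "\<dots> = (\<Sum>z\<in>perms n. f z * conv n g h (inv' z \<circ> x))"
    proof (rule sum.cong[OF refl])
      fix z assume "z \<in> perms n"
      then have "inv' z \<circ> x \<in> perms n" using True permutes_compose permutes_inv by blast
      then show "(\<Sum>w\<in>perms n. f z * (g w * h (inv' w \<circ> (inv' z \<circ> x)))) = f z * conv n g h (inv' z \<circ> x)"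
        by (simp add: conv_apply sum_distrib_left)
    qed
    finally show ?thesis using True by (simp add: conv_apply)
  qed (simp only: conv_apply if_False)
qed

lemma conv_add_left: "conv n (f + f') g = conv n f g + conv n f' g"
  by (rule ext) (simp add: conv_apply distrib_right sum.distrib)

lemma conv_scale_left: "conv n (fun_scale a f) g = fun_scale a (conv n f g)"
  by (rule ext) (simp add: conv_apply fun_scale_def sum_distrib_left mult.assoc)

lemma conv_scale_right: "conv n f (fun_scale a g) = fun_scale a (conv n f g)"
  by (rule ext) (simp add: conv_apply fun_scale_def sum_distrib_left mult.left_commute)

lemma conv_zero_right: "conv n f 0 = 0"
  by (rule ext) (simp add: conv_apply)

lemma conv_in_group_algebra: "conv n f g \<in> group_algebra (sym_group n)"
  by (simp add: group_algebra_def conv_apply sym_group_carrier)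

definition basis_vector :: "'g \<Rightarrow> 'g \<Rightarrow> complex" where
  "basis_vector p = (\<lambda>x. if x = p then 1 else 0)"

lemma conv_basis_vector:
  assumes "p \<in> perms n" "x \<in> perms n"
  shows "conv n (basis_vector p) g x = g (inv' p \<circ> x)"
proof -
  have "conv n (basis_vector p) g x = (\<Sum>y\<in>perms n. if y = p then g (inv' y \<circ> x) else 0)"
    using assms(2) unfolding conv_apply basis_vector_def by (simp add: if_distrib[of "\<lambda>u. u * _"] cong: if_cong)
  also have "\<dots> = g (inv' p \<circ> x)" unfolding sum.delta[OF finite_perms] using assms(1) by simp
  finally show ?thesis .
qed

definition fibre_stabilizer :: "nat \<Rightarrow> (nat \<Rightarrow> nat) \<Rightarrow> (nat \<Rightarrow> nat) set" where
  "fibre_stabilizer n f = {p \<in> perms n. \<forall>k\<in>{1..n}. f (p k) = f k}"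

lemma fibre_stabilizer_iff:
  "p \<in> fibre_stabilizer n f \<longleftrightarrow>
     p \<in> carrier (sym_group n) \<and> (\<forall>i. p ` {k \<in> {1..n}. f k = i} = {k \<in> {1..n}. f k = i})"
proof
  assume p: "p \<in> fibre_stabilizer n f"
  then have perm: "p permutes {1..n}" by (simp add: fibre_stabilizer_def)
  have "p ` {k \<in> {1..n}. f k = i} = {k \<in> {1..n}. f k = i}" for i
  proof (rule endo_inj_surj)
    show "p ` {k \<in> {1..n}. f k = i} \<subseteq> {k \<in> {1..n}. f k = i}"
    proof
      fix l assume "l \<in> p ` {k \<in> {1..n}. f k = i}"
      then obtain k where "k \<in> {1..n}" "f k = i" "l = p k" by blast
      then show "l \<in> {k \<in> {1..n}. f k = i}"
        using p permutes_in_image[OF perm, of k] unfolding fibre_stabilizer_def by simp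
    qed
    show "inj_on p {k \<in> {1..n}. f k = i}" using permutes_inj[OF perm] by (rule inj_on_subset) simp
  qed simp
  then show "p \<in> carrier (sym_group n) \<and> (\<forall>i. p ` {k \<in> {1..n}. f k = i} = {k \<in> {1..n}. f k = i})"
    using perm by (simp add: sym_group_carrier)
next
  assume p: "p \<in> carrier (sym_group n) \<and> (\<forall>i. p ` {k \<in> {1..n}. f k = i} = {k \<in> {1..n}. f k = i})"
  have "f (p k) = f k" if "k \<in> {1..n}" for k
  proof -
    have "p k \<in> p ` {l \<in> {1..n}. f l = f k}" using that by blast
    then have "p k \<in> {l \<in> {1..n}. f l = f k}" using p by (simp only:)
    then show ?thesis by simp
  qed
  then show "p \<in> fibre_stabilizer n f" using p by (simp add: fibre_stabilizer_def sym_group_carrier)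
qed

lemma fibre_stabilizer_image:
  "p \<in> fibre_stabilizer n f \<Longrightarrow> p ` {k \<in> {1..n}. f k = i} = {k \<in> {1..n}. f k = i}"
  by (simp add: fibre_stabilizer_iff)

lemma fibre_stabilizer_perms: "fibre_stabilizer n f \<subseteq> perms n"
  by (auto simp: fibre_stabilizer_def)

lemma finite_fibre_stabilizer: "finite (fibre_stabilizer n f)"
  using fibre_stabilizer_perms finite_perms by (rule finite_subset)

lemma id_fibre_stabilizer: "id \<in> fibre_stabilizer n f"
  by (simp add: fibre_stabilizer_def permutes_id)

lemma fibre_stabilizer_compose:
  assumes "p \<in> fibre_stabilizer n f" "q \<in> fibre_stabilizer n f"
  shows "p \<circ> q \<in> fibre_stabilizer n f"
proof -
  have q: "q permutes {1..n}" and p: "p permutes {1..n}" using assms by (auto simp: fibre_stabilizer_def)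
  have "f (p (q k)) = f k" if "k \<in> {1..n}" for k
  proof -
    have "q k \<in> {1..n}" using permutes_in_image[OF q] that by blast
    then show ?thesis using assms that unfolding fibre_stabilizer_def by simp
  qed
  then show ?thesis using permutes_compose[OF q p] by (simp add: fibre_stabilizer_def)
qed

lemma fibre_stabilizer_inv:
  assumes "p \<in> fibre_stabilizer n f"
  shows "inv' p \<in> fibre_stabilizer n f"
proof -
  have p: "p permutes {1..n}" using assms by (auto simp: fibre_stabilizer_def)
  have "f (inv' p k) = f k" if "k \<in> {1..n}" for k
  proof -
    have "inv' p k \<in> {1..n}" using permutes_in_image[OF permutes_inv[OF p]] that by blast
    then have "f (p (inv' p k)) = f (inv' p k)" using assms unfolding fibre_stabilizer_def by blast
    then show ?thesis by (simp add: permutes_inverses[OF p])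
  qed
  then show ?thesis using permutes_inv[OF p] by (simp add: fibre_stabilizer_def)
qed

lemma fibre_stabilizer_inv_compose_iff:
  assumes "p \<in> fibre_stabilizer n f" "x \<in> perms n"
  shows "inv' p \<circ> x \<in> fibre_stabilizer n f \<longleftrightarrow> x \<in> fibre_stabilizer n f"
proof
  have p: "p permutes {1..n}" using assms by (auto simp: fibre_stabilizer_def)
  assume "inv' p \<circ> x \<in> fibre_stabilizer n f"
  then have "p \<circ> (inv' p \<circ> x) \<in> fibre_stabilizer n f" by (rule fibre_stabilizer_compose[OF assms(1)])
  moreover have "p \<circ> (inv' p \<circ> x) = x" by (auto simp: permutes_inverses[OF p])
  ultimately show "x \<in> fibre_stabilizer n f" by simp
qed (rule fibre_stabilizer_compose[OF fibre_stabilizer_inv[OF assms(1)]])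

lemma fibre_stabilizer_mono:
  assumes "\<And>k l. k \<in> {1..n} \<Longrightarrow> l \<in> {1..n} \<Longrightarrow> f k = f l \<Longrightarrow> f' k = f' l"
  shows "fibre_stabilizer n f \<subseteq> fibre_stabilizer n f'"
proof
  fix p assume p: "p \<in> fibre_stabilizer n f"
  then have perm: "p permutes {1..n}" by (simp add: fibre_stabilizer_def)
  have "f' (p k) = f' k" if "k \<in> {1..n}" for k
    using assms[of "p k" k] permutes_in_image[OF perm, of k] p that unfolding fibre_stabilizer_def by blast
  then show "p \<in> fibre_stabilizer n f'" using perm by (simp add: fibre_stabilizer_def)
qed

definition symmetrizer :: "nat \<Rightarrow> (nat \<Rightarrow> nat) \<Rightarrow> (nat \<Rightarrow> nat) \<Rightarrow> complex" where
  "symmetrizer n f = (\<lambda>p. if p \<in> fibre_stabilizer n f then 1 else 0)"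

definition antisymmetrizer :: "nat \<Rightarrow> (nat \<Rightarrow> nat) \<Rightarrow> (nat \<Rightarrow> nat) \<Rightarrow> complex" where
  "antisymmetrizer n f = (\<lambda>p. if p \<in> fibre_stabilizer n f then of_int (sign p) else 0)"

lemma perms_sign_compose: "p \<in> perms n \<Longrightarrow> q \<in> perms n \<Longrightarrow> sign (p \<circ> q) = sign p * sign q"
  by (rule sign_compose) (auto intro: permutes_imp_permutation[of "{1..n}"])

lemma perms_sign_inverse: "p \<in> perms n \<Longrightarrow> sign (inv' p) = sign p"
  by (rule sign_inverse) (auto intro: permutes_imp_permutation[of "{1..n}"])

text \<open>If \<open>H\<close> is a subgroup of \<open>K\<close>, then \<open>h K = K\<close> for every \<open>h\<close> in \<open>H\<close>.\<close>

lemma conv_symmetrizer_coarser: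
  assumes "fibre_stabilizer n f \<subseteq> fibre_stabilizer n f'"
  shows "conv n (symmetrizer n f) (symmetrizer n f')
    = fun_scale (of_nat (card (fibre_stabilizer n f))) (symmetrizer n f')"
    (is "?lhs = ?rhs")
proof
  fix x show "?lhs x = ?rhs x"
  proof (cases "x \<in> perms n")
    case True
    have "?lhs x
        = (\<Sum>y\<in>perms n. if y \<in> fibre_stabilizer n f then symmetrizer n f' x else 0)"
      unfolding conv_apply if_P[OF True]
    proof (rule sum.cong[OF refl])
      fix y
      show "symmetrizer n f y * symmetrizer n f' (inv' y \<circ> x)
          = (if y \<in> fibre_stabilizer n f then symmetrizer n f' x else 0)"
        using fibre_stabilizer_inv_compose_iff[of y n f' x] assms True by (auto simp: symmetrizer_def)
    qed
    also have "\<dots> = (\<Sum>y\<in>fibre_stabilizer n f. symmetrizer n f' x)"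
      using fibre_stabilizer_perms by (intro sum.mono_neutral_cong_right finite_perms) auto
    finally show ?thesis by (simp add: fun_scale_def)
  next
    case False
    then have "x \<notin> fibre_stabilizer n f'" using fibre_stabilizer_perms by blast
    then show ?thesis unfolding conv_apply if_not_P[OF False] by (simp add: fun_scale_def symmetrizer_def)
  qed
qed

text \<open>The signed analogue; here the smaller group acts from the right.\<close>

lemma conv_antisymmetrizer_coarser:
  assumes "fibre_stabilizer n f \<subseteq> fibre_stabilizer n f'"
  shows "conv n (antisymmetrizer n f') (antisymmetrizer n f)
    = fun_scale (of_nat (card (fibre_stabilizer n f))) (antisymmetrizer n f')"
    (is "?lhs = ?rhs")
proof
  fix x show "?lhs x = ?rhs x"
  proof (cases "x \<in> perms n")
    case True
    then have x: "x permutes {1..n}" by simp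
    have "?lhs x
        = (\<Sum>y\<in>perms n. antisymmetrizer n f' (x \<circ> y) * antisymmetrizer n f (inv' (x \<circ> y) \<circ> x))"
      unfolding conv_apply if_P[OF True] by (rule sum_perms_compose_left[OF True])
    also have "\<dots> = (\<Sum>y\<in>perms n. antisymmetrizer n f' (x \<circ> inv' y) * antisymmetrizer n f (inv' (x \<circ> inv' y) \<circ> x))"
      by (rule sum_perms_inverse)
    also have "\<dots> = (\<Sum>y\<in>perms n. if y \<in> fibre_stabilizer n f then antisymmetrizer n f' x else 0)"
    proof (rule sum.cong[OF refl])
      fix y assume "y \<in> perms n"
      then have y: "y permutes {1..n}" by simp
      have iy: "inv' y \<in> perms n" using permutes_inv[OF y] by simp
      have "inv' (x \<circ> inv' y) = inv' (inv' y) \<circ> inv' x"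
        by (rule o_inv_distrib[OF permutes_bij[OF x] permutes_bij[OF permutes_inv[OF y]]])
      then have "inv' (x \<circ> inv' y) = y \<circ> inv' x" by (simp only: permutes_inv_inv[OF y])
      then have eq: "inv' (x \<circ> inv' y) \<circ> x = y" by (auto simp: permutes_inverses[OF x])
      have "antisymmetrizer n f' (x \<circ> inv' y) * antisymmetrizer n f y = antisymmetrizer n f' x"
        if yf: "y \<in> fibre_stabilizer n f"
      proof -
        have yf': "y \<in> fibre_stabilizer n f'" using yf assms by blast
        have "x \<circ> inv' y \<in> fibre_stabilizer n f' \<longleftrightarrow> x \<in> fibre_stabilizer n f'"
        proof
          assume "x \<circ> inv' y \<in> fibre_stabilizer n f'"
          then have "(x \<circ> inv' y) \<circ> y \<in> fibre_stabilizer n f'" using yf' by (rule fibre_stabilizer_compose)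
          moreover have "(x \<circ> inv' y) \<circ> y = x" by (auto simp: permutes_inverses[OF y])
          ultimately show "x \<in> fibre_stabilizer n f'" by simp
        qed (rule fibre_stabilizer_compose[OF _ fibre_stabilizer_inv[OF yf']])
        moreover have "sign (x \<circ> inv' y) * sign y = sign x"
          using perms_sign_compose[OF True iy] perms_sign_inverse[of y n] y by (simp add: mult.assoc)
        then have "(of_int (sign (x \<circ> inv' y)) * of_int (sign y) :: complex) = of_int (sign x)"
          by (metis of_int_mult)
        ultimately show ?thesis using yf by (simp add: antisymmetrizer_def)
      qed
      moreover have "antisymmetrizer n f y = 0" if "y \<notin> fibre_stabilizer n f"
        using that by (simp add: antisymmetrizer_def)
      ultimately show "antisymmetrizer n f' (x \<circ> inv' y) * antisymmetrizer n f (inv' (x \<circ> inv' y) \<circ> x)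
          = (if y \<in> fibre_stabilizer n f then antisymmetrizer n f' x else 0)"
        unfolding eq by simp
    qed
    also have "\<dots> = (\<Sum>y\<in>fibre_stabilizer n f. antisymmetrizer n f' x)"
      using fibre_stabilizer_perms by (intro sum.mono_neutral_cong_right finite_perms) auto
    finally show ?thesis by (simp add: fun_scale_def)
  next
    case False
    then have "x \<notin> fibre_stabilizer n f'" using fibre_stabilizer_perms by blast
    then show ?thesis unfolding conv_apply if_not_P[OF False] by (simp add: fun_scale_def antisymmetrizer_def)
  qed
qed

lemma transpose_fibre_stabilizer:
  assumes "i \<in> {1..n}" "j \<in> {1..n}" "f i = f j"
  shows "Transposition.transpose i j \<in> fibre_stabilizer n f"
  using assms permutes_swap_id[OF assms(1,2)] by (auto simp: fibre_stabilizer_def Transposition.transpose_def)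

text \<open>For the transposition \<open>t\<close> of \<open>i\<close> and \<open>j\<close> one has \<open>C t = - C\<close> and \<open>t R = R\<close>, hence \<open>C R = - C R\<close>.\<close>

lemma conv_antisymmetrizer_symmetrizer_eq_0:
  assumes "i \<in> {1..n}" "j \<in> {1..n}" "i \<noteq> j" "c i = c j" "r i = r j"
  shows "conv n (antisymmetrizer n c) (symmetrizer n r) = 0"
proof
  fix x
  let ?t = "Transposition.transpose i j"
  have tC: "?t \<in> fibre_stabilizer n c" and tR: "?t \<in> fibre_stabilizer n r"
    using assms by (auto intro: transpose_fibre_stabilizer)
  have t: "?t \<in> perms n" using tC fibre_stabilizer_perms by blast
  then have t': "?t permutes {1..n}" by simp
  have tt: "inv' ?t = ?t" by (rule inv_unique_comp) auto
  show "conv n (antisymmetrizer n c) (symmetrizer n r) x = 0 x"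
  proof (cases "x \<in> perms n")
    case True
    let ?S = "\<Sum>y\<in>perms n. antisymmetrizer n c y * symmetrizer n r (inv' y \<circ> x)"
    have "?S = (\<Sum>y\<in>perms n. antisymmetrizer n c (y \<circ> ?t) * symmetrizer n r (inv' (y \<circ> ?t) \<circ> x))"
      by (rule sum_perms_compose_right[OF t])
    also have "\<dots> = (\<Sum>y\<in>perms n. - (antisymmetrizer n c y * symmetrizer n r (inv' y \<circ> x)))"
    proof (rule sum.cong[OF refl])
      fix y assume y: "y \<in> perms n"
      then have y': "y permutes {1..n}" by simp
      have "y \<circ> ?t \<in> fibre_stabilizer n c \<longleftrightarrow> y \<in> fibre_stabilizer n c"
      proof
        assume "y \<circ> ?t \<in> fibre_stabilizer n c"
        then have "(y \<circ> ?t) \<circ> ?t \<in> fibre_stabilizer n c" using tC by (rule fibre_stabilizer_compose)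
        then show "y \<in> fibre_stabilizer n c" by (simp add: comp_assoc)
      qed (rule fibre_stabilizer_compose[OF _ tC])
      moreover have "sign (y \<circ> ?t) = - sign y"
        using perms_sign_compose[OF y t] assms(3) by (simp add: sign_swap_id)
      ultimately have C: "antisymmetrizer n c (y \<circ> ?t) = - antisymmetrizer n c y"
        by (simp add: antisymmetrizer_def)
      have "inv' (y \<circ> ?t) \<circ> x = inv' ?t \<circ> (inv' y \<circ> x)"
        using y' t' by (simp add: o_inv_distrib permutes_bij comp_assoc)
      moreover have "inv' y \<circ> x \<in> perms n" using True y' permutes_compose permutes_inv by blast
      ultimately have R: "symmetrizer n r (inv' (y \<circ> ?t) \<circ> x) = symmetrizer n r (inv' y \<circ> x)"
        using fibre_stabilizer_inv_compose_iff[OF tR] by (simp add: symmetrizer_def)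
      show "antisymmetrizer n c (y \<circ> ?t) * symmetrizer n r (inv' (y \<circ> ?t) \<circ> x)
          = - (antisymmetrizer n c y * symmetrizer n r (inv' y \<circ> x))"
        unfolding C R by simp
    qed
    also have "\<dots> = - ?S" by (rule sum_negf)
    finally have "?S = 0" by simp
    then show ?thesis unfolding conv_apply if_P[OF True] by simp
  next
    case False
    then show ?thesis unfolding conv_apply if_not_P[OF False] by simp
  qed
qed

section \<open>Dimension counts\<close>

lemma dim_le_if_subset_span:
  assumes "U \<subseteq> complex_fun.span W" "finite W" "S \<subseteq> U" "complex_fun.independent S"
  shows "card S \<le> complex_dim U"
proof -
  obtain B where B: "B \<subseteq> U" "complex_fun.independent B" "U \<subseteq> complex_fun.span B" "card B = complex_dim U"
    by (rule complex_fun.basis_exists[of U])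
  have "finite B" using complex_fun.independent_span_bound[OF assms(2) B(2)] B(1) assms(1) by blast
  then have "card S \<le> card B"
    using complex_fun.independent_span_bound[OF _ assms(4), of B] assms(3) B(3) by blast
  then show ?thesis by (simp only: B(4))
qed

text \<open>A basis of \<open>K\<close> together with preimages of a basis of the image is independent in \<open>U\<close>.\<close>

lemma dim_image_plus_kernel_le:
  fixes \<phi> :: "('g \<Rightarrow> complex) \<Rightarrow> 'g \<Rightarrow> complex"
  assumes add: "\<And>f g. \<phi> (f + g) = \<phi> f + \<phi> g" and scale: "\<And>a f. \<phi> (fun_scale a f) = fun_scale a (\<phi> f)"
    and U: "U \<subseteq> complex_fun.span W" "finite W" and K: "K \<subseteq> U" "\<And>f. f \<in> K \<Longrightarrow> \<phi> f = 0"
  shows "complex_dim (\<phi> ` U) + complex_dim K \<le> complex_dim U"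
proof -
  have zero: "\<phi> 0 = 0" using scale[of 0 0] by (simp add: fun_scale_def zero_fun_def)
  have lincomb: "\<phi> (\<Sum>v\<in>S. fun_scale (a v) v) = (\<Sum>v\<in>S. fun_scale (a v) (\<phi> v))" for S a
    by (induction S rule: infinite_finite_induct) (simp_all only: sum.infinite sum.empty sum.insert zero add scale simp_thms)
  obtain A where A: "A \<subseteq> K" "complex_fun.independent A" "K \<subseteq> complex_fun.span A" "card A = complex_dim K"
    by (rule complex_fun.basis_exists[of K])
  obtain I where I: "I \<subseteq> \<phi> ` U" "complex_fun.independent I" "\<phi> ` U \<subseteq> complex_fun.span I"
      "card I = complex_dim (\<phi> ` U)"
    by (rule complex_fun.basis_exists[of "\<phi> ` U"])
  have "\<forall>v\<in>I. \<exists>u\<in>U. \<phi> u = v" using I(1) by blast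
  then obtain g where g: "\<And>v. v \<in> I \<Longrightarrow> g v \<in> U" "\<And>v. v \<in> I \<Longrightarrow> \<phi> (g v) = v" by metis
  have ginj: "inj_on g I" by (rule inj_onI) (metis g(2))
  have finA: "finite A"
    using complex_fun.independent_span_bound[OF U(2) A(2)] A(1) K(1) U(1) by blast
  have disj: "A \<inter> g ` J = {}" if J: "J \<subseteq> I" for J
  proof (rule ccontr)
    assume "A \<inter> g ` J \<noteq> {}"
    then obtain w where "w \<in> J" "g w \<in> K" using A(1) by blast
    then have "0 \<in> I" using K(2) g(2) J by (metis subsetD)
    then show False using I(2) complex_fun.dependent_zero by blast
  qed
  have key: "a v = 0" if finJ: "finite J" and J: "J \<subseteq> I"
    and sum: "(\<Sum>v\<in>A \<union> g ` J. fun_scale (a v) v) = 0" and v: "v \<in> A \<union> g ` J" for a v J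
  proof -
    have split: "(\<Sum>v\<in>A. fun_scale (a v) v) + (\<Sum>v\<in>g ` J. fun_scale (a v) v) = 0"
      using sum finJ by (simp add: sum.union_disjoint[OF finA _ disj[OF J]])
    have "\<phi> (\<Sum>v\<in>A. fun_scale (a v) v) = 0"
    proof -
      have "(\<Sum>v\<in>A. fun_scale (a v) (\<phi> v)) = 0"
        by (rule sum.neutral) (use A(1) K(2) in \<open>auto simp: fun_scale_def zero_fun_def\<close>)
      then show ?thesis by (simp only: lincomb)
    qed
    moreover have "\<phi> (\<Sum>v\<in>g ` J. fun_scale (a v) v) = (\<Sum>v\<in>J. fun_scale (a (g v)) v)"
    proof -
      have "inj_on g J" using ginj J by (rule inj_on_subset)
      then have "(\<Sum>v\<in>g ` J. fun_scale (a v) (\<phi> v)) = (\<Sum>v\<in>J. fun_scale (a (g v)) (\<phi> (g v)))"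
        by (simp add: sum.reindex)
      also have "\<dots> = (\<Sum>v\<in>J. fun_scale (a (g v)) v)" by (rule sum.cong) (use g(2) J in auto)
      finally show ?thesis by (simp only: lincomb)
    qed
    ultimately have "(\<Sum>v\<in>J. fun_scale (a (g v)) v) = 0"
      using arg_cong[OF split, of \<phi>] by (simp only: add zero add_0_left)
    then have gJ: "a (g v) = 0" if "v \<in> J" for v
      using complex_fun.independentD[OF I(2) finJ J, of "\<lambda>v. a (g v)"] that by blast
    have "(\<Sum>v\<in>g ` J. fun_scale (a v) v) = 0"
      by (rule sum.neutral) (use gJ in \<open>auto simp: fun_scale_def zero_fun_def\<close>)
    then have "(\<Sum>v\<in>A. fun_scale (a v) v) = 0" using split by simp
    then have "a v = 0" if "v \<in> A" for v
      using complex_fun.independentD[OF A(2) finA subset_refl, of a] that by blast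
    with gJ v show ?thesis by blast
  qed
  have indep: "complex_fun.independent (A \<union> g ` J)" if "finite J" "J \<subseteq> I" for J
    by (rule complex_fun.independent_if_scalars_zero) (use finA that key in blast)+
  have sub: "A \<union> g ` J \<subseteq> U" if "J \<subseteq> I" for J using A(1) K(1) g(1) that by blast
  have card: "card (A \<union> g ` J) = card A + card J" if "finite J" "J \<subseteq> I" for J
  proof -
    have "card (A \<union> g ` J) = card A + card (g ` J)" using finA that(1) disj[OF that(2)] by (intro card_Un_disjoint) auto
    also have "card (g ` J) = card J" using inj_on_subset[OF ginj that(2)] by (rule card_image)
    finally show ?thesis .
  qed
  have bound: "card A + card J \<le> complex_dim U" if "finite J" "J \<subseteq> I" for J
    using dim_le_if_subset_span[OF U sub[OF that(2)] indep[OF that]] card[OF that] by simp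
  \<comment> \<open>An infinite \<open>I\<close> would have the default cardinality \<open>0\<close>.\<close>
  show ?thesis
  proof (cases "finite I")
    case True
    then show ?thesis using bound[OF True subset_refl] A(4) I(4) by simp
  next
    case False
    then show ?thesis using bound[of "{}"] A(4) I(4) by simp
  qed
qed

text \<open>In a linear relation take the indices \<open>Y\<close> with nonzero coefficients. Evaluating the relation at an
\<open>x\<close> in \<open>Y\<close> at which no other member of \<open>Y\<close> contributes gives a contradiction. No order on the
indices has to be constructed.\<close>

lemma card_le_dim_if_triangular:
  fixes F :: "'i \<Rightarrow> 'i \<Rightarrow> complex"
  assumes "finite X" "F ` X \<subseteq> U" "U \<subseteq> complex_fun.span W" "finite W"
    and diag: "\<And>x. x \<in> X \<Longrightarrow> F x x \<noteq> 0"
    and triangular: "\<And>Y. Y \<subseteq> X \<Longrightarrow> Y \<noteq> {} \<Longrightarrow> \<exists>x\<in>Y. \<forall>y\<in>Y. y \<noteq> x \<longrightarrow> F y x = 0"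
  shows "card X \<le> complex_dim U"
proof -
  have zero: "a x = 0" if sum: "\<And>z. (\<Sum>x\<in>X. a x * F x z) = 0" and "x \<in> X" for a :: "'i \<Rightarrow> complex" and x
  proof (rule ccontr)
    assume "a x \<noteq> 0"
    then have "{x \<in> X. a x \<noteq> 0} \<noteq> {}" "{x \<in> X. a x \<noteq> 0} \<subseteq> X" using that(2) by auto
    then obtain z where z: "z \<in> X" "a z \<noteq> 0" "\<And>y. y \<in> X \<Longrightarrow> a y \<noteq> 0 \<Longrightarrow> y \<noteq> z \<Longrightarrow> F y z = 0"
      using triangular[of "{x \<in> X. a x \<noteq> 0}"] by auto
    have "(\<Sum>x\<in>X. a x * F x z) = (\<Sum>x\<in>{z}. a x * F x z)"
      by (rule sum.mono_neutral_right) (use assms(1) z in auto)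
    then show False using sum[of z] z(1,2) diag by simp
  qed
  have inj: "inj_on F X"
  proof (rule inj_onI)
    fix x y assume xy: "x \<in> X" "y \<in> X" "F x = F y"
    show "x = y"
    proof (rule ccontr)
      assume "x \<noteq> y"
      define a :: "'i \<Rightarrow> complex" where "a = (\<lambda>z. if z = x then 1 else if z = y then -1 else 0)"
      have "(\<Sum>v\<in>X. a v * F v z) = (\<Sum>v\<in>{x, y}. a v * F v z)" for z
        by (rule sum.mono_neutral_right) (use assms(1) xy in \<open>auto simp: a_def\<close>)
      then have "(\<Sum>v\<in>X. a v * F v z) = 0" for z using \<open>x \<noteq> y\<close> xy(3) by (simp add: a_def)
      then have "a x = 0" using zero xy(1) by blast
      then show False by (simp add: a_def)
    qed
  qed
  have "complex_fun.independent (F ` X)"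
  proof (rule complex_fun.independent_if_scalars_zero)
    fix a v assume sum: "(\<Sum>f\<in>F ` X. fun_scale (a f) f) = 0" and "v \<in> F ` X"
    then obtain x where x: "x \<in> X" "v = F x" by blast
    have sum': "(\<Sum>x\<in>X. fun_scale (a (F x)) (F x)) = 0"
      using sum by (simp add: sum.reindex[OF inj])
    have "(\<Sum>x\<in>X. a (F x) * F x z) = 0" for z
    proof -
      have "(\<Sum>x\<in>Y. fun_scale (a (F x)) (F x)) z = (\<Sum>x\<in>Y. a (F x) * F x z)" for Y
        by (induction Y rule: infinite_finite_induct) (simp_all add: fun_scale_def)
      then show ?thesis using fun_cong[OF sum', of z] by simp
    qed
    then show "a v = 0" using zero[of "\<lambda>x. a (F x)" x] x by simp
  qed (use assms(1) in simp)
  from dim_le_if_subset_span[OF assms(3,4,2) this] show ?thesis by (simp add: card_image[OF inj])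
qed


section \<open>Specht ideals and splitting\<close>

abbreviation young_product :: "nat \<Rightarrow> (nat \<Rightarrow> nat) \<Rightarrow> (nat \<Rightarrow> nat) \<Rightarrow> (nat \<Rightarrow> nat) \<Rightarrow> complex" where
  "young_product n r c \<equiv> conv n (antisymmetrizer n c) (symmetrizer n r)"

definition specht_ideal :: "nat \<Rightarrow> (nat \<Rightarrow> nat) \<Rightarrow> (nat \<Rightarrow> nat) \<Rightarrow> ((nat \<Rightarrow> nat) \<Rightarrow> complex) set" where
  "specht_ideal n r c = (\<lambda>a. conv n a (young_product n r c)) ` group_algebra (sym_group n)"

lemma specht_module_eq_ideal:
  "specht_module D b = specht_ideal (card D) (fst \<circ> b) (snd \<circ> b)"
proof -
  have "row_stabilizer n b = fibre_stabilizer n (fst \<circ> b)"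
    "column_stabilizer n b = fibre_stabilizer n (snd \<circ> b)" for n
    unfolding row_stabilizer_def column_stabilizer_def by (auto simp only: fibre_stabilizer_iff o_apply mem_Collect_eq set_eq_iff)
  then show ?thesis
    unfolding specht_module_def specht_ideal_def Let_def row_symmetrizer_def column_antisymmetrizer_def
      symmetrizer_def antisymmetrizer_def by (simp add: Setcompr_eq_image)
qed

lemma group_algebra_span:
  "group_algebra (sym_group n) \<subseteq> complex_fun.span (basis_vector ` perms n)"
proof
  fix f assume f: "f \<in> group_algebra (sym_group n)"
  have "f = (\<Sum>p\<in>perms n. fun_scale (f p) (basis_vector p))"
  proof
    fix x
    have "(\<Sum>p\<in>S. fun_scale (f p) (basis_vector p)) x = (\<Sum>p\<in>S. if p = x then f p else 0)" for S
      by (induction S rule: infinite_finite_induct) (auto simp: fun_scale_def basis_vector_def)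
    also have "(\<Sum>p\<in>perms n. if p = x then f p else 0) = f x"
      unfolding sum.delta[OF finite_perms] using f by (auto simp: group_algebra_def sym_group_carrier)
    finally show "f x = (\<Sum>p\<in>perms n. fun_scale (f p) (basis_vector p)) x" by simp
  qed
  also have "\<dots> \<in> complex_fun.span (basis_vector ` perms n)"
    by (intro complex_fun.span_sum complex_fun.span_scale complex_fun.span_base) auto
  finally show "f \<in> complex_fun.span (basis_vector ` perms n)" .
qed

lemma specht_ideal_span: "specht_ideal n r c \<subseteq> complex_fun.span (basis_vector ` perms n)"
  using group_algebra_span conv_in_group_algebra unfolding specht_ideal_def by blast

lemma specht_ideal_dim_le: "complex_dim (specht_ideal n r c) \<le> fact n"
proof -
  have "complex_dim (specht_ideal n r c) \<le> card (basis_vector ` perms n)"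
    using specht_ideal_span finite_perms by (intro complex_fun.dim_le_card) auto
  also have "\<dots> \<le> card (perms n)" by (rule card_image_le[OF finite_perms])
  also have "\<dots> = fact n" by (rule card_permutations) auto
  finally show ?thesis .
qed

text \<open>Right multiplication by \<open>\<tau> = R' / |R|\<close> maps \<open>S(r, c)\<close> onto \<open>S(r', c)\<close>, since \<open>R \<tau> = R'\<close>. The element \<open>C'\<close> is
a left multiple of \<open>C\<close>, so \<open>S(r, c')\<close> is contained in \<open>S(r, c)\<close>; and it is killed, since \<open>C' R' = 0\<close>
because of the transposition of \<open>i\<close> and \<open>j\<close>.\<close>

lemma specht_ideal_exchange:
  assumes rr: "\<And>k l. k \<in> {1..n} \<Longrightarrow> l \<in> {1..n} \<Longrightarrow> r k = r l \<Longrightarrow> r' k = r' l"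
    and cc: "\<And>k l. k \<in> {1..n} \<Longrightarrow> l \<in> {1..n} \<Longrightarrow> c k = c l \<Longrightarrow> c' k = c' l"
    and ij: "i \<in> {1..n}" "j \<in> {1..n}" "i \<noteq> j" "r' i = r' j" "c' i = c' j"
  shows "complex_dim (specht_ideal n r' c) + complex_dim (specht_ideal n r c') \<le> complex_dim (specht_ideal n r c)"
proof -
  let ?GA = "group_algebra (sym_group n)"
  let ?R = "symmetrizer n r" and ?R' = "symmetrizer n r'"
  let ?C = "antisymmetrizer n c" and ?C' = "antisymmetrizer n c'"
  define kr where "kr = (of_nat (card (fibre_stabilizer n r)) :: complex)"
  define kc where "kc = (of_nat (card (fibre_stabilizer n c)) :: complex)"
  have nonzero: "(of_nat (card (fibre_stabilizer n f)) :: complex) \<noteq> 0" for f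
    using id_fibre_stabilizer[of n f] finite_fibre_stabilizer[of n f] by (auto simp: card_eq_0_iff)
  have kr: "kr \<noteq> 0" and kc: "kc \<noteq> 0" unfolding kr_def kc_def by (rule nonzero)+
  have scale_scale: "fun_scale a (fun_scale b f) = fun_scale (a * b) f" for a b and f :: "(nat \<Rightarrow> nat) \<Rightarrow> complex"
    by (simp add: fun_scale_def mult.assoc)
  have scale_1: "fun_scale 1 f = f" for f :: "(nat \<Rightarrow> nat) \<Rightarrow> complex" by (simp add: fun_scale_def)
  define \<tau> where "\<tau> = fun_scale (1 / kr) ?R'"
  have R\<tau>: "conv n ?R \<tau> = ?R'"
  proof -
    have "fibre_stabilizer n r \<subseteq> fibre_stabilizer n r'" by (rule fibre_stabilizer_mono) (rule rr)
    from conv_symmetrizer_coarser[OF this] show ?thesis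
      unfolding \<tau>_def conv_scale_right kr_def[symmetric] using kr by (simp add: scale_scale scale_1)
  qed
  have CC': "conv n (fun_scale (1 / kc) ?C') ?C = ?C'"
  proof -
    have "fibre_stabilizer n c \<subseteq> fibre_stabilizer n c'" by (rule fibre_stabilizer_mono) (rule cc)
    from conv_antisymmetrizer_coarser[OF this] show ?thesis
      unfolding conv_scale_left kc_def[symmetric] using kc by (simp add: scale_scale scale_1)
  qed
  define \<phi> where "\<phi> f = conv n f \<tau>" for f
  have image: "\<phi> ` specht_ideal n r c = specht_ideal n r' c"
  proof -
    have "\<phi> (conv n a (conv n ?C ?R)) = conv n a (conv n ?C ?R')" for a
      unfolding \<phi>_def by (simp only: conv_assoc R\<tau>)
    then show ?thesis by (simp only: specht_ideal_def image_image)
  qed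
  have sub: "specht_ideal n r c' \<subseteq> specht_ideal n r c"
  proof
    fix f assume "f \<in> specht_ideal n r c'"
    then obtain a where "f = conv n a (conv n ?C' ?R)" unfolding specht_ideal_def by blast
    also have "\<dots> = conv n a (conv n (conv n (fun_scale (1 / kc) ?C') ?C) ?R)" by (simp only: CC')
    also have "\<dots> = conv n (conv n a (fun_scale (1 / kc) ?C')) (conv n ?C ?R)" by (simp only: conv_assoc)
    finally show "f \<in> specht_ideal n r c" unfolding specht_ideal_def using conv_in_group_algebra by blast
  qed
  have kernel: "\<phi> f = 0" if f: "f \<in> specht_ideal n r c'" for f
  proof -
    obtain a where "f = conv n a (conv n ?C' ?R)" using f unfolding specht_ideal_def by blast
    then have "\<phi> f = conv n a (conv n ?C' ?R')" unfolding \<phi>_def by (simp only: conv_assoc R\<tau>)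
    also have "conv n ?C' ?R' = 0" by (rule conv_antisymmetrizer_symmetrizer_eq_0[OF ij(1-3,5,4)])
    finally show ?thesis by (simp only: conv_zero_right)
  qed
  have "complex_dim (\<phi> ` specht_ideal n r c) + complex_dim (specht_ideal n r c') \<le> complex_dim (specht_ideal n r c)"
    by (rule dim_image_plus_kernel_le[OF _ _ specht_ideal_span finite_imageI[OF finite_perms] sub kernel])
      (simp_all only: \<phi>_def conv_add_left conv_scale_left)
  then show ?thesis by (simp only: image)
qed


section \<open>Independence of standard labellings\<close>

lemma young_product_nonzero:
  assumes "young_product n r c z \<noteq> 0"
  obtains y where "y \<in> fibre_stabilizer n c" "inv' y \<circ> z \<in> fibre_stabilizer n r"
proof -
  have z: "z \<in> perms n"
  proof (rule ccontr)
    assume "z \<notin> perms n"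
    then show False using assms by (simp only: conv_apply if_False)
  qed
  have "\<exists>y\<in>perms n. antisymmetrizer n c y * symmetrizer n r (inv' y \<circ> z) \<noteq> 0"
  proof (rule ccontr)
    assume "\<not> ?thesis"
    then have "(\<Sum>y\<in>perms n. antisymmetrizer n c y * symmetrizer n r (inv' y \<circ> z)) = 0"
      by (intro sum.neutral) blast
    then show False using assms unfolding conv_apply if_P[OF z] by contradiction
  qed
  then show ?thesis using that by (auto simp: antisymmetrizer_def symmetrizer_def split: if_splits)
qed

text \<open>No two boxes coincide, so only the identity preserves all rows and all columns.\<close>

lemma young_product_id:
  assumes "inj_on (\<lambda>k. (r k, c k)) {1..n}"
  shows "young_product n r c id = 1"
proof -
  have id: "id \<in> perms n" by (simp add: permutes_id)
  have "young_product n r c id = (\<Sum>y\<in>perms n. if y = id then 1 else 0)"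
    unfolding conv_apply if_P[OF id]
  proof (rule sum.cong[OF refl])
    fix y assume "y \<in> perms n"
    then have y: "y permutes {1..n}" by simp
    have "y = id" if C: "y \<in> fibre_stabilizer n c" and R: "inv' y \<in> fibre_stabilizer n r"
    proof
      fix k show "y k = id k"
      proof (cases "k \<in> {1..n}")
        case True
        have "inv' (inv' y) \<in> fibre_stabilizer n r" using R by (rule fibre_stabilizer_inv)
        then have "y \<in> fibre_stabilizer n r" by (simp only: permutes_inv_inv[OF y])
        then have "(r (y k), c (y k)) = (r k, c k)" using C True unfolding fibre_stabilizer_def by simp
        then show ?thesis using inj_onD[OF assms, of "y k" k] True permutes_in_image[OF y, of k] by simp
      qed (simp add: permutes_not_in[OF y])
    qed
    then show "antisymmetrizer n c y * symmetrizer n r (inv' y \<circ> id) = (if y = id then 1 else 0)"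
      using id_fibre_stabilizer[of n c] id_fibre_stabilizer[of n r]
      by (auto simp: antisymmetrizer_def symmetrizer_def)
  qed
  also have "\<dots> = 1" unfolding sum.delta[OF finite_perms] using id by simp
  finally show ?thesis .
qed

text \<open>A nonzero coefficient means \<open>\<sigma>\<^sup>-\<^sup>1 x = y \<rho>\<close>, where \<open>y\<close> preserves columns and \<open>\<rho>\<close> preserves rows. The
labelling \<open>\<sigma> y = x \<rho>\<^sup>-\<^sup>1\<close> is the required witness.\<close>

lemma exchangeable_if_young_product_nonzero:
  assumes "young_product n r c (inv' \<sigma> \<circ> x) \<noteq> 0"
    and "\<sigma> \<in> perms n" "x \<in> perms n"
  shows "exchangeable r c {1..n} x \<sigma>"
proof -
  obtain y where C: "y \<in> fibre_stabilizer n c" and R: "inv' y \<circ> (inv' \<sigma> \<circ> x) \<in> fibre_stabilizer n r"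
    using assms(1) by (rule young_product_nonzero)
  have \<sigma>: "\<sigma> permutes {1..n}" and x: "x permutes {1..n}" and y: "y permutes {1..n}"
    using assms(2,3) C by (auto simp: fibre_stabilizer_def)
  let ?\<rho> = "inv' y \<circ> (inv' \<sigma> \<circ> x)"
  have eq: "(\<sigma> \<circ> y) \<circ> ?\<rho> = x" by (auto simp: permutes_inverses[OF y] permutes_inverses[OF \<sigma>])
  show ?thesis unfolding exchangeable_def
  proof (intro exI[of _ "\<sigma> \<circ> y"] conjI allI)
    show "inj_on (\<sigma> \<circ> y) {1..n}" using permutes_inj[OF permutes_compose[OF y \<sigma>]] by (rule inj_on_subset) simp
    show "(\<sigma> \<circ> y) ` {e \<in> {1..n}. c e = j} = \<sigma> ` {e \<in> {1..n}. c e = j}" for j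
      using fibre_stabilizer_image[OF C] by (simp only: image_comp[symmetric])
    have "(\<sigma> \<circ> y) ` ?\<rho> ` {e \<in> {1..n}. r e = i} = x ` {e \<in> {1..n}. r e = i}" for i
      by (simp only: image_comp eq)
    then show "(\<sigma> \<circ> y) ` {e \<in> {1..n}. r e = i} = x ` {e \<in> {1..n}. r e = i}" for i
      by (simp only: fibre_stabilizer_image[OF R])
  qed
qed

lemma exchangeable_subset:
  assumes "exchangeable r c E T T'" "A \<subseteq> E"
    and closed: "\<And>e e'. e \<in> A \<Longrightarrow> e' \<in> E \<Longrightarrow> r e' = r e \<or> c e' = c e \<Longrightarrow> e' \<in> A"
  shows "exchangeable r c A T T'"
proof -
  obtain S where S: "inj_on S E" "\<And>i. S ` {e\<in>E. r e = i} = T ` {e\<in>E. r e = i}"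
    "\<And>j. S ` {e\<in>E. c e = j} = T' ` {e\<in>E. c e = j}"
    using assms(1) unfolding exchangeable_def by blast
  show ?thesis unfolding exchangeable_def
  proof (intro exI[of _ S] conjI allI)
    show "inj_on S A" using S(1) assms(2) by (rule inj_on_subset)
    show "S ` {e\<in>A. r e = i} = T ` {e\<in>A. r e = i}" for i
      by (rule image_eq_on_union_of_fibres[OF S(2)]) (use assms(2) closed in auto)
    show "S ` {e\<in>A. c e = i} = T' ` {e\<in>A. c e = i}" for i
      by (rule image_eq_on_union_of_fibres[OF S(3)]) (use assms(2) closed in auto)
  qed
qed

text \<open>If every member of a nonempty set of standard permutations had a nonzero coefficient in the vector of
another member, then following these members one would run into a nonconstant cycle of exchanges.\<close>

lemma standard_perms_le_dim:
  assumes ts: "forest_drawing r c ts" "\<Union>(edges ` set ts) = {1..n}"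
    and inj: "inj_on (\<lambda>k. (r k, c k)) {1..n}"
  shows "card {\<sigma>. \<sigma> permutes {1..n} \<and> (\<forall>t\<in>set ts. standard 0 \<sigma> t)} \<le> complex_dim (specht_ideal n r c)"
    (is "card ?X \<le> _")
proof -
  let ?CR = "young_product n r c"
  define F where "F \<sigma> = conv n (basis_vector \<sigma>) ?CR" for \<sigma>
  have X: "?X \<subseteq> perms n" by blast
  have F: "F \<sigma> x = ?CR (inv' \<sigma> \<circ> x)" if "\<sigma> \<in> perms n" "x \<in> perms n" for \<sigma> x
    unfolding F_def using that by (rule conv_basis_vector)
  show ?thesis
  proof (rule card_le_dim_if_triangular[of ?X F])
    show "finite ?X" using X finite_perms by (rule finite_subset)
    have "basis_vector \<sigma> \<in> group_algebra (sym_group n)" if "\<sigma> \<in> perms n" for \<sigma>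
      using that by (auto simp: basis_vector_def group_algebra_def sym_group_carrier)
    then show "F ` ?X \<subseteq> specht_ideal n r c" unfolding F_def specht_ideal_def by blast
    show "specht_ideal n r c \<subseteq> complex_fun.span (basis_vector ` perms n)" by (rule specht_ideal_span)
    show "finite (basis_vector ` perms n)" by (rule finite_imageI[OF finite_perms])
    show "F \<sigma> \<sigma> \<noteq> 0" if "\<sigma> \<in> ?X" for \<sigma>
    proof -
      have \<sigma>: "\<sigma> permutes {1..n}" using that by simp
      then have "F \<sigma> \<sigma> = ?CR id" using F[of \<sigma> \<sigma>] permutes_inv_o(2)[OF \<sigma>] by simp
      then show ?thesis using young_product_id[OF inj] by simp
    qed
    fix Y assume Y: "Y \<subseteq> ?X" "Y \<noteq> {}"
    show "\<exists>x\<in>Y. \<forall>y\<in>Y. y \<noteq> x \<longrightarrow> F y x = 0"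
    proof (rule ccontr)
      assume "\<not> ?thesis"
      then have "\<forall>x\<in>Y. \<exists>y\<in>Y. y \<noteq> x \<and> F y x \<noteq> 0" by blast
      then obtain nxt where nx: "\<And>x. x \<in> Y \<Longrightarrow> nxt x \<in> Y" "\<And>x. x \<in> Y \<Longrightarrow> nxt x \<noteq> x"
        "\<And>x. x \<in> Y \<Longrightarrow> F (nxt x) x \<noteq> 0" by metis
      obtain x0 where x0: "x0 \<in> Y" using Y(2) by blast
      define U where "U k = (nxt ^^ k) x0" for k
      have UY: "U k \<in> Y" for k by (induction k) (simp_all add: U_def x0 nx(1))
      have "finite Y" using Y(1) X finite_perms by (meson finite_subset subset_trans)
      then have "\<not> inj U" using UY finite_subset[of "range U" Y] finite_imageD[of U UNIV] by auto
      then obtain i j where ij: "i < j" "U i = U j" unfolding inj_def by (metis linorder_neqE_nat)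
      define T where "T k = U (i + k)" for k
      have U_shift: "U (k + j) = U (k + i)" for k
        using ij(2) by (simp add: U_def funpow_add)
      \<comment> \<open>Doubling the period makes it exceed one, so that \<open>N - 1\<close> steps reverse the chain.\<close>
      define N where "N = 2 * (j - i)"
      have per1: "T (k + (j - i)) = T k" for k
        using U_shift[of k] ij(1) by (simp add: T_def add.commute)
      have per: "T (k + N) = T k" for k
        using per1[of k] per1[of "k + (j - i)"] by (simp add: N_def mult_2 add.assoc)
      have N: "1 < N" using ij(1) by (simp add: N_def)
      have TX: "T k \<in> ?X" for k using UY Y(1) by (auto simp: T_def)
      have ex: "exchangeable r c {1..n} (T k) (T (Suc k))" for k
      proof (rule exchangeable_if_young_product_nonzero)
        have "T (Suc k) = nxt (T k)" by (simp add: T_def U_def)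
        then have "F (T (Suc k)) (T k) \<noteq> 0" using nx(3)[of "T k"] UY by (simp add: T_def)
        then show "?CR (inv' (T (Suc k)) \<circ> T k) \<noteq> 0" using F TX by auto
      qed (use TX in auto)
      have const: "T k e = T 0 e" if t: "t \<in> set ts" and e: "e \<in> edges t" for t e k
      proof -
        have sub: "edges t \<subseteq> {1..n}" using t ts(2) by blast
        have ex_t: "exchangeable r c (edges t) (T k) (T (Suc k))" for k
        proof (rule exchangeable_subset[OF ex sub])
          fix e e' assume "e \<in> edges t" "e' \<in> {1..n}" "r e' = r e \<or> c e' = c e"
          then show "e' \<in> edges t" using forest_drawing_closed[OF ts(1) t] ts(2) by blast
        qed
        have perm: "T k permutes {1..n}" and std: "standard 0 (T k) t" for k using TX t by blast+
        have inj_t: "inj_on (T k) (edges t)" for k using permutes_inj[OF perm] by (rule inj_on_subset) simp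
        have nz: "T k e \<noteq> 0" if "e \<in> edges t" for k e
          using permutes_in_image[OF perm, of k e] sub that by auto
        from forest_drawing_drawing[OF ts(1) t] show ?thesis
        proof
          assume d: "drawing r c t"
          show ?thesis
            by (rule periodic_standard_constant[where T = T and p = 0, OF d N _ inj_t nz std ex_t e]) (simp add: per)
        next
          assume d: "drawing c r t"
          define V where "V k = T ((N - 1) * k)" for k
          have per_t: "T (j + N) e = T j e" if "e \<in> edges t" for j e by (simp only: per)
          note reverse = periodic_exchange_reverse[where E = "edges t" and T = T, OF N per_t ex_t]
          have V: "V k e = V 0 e" for k
          proof (rule periodic_standard_constant[where T = V and p = 0, OF d N])
            show "V (j + N) e = V j e" if "e \<in> edges t" for j e
              unfolding V_def using reverse(1) that by blast
            show "exchangeable c r (edges t) (V j) (V (Suc j))" for j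
              unfolding V_def using reverse(2) by blast
            show "inj_on (V j) (edges t)" for j unfolding V_def by (rule inj_t)
            show "V j e \<noteq> 0" if "e \<in> edges t" for j e unfolding V_def using that by (rule nz)
            show "standard 0 (V j) t" for j unfolding V_def by (rule std)
          qed (rule e)
          have "T k e = V ((N - 1) * k) e" for k
            unfolding V_def using reverse(3) e by blast
          then show ?thesis using V by metis
        qed
      qed
      have "T 1 e = T 0 e" for e
      proof (cases "e \<in> {1..n}")
        case True
        then show ?thesis using const ts(2) by blast
      next
        case False
        have "T k permutes {1..n}" for k using TX by blast
        from permutes_not_in[OF this False] show ?thesis by simp
      qed
      then have "T 1 = T 0" by blast
      moreover have "T 1 = nxt (T 0)" by (simp add: T_def U_def)
      moreover have "T 0 \<in> Y" using UY by (simp add: T_def)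
      ultimately show False using nx(2) by metis
    qed
  qed
qed

section \<open>Dimension equals volume\<close>

lemma volume_le_dim:
  assumes "forest {1..n} r c"
  shows "fact n * matching_volume {1..n} r c \<le> complex_dim (specht_ideal n r c)"
proof -
  obtain ts where ts: "forest_drawing r c ts" "\<Union>(edges ` set ts) = {1..n}"
    using forest_drawing_exists[OF assms] by blast
  show ?thesis
    unfolding matching_volume_count[OF ts] of_nat_le_iff by (rule standard_perms_le_dim[OF ts forest_inj[OF assms]])
qed

text \<open>The induction is on the number of vertices, which increases at each splitting and is at most \<open>2 n\<close>. If two
edges meet, then the forest of those edges that meet another one has a leaf \<open>e2\<close>, and some \<open>e1\<close> meets it at
its other end. The two cases differ by whether this common vertex is a row or a column. In the first
case the ideal of the given forest is the image of the ideal of the split forest, in the second case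
it is contained in it.\<close>

lemma dim_le_volume:
  assumes "forest {1..n} r c"
  shows "complex_dim (specht_ideal n r c) \<le> fact n * matching_volume {1..n} r c"
  using assms
proof (induction "2 * n - (card (r ` {1..n}) + card (c ` {1..n}))" arbitrary: r c rule: less_induct)
  case less
  let ?E = "{1..n}"
  let ?dim = "\<lambda>r c. real (complex_dim (specht_ideal n r c))"
  let ?vol = "\<lambda>r c. fact n * matching_volume ?E r c"
  have fin: "finite ?E" by simp
  have card_le: "card (f ` ?E) \<le> n" for f :: "nat \<Rightarrow> nat" using card_image_le[OF fin, of f] by simp
  \<comment> \<open>The old row of \<open>e1\<close> is still occupied by \<open>e2\<close>.\<close>
  have more: "card ((f(e1 := x)) ` ?E) = Suc (card (f ` ?E))"
    if "x \<notin> f ` ?E" "e1 \<in> ?E" "e2 \<in> ?E" "e1 \<noteq> e2" "f e1 = f e2" for f :: "nat \<Rightarrow> nat" and x e1 e2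
  proof -
    have "(f(e1 := x)) ` ?E = insert x (f ` (?E - {e1}))" using that(2) by auto
    also have "f ` (?E - {e1}) = f ` ?E"
      using that(3,4,5) by (metis (no_types, lifting) imageI image_insert insertE insertI1 insert_Diff insert_absorb insert_iff that(2))
    finally show ?thesis using that(1) fin by simp
  qed
  let ?F = "{e \<in> ?E. \<exists>e'\<in>?E. e' \<noteq> e \<and> (r e' = r e \<or> c e' = c e)}"
  have alone: "e = e2 \<or> e \<in> ?F" if "e2 \<in> ?F" "e \<in> ?E" "r e = r e2 \<or> c e = c e2" for e e2
    using that by auto
  show ?case
  proof (cases "?F = {}")
    case True
    then have "inj_on r ?E" "inj_on c ?E" unfolding inj_on_def by blast+
    then have "matching_volume ?E r c = 1" by (rule matching_volume_matching[OF fin])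
    moreover have "?dim r c \<le> real (fact n)" using specht_ideal_dim_le by (simp only: of_nat_le_iff)
    ultimately show ?thesis by simp
  next
    case False
    have "?F \<subseteq> ?E" by blast
    from less.prems this False show ?thesis
    proof (rule forest_leaf)
      fix e2 assume e2: "e2 \<in> ?F" "\<And>e'. e' \<in> ?F \<Longrightarrow> c e' = c e2 \<Longrightarrow> e' = e2"
      have leaf: "e = e2" if "e \<in> ?E" "c e = c e2" for e
        using alone[OF e2(1) that(1)] e2(2) that by blast
      have e2E: "e2 \<in> ?E" using e2(1) by blast
      obtain e1 where e1: "e1 \<in> ?E" "e1 \<noteq> e2" "r e1 = r e2" using e2(1) leaf by blast
      obtain x where x: "x \<notin> r ` ?E" using ex_new_if_finite[of "r ` ?E"] by auto
      let ?r = "r(e1 := x)" and ?c = "c(e2 := c e1)"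
      have "?dim r c + ?dim ?r ?c \<le> ?dim ?r c"
      proof -
        have "complex_dim (specht_ideal n r c) + complex_dim (specht_ideal n ?r ?c) \<le> complex_dim (specht_ideal n ?r c)"
        proof (rule specht_ideal_exchange[OF _ _ e1(1) e2E e1(2,3)])
          show "r k = r l" if "k \<in> ?E" "l \<in> ?E" "?r k = ?r l" for k l
            using that x by (auto split: if_splits)
          show "?c k = ?c l" if "k \<in> ?E" "l \<in> ?E" "c k = c l" for k l
            using leaf[OF that(1)] leaf[OF that(2)] that(3) by auto
        qed (use e1 in simp)
        then show ?thesis by linarith
      qed
      moreover have "?dim ?r c \<le> ?vol ?r c"
      proof (rule less.hyps)
        show "forest ?E ?r c" using less.prems x by (rule forest_split)
        show "2 * n - (card (?r ` ?E) + card (c ` ?E)) < 2 * n - (card (r ` ?E) + card (c ` ?E))"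
          using more[OF x e1(1) e2E e1(2,3)] card_le[of ?r] card_le[of c] by linarith
      qed
      moreover have "?vol ?r ?c \<le> ?dim ?r ?c"
        by (rule volume_le_dim) (rule forest_slide[OF less.prems x e1(1) e2E e1(2,3)])
      moreover have "?vol r c + ?vol ?r ?c = ?vol ?r c"
        using matching_volume_recurrence[OF fin e1(1) e2E e1(2,3) leaf x] by (metis distrib_left)
      ultimately show ?thesis by linarith
    next
      fix e2 assume e2: "e2 \<in> ?F" "\<And>e'. e' \<in> ?F \<Longrightarrow> r e' = r e2 \<Longrightarrow> e' = e2"
      have leaf: "e = e2" if "e \<in> ?E" "r e = r e2" for e
        using alone[OF e2(1) that(1)] e2(2) that by blast
      have e2E: "e2 \<in> ?E" using e2(1) by blast
      obtain e1 where e1: "e1 \<in> ?E" "e1 \<noteq> e2" "c e1 = c e2" using e2(1) leaf by blast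
      obtain x where x: "x \<notin> c ` ?E" using ex_new_if_finite[of "c ` ?E"] by auto
      let ?c = "c(e1 := x)" and ?r = "r(e2 := r e1)"
      have "?dim ?r ?c + ?dim r c \<le> ?dim r ?c"
      proof -
        have "complex_dim (specht_ideal n ?r ?c) + complex_dim (specht_ideal n r c) \<le> complex_dim (specht_ideal n r ?c)"
        proof (rule specht_ideal_exchange[OF _ _ e1(1) e2E e1(2) _ e1(3)])
          show "c k = c l" if "k \<in> ?E" "l \<in> ?E" "?c k = ?c l" for k l
            using that x by (auto split: if_splits)
          show "?r k = ?r l" if "k \<in> ?E" "l \<in> ?E" "r k = r l" for k l
            using leaf[OF that(1)] leaf[OF that(2)] that(3) by auto
        qed (use e1 in simp)
        then show ?thesis by linarith
      qed
      moreover have swapped: "forest ?E c r" using less.prems by (simp only: forest_swap)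
      moreover have "?dim r ?c \<le> ?vol r ?c"
      proof (rule less.hyps)
        show "forest ?E r ?c" using forest_split[OF swapped x] by (simp only: forest_swap)
        show "2 * n - (card (r ` ?E) + card (?c ` ?E)) < 2 * n - (card (r ` ?E) + card (c ` ?E))"
          using more[OF x e1(1) e2E e1(2,3)] card_le[of ?c] card_le[of r] by linarith
      qed
      moreover have "?vol ?r ?c \<le> ?dim ?r ?c"
        by (rule volume_le_dim) (use forest_slide[OF swapped x e1(1) e2E e1(2,3)] forest_swap in blast)
      moreover have "?vol r c + ?vol ?r ?c = ?vol r ?c"
        using matching_volume_recurrence[OF fin e1(1) e2E e1(2,3) leaf x] matching_volume_swap by (metis distrib_left)
      ultimately show ?thesis by linarith
    qed
  qed
qed

lemma dim_eq_volume:
  "forest {1..n} r c \<Longrightarrow> real (complex_dim (specht_ideal n r c)) = fact n * matching_volume {1..n} r c"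
  using volume_le_dim dim_le_volume by (intro antisym)


section \<open>From graphs to rows and columns\<close>

text \<open>If every vertex can be left by a different edge than it was entered, then a walk that never turns
back goes on forever. Its first repetition closes a cycle, which has length at least three because
consecutive vertices, and vertices two steps apart, are different.\<close>

lemma cycle_exists:
  assumes fin: "finite F" and ne: "F \<noteq> {}" and card: "\<And>e. e \<in> F \<Longrightarrow> card e = 2"
    and continue: "\<And>e v. e \<in> F \<Longrightarrow> v \<in> e \<Longrightarrow> \<exists>e'\<in>F. e' \<noteq> e \<and> v \<in> e'"
  shows "\<exists>vs. is_cycle F vs"
proof -
  have other: "\<exists>b'. {b, b'} \<in> F \<and> b' \<noteq> b \<and> b' \<noteq> a" if ab: "{a, b} \<in> F" for a b
  proof -
    obtain e' where e': "e' \<in> F" "e' \<noteq> {a, b}" "b \<in> e'" using continue[OF ab, of b] by auto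
    obtain u v where "e' = {u, v}" "u \<noteq> v" using card[OF e'(1)] by (auto simp: card_2_iff)
    then show ?thesis using e' by (metis doubleton_eq_iff insertE singletonD)
  qed
  then obtain g where g: "\<And>a b. {a, b} \<in> F \<Longrightarrow> {b, g a b} \<in> F \<and> g a b \<noteq> b \<and> g a b \<noteq> a" by metis
  obtain a0 b0 where start: "{a0, b0} \<in> F" "a0 \<noteq> b0"
  proof -
    obtain e where "e \<in> F" using ne by blast
    then show ?thesis using that card[of e] by (metis card_2_iff)
  qed
  \<comment> \<open>A state is the pair of the last two vertices visited.\<close>
  define walk where "walk k = ((\<lambda>(a, b). (b, g a b)) ^^ k) (a0, b0)" for k
  define x where "x k = fst (walk k)" for k
  have walk_Suc: "walk (Suc k) = (snd (walk k), g (fst (walk k)) (snd (walk k)))" for k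
    by (simp add: walk_def case_prod_beta)
  have snd_walk: "snd (walk k) = x (Suc k)" for k by (simp add: x_def walk_Suc)
  have x_step: "x (Suc (Suc k)) = g (x k) (x (Suc k))" for k
    using walk_Suc[of "Suc k"] walk_Suc[of k] by (simp add: x_def)
  have edge: "{x k, x (Suc k)} \<in> F \<and> x k \<noteq> x (Suc k)" for k
  proof (induction k)
    case 0
    show ?case using start by (simp add: x_def walk_def)
  next
    case (Suc k)
    then show ?case using g[of "x k" "x (Suc k)"] by (auto simp: x_step)
  qed
  have skip: "x (Suc (Suc k)) \<noteq> x k" for k using g[of "x k" "x (Suc k)"] edge[of k] by (simp add: x_step)
  have "finite (\<Union>F)" using fin card by (intro finite_Union) (auto intro: card_ge_0_finite)
  moreover have "range x \<subseteq> \<Union>F" using edge by blast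
  ultimately have "\<not> inj x" using finite_subset[of "range x"] finite_imageD[of x UNIV] by auto
  then have "\<exists>j. \<exists>i<j. x i = x j" unfolding inj_def by (metis linorder_neqE_nat)
  define j where "j = (LEAST j. \<exists>i<j. x i = x j)"
  obtain i where i: "i < j" "x i = x j"
    using LeastI_ex[OF \<open>\<exists>j. \<exists>i<j. x i = x j\<close>] unfolding j_def by blast
  have minimal: "x k \<noteq> x l" if "k < l" "l < j" for k l
    using not_less_Least[of l "\<lambda>j. \<exists>i<j. x i = x j"] that unfolding j_def by blast
  have len: "3 \<le> j - i"
  proof (rule ccontr)
    assume "\<not> 3 \<le> j - i"
    then have "j = Suc i \<or> j = Suc (Suc i)" using i(1) by linarith
    then show False using i(2) edge[of i] skip[of i] by auto
  qed
  have "is_cycle F (map x [i..<j])"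
    unfolding is_cycle_def
  proof (intro conjI allI impI)
    show "3 \<le> length (map x [i..<j])" using len by simp
    have "inj_on x {i..<j}"
      by (rule inj_onI) (metis atLeastLessThan_iff linorder_neqE_nat minimal)
    then show "distinct (map x [i..<j])" by (simp add: distinct_map)
    fix k assume "k < length (map x [i..<j])"
    then have k: "k < j - i" by simp
    have "map x [i..<j] ! (Suc k mod length (map x [i..<j])) = x (Suc (i + k))"
    proof (cases "Suc k = j - i")
      case True
      then have "Suc (i + k) = j" using i(1) by simp
      then show ?thesis using True i by (simp add: nth_append)
    next
      case False
      then have "Suc k < j - i" using k by simp
      then show ?thesis by simp
    qed
    moreover have "map x [i..<j] ! k = x (i + k)" using k by simp
    ultimately show "{map x [i..<j] ! k, map x [i..<j] ! (Suc k mod length (map x [i..<j]))} \<in> F"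
      using edge[of "i + k"] by simp
  qed
  then show ?thesis by blast
qed

lemma forest_reindex:
  assumes "forest E r c" "bij_betw \<eta> I E" and r': "\<And>i. i \<in> I \<Longrightarrow> r' i = r (\<eta> i)"
    and c': "\<And>i. i \<in> I \<Longrightarrow> c' i = c (\<eta> i)"
  shows "forest I r' c'"
  unfolding forest_def
proof (intro conjI allI impI)
  show "finite I" using assms(1,2) bij_betw_finite unfolding forest_def by blast
  fix F assume F: "F \<subseteq> I" "F \<noteq> {}"
  have inj: "\<eta> i = \<eta> j \<longleftrightarrow> i = j" if "i \<in> F" "j \<in> F" for i j
    using inj_onD[OF bij_betw_imp_inj_on[OF assms(2)]] that F(1) by blast
  have "\<eta> ` F \<subseteq> E" "\<eta> ` F \<noteq> {}" using F bij_betw_imp_surj_on[OF assms(2)] by auto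
  with assms(1) have "\<exists>e\<in>\<eta> ` F. (\<forall>e'\<in>\<eta> ` F. r e' = r e \<longrightarrow> e' = e) \<or> (\<forall>e'\<in>\<eta> ` F. c e' = c e \<longrightarrow> e' = e)"
    unfolding forest_def by blast
  then obtain i where i: "i \<in> F" and
    leaf: "(\<forall>j\<in>F. r (\<eta> j) = r (\<eta> i) \<longrightarrow> \<eta> j = \<eta> i) \<or> (\<forall>j\<in>F. c (\<eta> j) = c (\<eta> i) \<longrightarrow> \<eta> j = \<eta> i)"
    by blast
  have "(\<forall>j\<in>F. r (\<eta> j) = r (\<eta> i) \<longrightarrow> \<eta> j = \<eta> i) \<longleftrightarrow> (\<forall>j\<in>F. r' j = r' i \<longrightarrow> j = i)"
    "(\<forall>j\<in>F. c (\<eta> j) = c (\<eta> i) \<longrightarrow> \<eta> j = \<eta> i) \<longleftrightarrow> (\<forall>j\<in>F. c' j = c' i \<longrightarrow> j = i)"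
    using F(1) i by (auto simp: r' c' inj subset_iff)
  with leaf i show "\<exists>i\<in>F. (\<forall>j\<in>F. r' j = r' i \<longrightarrow> j = i) \<or> (\<forall>j\<in>F. c' j = c' i \<longrightarrow> j = i)"
    by (intro bexI[of _ i]) simp_all
qed

lemma matching_volume_cong:
  assumes "\<And>e. e \<in> E \<Longrightarrow> r e = r' e" "\<And>e. e \<in> E \<Longrightarrow> c e = c' e"
  shows "matching_volume E r c = matching_volume E r' c'"
proof -
  have "{e. e \<in> E \<and> r e = i} = {e. e \<in> E \<and> r' e = i}" "{e. e \<in> E \<and> c e = i} = {e. e \<in> E \<and> c' e = i}" for i
    using assms by auto
  then show ?thesis unfolding matching_volume_def fractional_matching_def by (simp only:)
qed

theorem theorem3p1:
  fixes V :: "'v set" and E :: "'v set set" and col :: "'v \<Rightarrow> colour"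
    and r c :: "'v \<Rightarrow> nat" and b :: "nat \<Rightarrow> nat \<times> nat"
  assumes "bipartitioned_forest V E col"
    and "vertex_numbering V col White r"
    and "vertex_numbering V col Black c"
    and "box_ordering (graph_diagram V E col r c) b"
  shows "real (complex_dim (specht_module (graph_diagram V E col r c) b)) = normalized_volume V E"
proof -
  let ?D = "graph_diagram V E col r c"
  let ?n = "card ?D"
  have finV: "finite V" and edge: "\<And>e. e \<in> E \<Longrightarrow> e \<subseteq> V \<and> card e = 2"
    and acyclic: "\<nexists>vs. is_cycle E vs" and proper: "proper_bicolouring V E col"
    using assms(1) unfolding bipartitioned_forest_def is_forest_def finite_simple_graph_def by auto
  have finE: "finite E" using finV edge by (intro finite_subset[of E "Pow V"]) auto
  have "\<exists>u v. u \<in> V \<and> v \<in> V \<and> col u = White \<and> col v = Black \<and> e = {u, v}" if e: "e \<in> E" for e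
  proof -
    obtain u v where uv: "e = {u, v}" "u \<in> V" "v \<in> V" using edge[OF e] by (auto simp: card_2_iff)
    then have "col u \<noteq> col v" using proper e unfolding proper_bicolouring_def by blast
    then show ?thesis using uv by (cases "col u"; cases "col v") (auto simp: insert_commute)
  qed
  then obtain wh bl where ends: "\<And>e. e \<in> E \<Longrightarrow> wh e \<in> V \<and> bl e \<in> V \<and> col (wh e) = White \<and>
      col (bl e) = Black \<and> e = {wh e, bl e}" by metis
  have r_inj: "u = u'" if "u \<in> V" "u' \<in> V" "col u = White" "col u' = White" "r u = r u'" for u u'
    using assms(2) that unfolding vertex_numbering_def inj_on_def by blast
  have c_inj: "u = u'" if "u \<in> V" "u' \<in> V" "col u = Black" "col u' = Black" "c u = c u'" for u u'
    using assms(3) that unfolding vertex_numbering_def inj_on_def by blast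
  let ?row = "r \<circ> wh" and ?column = "c \<circ> bl"
  have same_row: "?row e = ?row e' \<longleftrightarrow> wh e = wh e'" and same_column: "?column e = ?column e' \<longleftrightarrow> bl e = bl e'"
    if "e \<in> E" "e' \<in> E" for e e'
    using r_inj[of "wh e" "wh e'"] c_inj[of "bl e" "bl e'"] ends[OF that(1)] ends[OF that(2)] by auto
  have forest: "forest E ?row ?column"
    unfolding forest_def
  proof (intro conjI allI impI finE)
    fix F assume F: "F \<subseteq> E" "F \<noteq> {}"
    show "\<exists>e\<in>F. (\<forall>e'\<in>F. ?row e' = ?row e \<longrightarrow> e' = e) \<or> (\<forall>e'\<in>F. ?column e' = ?column e \<longrightarrow> e' = e)"
    proof (rule ccontr)
      assume "\<not> ?thesis"
      then have no_leaf: "\<exists>e'\<in>F. ?row e' = ?row e \<and> e' \<noteq> e" "\<exists>e'\<in>F. ?column e' = ?column e \<and> e' \<noteq> e"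
        if "e \<in> F" for e using that by blast+
      have "\<exists>vs. is_cycle F vs"
      proof (rule cycle_exists)
        show "finite F" using F(1) finE by (rule finite_subset)
        show "card e = 2" if "e \<in> F" for e using that F(1) edge by blast
        fix e v assume ev: "e \<in> F" "v \<in> e"
        then have eE: "e \<in> E" using F(1) by blast
        consider "v = wh e" | "v = bl e" using ev(2) ends[OF eE] by blast
        then show "\<exists>e'\<in>F. e' \<noteq> e \<and> v \<in> e'"
        proof cases
          case 1
          obtain e' where e': "e' \<in> F" "?row e' = ?row e" "e' \<noteq> e" using no_leaf(1)[OF ev(1)] by blast
          then have "e' \<in> E" using F(1) by blast
          then have "v \<in> e'" using same_row[OF _ eE] e'(2) 1 ends[of e'] by (metis insertI1)
          then show ?thesis using e' by blast
        next
          case 2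
          obtain e' where e': "e' \<in> F" "?column e' = ?column e" "e' \<noteq> e" using no_leaf(2)[OF ev(1)] by blast
          then have "e' \<in> E" using F(1) by blast
          then have "v \<in> e'" using same_column[OF _ eE] e'(2) 2 ends[of e'] by (metis insertI1 insertI2)
          then show ?thesis using e' by blast
        qed
      qed (rule F(2))
      then obtain vs where "is_cycle F vs" by blast
      then have "is_cycle E vs" using F(1) unfolding is_cycle_def by blast
      then show False using acyclic by blast
    qed
  qed
  define box where "box e = (?row e, ?column e)" for e
  have box: "bij_betw box E ?D"
  proof (rule bij_betw_imageI)
    show "inj_on box E"
    proof (rule inj_onI)
      fix e e' assume ee': "e \<in> E" "e' \<in> E" "box e = box e'"
      then have "wh e = wh e'" "bl e = bl e'" using same_row[OF ee'(1,2)] same_column[OF ee'(1,2)] by (auto simp: box_def)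
      then show "e = e'" using ends[OF ee'(1)] ends[OF ee'(2)] by metis
    qed
    show "box ` E = ?D"
    proof
      show "box ` E \<subseteq> ?D"
      proof
        fix d assume "d \<in> box ` E"
        then obtain e where e: "e \<in> E" "d = box e" by blast
        then have "d = (r (wh e), c (bl e))" "{wh e, bl e} \<in> E" using ends[OF e(1)] by (auto simp: box_def)
        then show "d \<in> ?D" unfolding graph_diagram_def using ends[OF e(1)] by blast
      qed
      show "?D \<subseteq> box ` E"
      proof
        fix d assume "d \<in> ?D"
        then obtain u v where uv: "d = (r u, c v)" "col u = White" "col v = Black" "{u, v} \<in> E"
          unfolding graph_diagram_def by blast
        have "{u, v} = {wh {u, v}, bl {u, v}}" "col (wh {u, v}) = White" "col (bl {u, v}) = Black"
          using ends[OF uv(4)] by blast+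
        then have "wh {u, v} = u" "bl {u, v} = v" using uv(2,3) by (metis colour.distinct(1) doubleton_eq_iff)+
        then have "d = box {u, v}" using uv(1) by (simp add: box_def)
        then show "d \<in> box ` E" using uv(4) by blast
      qed
    qed
  qed
  \<comment> \<open>The numbering of the edges that corresponds to the ordering of the boxes.\<close>
  define \<eta> where "\<eta> = inv_into E box \<circ> b"
  have b: "bij_betw b {1..?n} ?D" using assms(4) by (simp add: box_ordering_def)
  have \<eta>: "bij_betw \<eta> {1..?n} E" unfolding \<eta>_def by (rule bij_betw_trans[OF b bij_betw_inv_into[OF box]])
  have box_\<eta>: "box (\<eta> k) = b k" if "k \<in> {1..?n}" for k
    using bij_betw_inv_into_right[OF box] bij_betwE[OF b] that by (simp add: \<eta>_def)
  have b_fst: "(fst \<circ> b) k = ?row (\<eta> k)" and b_snd: "(snd \<circ> b) k = ?column (\<eta> k)" if "k \<in> {1..?n}" for k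
    using box_\<eta>[OF that, symmetric] by (simp_all only: o_apply box_def fst_conv snd_conv)
  have "forest {1..?n} (fst \<circ> b) (snd \<circ> b)"
    by (rule forest_reindex[OF forest \<eta> b_fst b_snd])
  then have "real (complex_dim (specht_module ?D b)) = fact ?n * matching_volume {1..?n} (fst \<circ> b) (snd \<circ> b)"
    unfolding specht_module_eq_ideal by (rule dim_eq_volume)
  also have "matching_volume {1..?n} (fst \<circ> b) (snd \<circ> b) = matching_volume {1..?n} (?row \<circ> \<eta>) (?column \<circ> \<eta>)"
  proof (rule matching_volume_cong)
    fix k assume "k \<in> {1..?n}"
    then show "(fst \<circ> b) k = (?row \<circ> \<eta>) k" "(snd \<circ> b) k = (?column \<circ> \<eta>) k"
      using b_fst b_snd by (simp_all only: o_apply)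
  qed
  also have "\<dots> = matching_volume E ?row ?column"
    by (rule matching_volume_reindex[OF \<eta>, symmetric]) simp
  also have "\<dots> = measure (\<Pi>\<^sub>M e\<in>E. lborel) {w \<in> E \<rightarrow>\<^sub>E UNIV. fractional_matching E ?row ?column w}"
    by (rule lebesgue_measure_fractional_matchings[OF finE, symmetric])
  also have "{w \<in> E \<rightarrow>\<^sub>E UNIV. fractional_matching E ?row ?column w} = matching_polytope V E"
  proof -
    have white: "{e. e \<in> E \<and> v \<in> e} = {e. e \<in> E \<and> ?row e = r v}" if "v \<in> V" "col v = White" for v
    proof -
      have "v \<in> e \<longleftrightarrow> ?row e = r v" if e: "e \<in> E" for e
      proof -
        have "v \<in> e \<longleftrightarrow> v = wh e" using ends[OF e] \<open>col v = White\<close> by (metis colour.distinct(1) insertE insertI1 singletonD)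
        then show ?thesis using r_inj[of "wh e" v] ends[OF e] \<open>v \<in> V\<close> \<open>col v = White\<close> by auto
      qed
      then show ?thesis by auto
    qed
    have black: "{e. e \<in> E \<and> v \<in> e} = {e. e \<in> E \<and> ?column e = c v}" if "v \<in> V" "col v = Black" for v
    proof -
      have "v \<in> e \<longleftrightarrow> ?column e = c v" if e: "e \<in> E" for e
      proof -
        have "v \<in> e \<longleftrightarrow> v = bl e" using ends[OF e] \<open>col v = Black\<close> by (metis colour.distinct(1) insertE insertI1 insertI2 singletonD)
        then show ?thesis using c_inj[of "bl e" v] ends[OF e] \<open>v \<in> V\<close> \<open>col v = Black\<close> by auto
      qed
      then show ?thesis by auto
    qed
    let ?sum = "\<lambda>w f k. \<Sum>e | e \<in> E \<and> f e = k. w e"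
    have "(\<forall>v\<in>V. (\<Sum>e | e \<in> E \<and> v \<in> e. w e) \<le> 1) \<longleftrightarrow>
        (\<forall>i. ?sum w ?row i \<le> 1) \<and> (\<forall>j. ?sum w ?column j \<le> 1)"
      for w :: "'v set \<Rightarrow> real"
    proof (intro iffI conjI allI ballI)
      assume vertex: "\<forall>v\<in>V. (\<Sum>e | e \<in> E \<and> v \<in> e. w e) \<le> 1"
      have unmet: "?sum w f k \<le> 1" if "k \<notin> f ` E" for f :: "'v set \<Rightarrow> nat" and k
      proof -
        have empty: "{e. e \<in> E \<and> f e = k} = {}" using that by blast
        show ?thesis unfolding empty by simp
      qed
      show "?sum w ?row i \<le> 1" for i
      proof (cases "i \<in> ?row ` E")
        case True
        then obtain e where e: "e \<in> E" "i = r (wh e)" by auto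
        show ?thesis using vertex ends[OF e(1)] white[of "wh e"] unfolding e(2) by metis
      qed (rule unmet)
      show "?sum w ?column j \<le> 1" for j
      proof (cases "j \<in> ?column ` E")
        case True
        then obtain e where e: "e \<in> E" "j = c (bl e)" by auto
        show ?thesis using vertex ends[OF e(1)] black[of "bl e"] unfolding e(2) by metis
      qed (rule unmet)
    next
      fix v assume sums: "(\<forall>i. ?sum w ?row i \<le> 1) \<and> (\<forall>j. ?sum w ?column j \<le> 1)" and v: "v \<in> V"
      show "(\<Sum>e | e \<in> E \<and> v \<in> e. w e) \<le> 1"
      proof (cases "col v")
        case White
        show ?thesis unfolding white[OF v White] using sums by blast
      next
        case Black
        show ?thesis unfolding black[OF v Black] using sums by blast
      qed
    qed
    then show ?thesis unfolding matching_polytope_def fractional_matching_def by simp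
  qed
  also have "fact ?n * measure (\<Pi>\<^sub>M e\<in>E. lborel) (matching_polytope V E) = normalized_volume V E"
    unfolding normalized_volume_def using bij_betw_same_card[OF box] by simp
  finally show ?thesis .
qed

end
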